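(* Let $m\ge 2$ and let $F:M^m\to\mathbb{R}^n$ be a smooth immersion of a compact $m$-dimensional manifold (without boundary) which is a self-shrinker, i.e. $H=-F^\perp$. Then $M$ is spherical (i.e. $F(M)$ is contained in a sphere of $\mathbb{R}^n$) if and only if the mean curvature vector $H$ vanishes nowhere on $M$ and the principal normal $\nu=H/|H|$ is parallel in the normal bundle, $\nabla^\perp\nu=0$.
   Context: For a smooth immersion $F:M^m\to\mathbb{R}^n$, equip $M$ with the induced metric $g$. The second fundamental form is $A=\nabla dF$, a symmetric bilinear form on $TM$ with values in the normal bundle $NM$; the mean curvature vector is $H=\operatorname{tr}_g A$ (not normalized by $1/m$). $F^\perp$ denotes the projection of the position vector $F$ onto the normal bundle. $\nabla^\perp$ is the connection on the normal bundle. $F$ is called a self-shrinker if $H=-F^\perp$. Where $H\neq 0$, the principal normal is $\nu:=H/|H|$. *)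

theory Defs
  imports "HOL-Analysis.Analysis"
begin

subsection \<open>Smooth maps on open subsets of Euclidean space\<close>

primrec Ck_on ::
  "nat \<Rightarrow> ('a::euclidean_space \<Rightarrow> 'b::real_normed_vector) \<Rightarrow> 'a set \<Rightarrow> bool" where
  "Ck_on 0 f S \<longleftrightarrow> continuous_on S f"
| "Ck_on (Suc k) f S \<longleftrightarrow>
     (\<forall>x\<in>S. f differentiable (at x)) \<and>
     (\<forall>v. Ck_on k (\<lambda>x. frechet_derivative f (at x) v) S)"

definition smooth_on :: "('a::euclidean_space \<Rightarrow> 'b::real_normed_vector) \<Rightarrow> 'a set \<Rightarrow> bool" where
  "smooth_on f S \<longleftrightarrow> open S \<and> (\<forall>k. Ck_on k f S)"

definition partial_deriv :: "'m \<Rightarrow> (real^'m::finite \<Rightarrow> 'b::real_normed_vector) \<Rightarrow> real^'m \<Rightarrow> 'b" where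
  "partial_deriv i f x = frechet_derivative f (at x) (axis i 1)"

subsection \<open>Smooth manifolds without boundary\<close>

type_synonym ('a, 'm) chart = "'a set \<times> ('a \<Rightarrow> real^'m)"

definition chart_dom :: "('a, 'm) chart \<Rightarrow> 'a set" where
  "chart_dom c = fst c"

definition chart_map :: "('a, 'm) chart \<Rightarrow> 'a \<Rightarrow> real^'m" where
  "chart_map c = snd c"

definition chart_image :: "('a, 'm) chart \<Rightarrow> (real^'m) set" where
  "chart_image c = chart_map c ` chart_dom c"

text \<open>The map \<open>f\<close> read in the chart \<open>c\<close>; meaningful on \<open>chart_image c\<close> only.\<close>

definition in_chart :: "('a, 'm) chart \<Rightarrow> ('a \<Rightarrow> 'b) \<Rightarrow> real^'m \<Rightarrow> 'b" where
  "in_chart c f = f \<circ> inv_into (chart_dom c) (chart_map c)"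

definition is_chart :: "'a topology \<Rightarrow> ('a, 'm::finite) chart \<Rightarrow> bool" where
  "is_chart M c \<longleftrightarrow>
     openin M (chart_dom c) \<and> open (chart_image c) \<and>
     homeomorphic_map (subtopology M (chart_dom c)) (top_of_set (chart_image c)) (chart_map c)"

definition smooth_manifold :: "'a topology \<Rightarrow> ('a, 'm::finite) chart set \<Rightarrow> bool" where
  "smooth_manifold M \<A> \<longleftrightarrow>
     Hausdorff_space M \<and> second_countable M \<and>
     (\<forall>c\<in>\<A>. is_chart M c) \<and>
     (\<Union>c\<in>\<A>. chart_dom c) = topspace M \<and>
     (\<forall>c\<in>\<A>. \<forall>d\<in>\<A>.
        smooth_on (in_chart c (chart_map d)) (chart_map c ` (chart_dom c \<inter> chart_dom d)))"

definition smooth_immersion ::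
  "('a, 'm::finite) chart set \<Rightarrow> ('a \<Rightarrow> real^'n::finite) \<Rightarrow> bool" where
  "smooth_immersion \<A> F \<longleftrightarrow>
     (\<forall>c\<in>\<A>. smooth_on (in_chart c F) (chart_image c) \<and>
       (\<forall>x\<in>chart_image c. inj (frechet_derivative (in_chart c F) (at x))))"

subsection \<open>Geometry of an immersion in local coordinates\<close>

text \<open>
  Here \<open>X\<close> is an immersion read in a chart, and \<open>x\<close> a point of the chart image.
\<close>

definition induced_metric :: "(real^'m::finite \<Rightarrow> real^'n::finite) \<Rightarrow> real^'m \<Rightarrow> real^'m^'m" where
  "induced_metric X x = (\<chi> i j. partial_deriv i X x \<bullet> partial_deriv j X x)"

definition inverse_metric :: "(real^'m::finite \<Rightarrow> real^'n::finite) \<Rightarrow> real^'m \<Rightarrow> real^'m^'m" where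
  "inverse_metric X x = matrix_inv (induced_metric X x)"

text \<open>The symbol \<open>\<Gamma>\<^sup>k\<^sub>i\<^sub>j\<close> of the Levi-Civita connection of the induced metric.\<close>

definition christoffel ::
  "(real^'m::finite \<Rightarrow> real^'n::finite) \<Rightarrow> 'm \<Rightarrow> 'm \<Rightarrow> 'm \<Rightarrow> real^'m \<Rightarrow> real" where
  "christoffel X k i j x =
     1/2 * (\<Sum>l\<in>UNIV. inverse_metric X x $ k $ l *
       (partial_deriv i (\<lambda>y. induced_metric X y $ j $ l) x +
        partial_deriv j (\<lambda>y. induced_metric X y $ i $ l) x -
        partial_deriv l (\<lambda>y. induced_metric X y $ i $ j) x))"

text \<open>
  The component \<open>A\<^sub>i\<^sub>j\<close> of \<open>A = \<nabla>dX\<close>, where \<open>\<nabla>\<close> is induced by the Levi-Civita connection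
  on the domain and the flat connection on the ambient space.
\<close>

definition second_fundamental_form ::
  "(real^'m::finite \<Rightarrow> real^'n::finite) \<Rightarrow> 'm \<Rightarrow> 'm \<Rightarrow> real^'m \<Rightarrow> real^'n" where
  "second_fundamental_form X i j x =
     partial_deriv i (partial_deriv j X) x -
     (\<Sum>k\<in>UNIV. christoffel X k i j x *\<^sub>R partial_deriv k X x)"

definition mean_curvature ::
  "(real^'m::finite \<Rightarrow> real^'n::finite) \<Rightarrow> real^'m \<Rightarrow> real^'n" where
  "mean_curvature X x =
     (\<Sum>i\<in>UNIV. \<Sum>j\<in>UNIV. inverse_metric X x $ i $ j *\<^sub>R second_fundamental_form X i j x)"

definition tangent_space ::
  "(real^'m::finite \<Rightarrow> real^'n::finite) \<Rightarrow> real^'m \<Rightarrow> (real^'n) set" where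
  "tangent_space X x = range (frechet_derivative X (at x))"

definition normal_space ::
  "(real^'m::finite \<Rightarrow> real^'n::finite) \<Rightarrow> real^'m \<Rightarrow> (real^'n) set" where
  "normal_space X x = orthogonal_comp (tangent_space X x)"

text \<open>Orthogonal projection of an ambient vector onto the normal space at \<open>x\<close>.\<close>

definition normal_part ::
  "(real^'m::finite \<Rightarrow> real^'n::finite) \<Rightarrow> real^'m \<Rightarrow> real^'n \<Rightarrow> real^'n" where
  "normal_part X x v = (THE w. w \<in> normal_space X x \<and> v - w \<in> tangent_space X x)"

definition principal_normal ::
  "(real^'m::finite \<Rightarrow> real^'n::finite) \<Rightarrow> real^'m \<Rightarrow> real^'n" where
  "principal_normal X x = mean_curvature X x /\<^sub>R norm (mean_curvature X x)"

text \<open>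
  The normal connection \<open>\<nabla>\<^sup>\<bottom>\<^sub>i \<xi> = (\<partial>\<^sub>i \<xi>)\<^sup>\<bottom>\<close> applied to a section \<open>\<xi>\<close> of the normal bundle.
\<close>

definition normal_connection ::
  "(real^'m::finite \<Rightarrow> real^'n::finite) \<Rightarrow> 'm \<Rightarrow> (real^'m \<Rightarrow> real^'n) \<Rightarrow> real^'m \<Rightarrow> real^'n" where
  "normal_connection X i \<xi> x = normal_part X x (partial_deriv i \<xi> x)"

lemma normal_part_unique:
  assumes "X differentiable (at x)"
  shows "\<exists>!w. w \<in> normal_space X x \<and> v - w \<in> tangent_space X x"
proof -
  have "linear (frechet_derivative X (at x))"
    using assms linear_frechet_derivative by blast
  then have T: "subspace (tangent_space X x)"
    unfolding tangent_space_def by (simp add: linear_subspace_image)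
  then have sp: "span (tangent_space X x) = tangent_space X x"
    by (simp add: span_eq_iff)
  obtain y z where yz: "y \<in> tangent_space X x"
      "\<And>w. w \<in> tangent_space X x \<Longrightarrow> orthogonal z w" "v = y + z"
    using orthogonal_subspace_decomp_exists[of "tangent_space X x" v] sp by metis
  show ?thesis
  proof (rule ex1I[of _ z])
    show "z \<in> normal_space X x \<and> v - z \<in> tangent_space X x"
      using yz by (auto simp: normal_space_def orthogonal_comp_def orthogonal_commute)
  next
    fix w assume w: "w \<in> normal_space X x \<and> v - w \<in> tangent_space X x"
    have "(v - w) - y \<in> tangent_space X x"
      using w yz(1) T by (simp add: subspace_diff)
    then have d: "z - w \<in> tangent_space X x"
      using yz(3) by (simp add: algebra_simps)
    have "orthogonal z (z - w)" "orthogonal w (z - w)"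
      using yz(2)[OF d] w d
      by (auto simp: normal_space_def orthogonal_comp_def orthogonal_commute)
    then have "(z - w) \<bullet> (z - w) = 0"
      by (simp add: orthogonal_def inner_diff_left)
    then show "w = z" by simp
  qed
qed

subsection \<open>Global notions\<close>

text \<open>
  \<open>H\<close>, \<open>F\<^sup>\<bottom>\<close>, \<open>\<nu>\<close> and \<open>\<nabla>\<^sup>\<bottom>\<close> do not depend on the choice of coordinates, so that conditions
  on them are imposed in every chart of the atlas.
\<close>

definition self_shrinker ::
  "('a, 'm::finite) chart set \<Rightarrow> ('a \<Rightarrow> real^'n::finite) \<Rightarrow> bool" where
  "self_shrinker \<A> F \<longleftrightarrow>
     (\<forall>c\<in>\<A>. \<forall>x\<in>chart_image c.
        mean_curvature (in_chart c F) x = - normal_part (in_chart c F) x (in_chart c F x))"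

definition mean_curvature_nowhere_zero ::
  "('a, 'm::finite) chart set \<Rightarrow> ('a \<Rightarrow> real^'n::finite) \<Rightarrow> bool" where
  "mean_curvature_nowhere_zero \<A> F \<longleftrightarrow>
     (\<forall>c\<in>\<A>. \<forall>x\<in>chart_image c. mean_curvature (in_chart c F) x \<noteq> 0)"

definition parallel_principal_normal ::
  "('a, 'm::finite) chart set \<Rightarrow> ('a \<Rightarrow> real^'n::finite) \<Rightarrow> bool" where
  "parallel_principal_normal \<A> F \<longleftrightarrow>
     (\<forall>c\<in>\<A>. \<forall>x\<in>chart_image c. \<forall>i.
        normal_connection (in_chart c F) i (principal_normal (in_chart c F)) x = 0)"

definition spherical :: "'a topology \<Rightarrow> ('a \<Rightarrow> real^'n::finite) \<Rightarrow> bool" where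
  "spherical M F \<longleftrightarrow> (\<exists>a r. r > 0 \<and> F ` topspace M \<subseteq> sphere a r)"

end

(* Write H = h nu with h > 0 and nu parallel, let W be the shape operator of nu, S = W/h, and let u = |S|^2.
   Codazzi, Ricci and Simons' identity turn the shrinker equation into L u = 2 |DS|^2 >= 0, where
   L = Laplacian - F^T . D + 2 (D log h) . D.  At a maximum of u the tensor S is parallel, and Codazzi
   then forces either D log h = 0 or S of rank one (u = 1).  If s = max u exceeded 1/m, the function
   E = exp (|F|^2/2 - (log h)/s) would satisfy L E > 0 near the maximum set of u, so that the weak maximum
   principle for u + epsilon E gives a contradiction; thus neither connectedness nor the strong
   maximum principle is needed.  Hence u = 1/m, h is locally constant, |W| = 1, h^2 = m, and comparing
   |F|^2 >= h^2 with its maximum yields |F|^2 = m.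
   Conversely, on a sphere with centre a one gets <F, F - a> = m, so |F| is locally constant and H = -F. *)
theory Submission
  imports Defs
begin

subsection \<open>Calculus of smooth maps\<close>

text \<open>In codimension above one the second fundamental form A has components orthogonal to nu
  that are controlled only through their trace, and they enter Simons' identity. Two facts remove
  them. The Ricci equation of the parallel nu cancels one cross term. The shrinker equation F + h nu
  = F^T, differentiated twice, traced and paired with an arbitrary normal vector, shows that V = sum
  W_pk A_pk is a multiple of nu, whence |V|^2 = |W|^4. In E the weight 1 of |F|^2/2 makes the square
  |F^T|^2 from the exponential cancel against the drift, and the weight 1/s of log h makes the h^2
  term of L E / E vanish where u = s. There remain m - 1/s and gradient terms with the factor 1 -
  1/s; the alternative D log h = 0 or u = 1 kills the latter. The bound u >= 1/m is Cauchy-Schwarz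
  for tr W = h. The dimension matters once u = 1/m is known: m >= 2 excludes u = 1 and so forces D
  log h = 0. For m = 1 one always has u = 1, and the non-circular closed Abresch-Langer curves
  satisfy the other conditions.\<close>

lemma Ck_on_cong:
  assumes "open S" "\<And>x. x \<in> S \<Longrightarrow> f x = g x"
  shows "Ck_on k f S \<longleftrightarrow> Ck_on k g S"
  using assms(2)
proof (induction k arbitrary: f g)
  case 0
  then show ?case by (simp cong: continuous_on_cong)
next
  case (Suc k)
  have der: "(f has_derivative D) (at x) \<longleftrightarrow> (g has_derivative D) (at x)" if "x \<in> S" for x D
    using that Suc.prems assms(1)
    by (metis (full_types) has_derivative_transform_within_open)
  have "f differentiable (at x) \<longleftrightarrow> g differentiable (at x)" if "x \<in> S" for x
    using der[OF that] by (simp add: differentiable_def)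
  moreover have "frechet_derivative f (at x) = frechet_derivative g (at x)" if "x \<in> S" for x
    using der[OF that] by (simp add: frechet_derivative_def)
  ultimately show ?case
    using Suc.IH by (metis (no_types, lifting) Ck_on.simps(2))
qed

lemma Ck_on_SucD: "Ck_on (Suc k) f S \<Longrightarrow> Ck_on k f S"
proof (induction k arbitrary: f)
  case 0
  then show ?case
    by (simp add: continuous_at_imp_continuous_on differentiable_imp_continuous_within)
next
  case (Suc k)
  then show ?case by (metis Ck_on.simps(2))
qed

text \<open>\<open>frechet_derivative\<close> is a choice operator, so the recursion of
  \<open>Ck_on\<close> does not unfold on explicit formulas. This rule accepts any known derivative
  instead, and the closure rules below go through it.\<close>

lemma Ck_on_SucI:
  assumes "open S" "\<And>x. x \<in> S \<Longrightarrow> (f has_derivative f' x) (at x)"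
    and "\<And>v. Ck_on k (\<lambda>x. f' x v) S"
  shows "Ck_on (Suc k) f S"
proof -
  have "frechet_derivative f (at x) = f' x" if "x \<in> S" for x
    using assms(2)[OF that] frechet_derivative_at by metis
  then have "Ck_on k (\<lambda>x. frechet_derivative f (at x) v) S" for v
    using Ck_on_cong[OF assms(1), of "\<lambda>x. f' x v" "\<lambda>x. frechet_derivative f (at x) v" k] assms(3)
    by simp
  then show ?thesis
    using assms(2) by (auto simp: differentiable_def)
qed

lemma Ck_on_has_derivative:
  assumes "Ck_on (Suc k) f S" "x \<in> S"
  shows "(f has_derivative frechet_derivative f (at x)) (at x)"
  using assms by (simp add: frechet_derivative_works)

lemma Ck_on_const: "open S \<Longrightarrow> Ck_on k (\<lambda>x. c) S"
proof (induction k arbitrary: c)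
  case (Suc k)
  show ?case
    by (rule Ck_on_SucI[of _ _ "\<lambda>x v. 0"]) (use Suc in auto)
qed auto

lemma Ck_on_bounded_linear:
  assumes "bounded_linear L" "open S" "Ck_on k f S"
  shows "Ck_on k (\<lambda>x. L (f x)) S"
  using assms(3)
proof (induction k arbitrary: f)
  case 0
  then show ?case
    using assms(1) by (simp add: bounded_linear.continuous_on)
next
  case (Suc k)
  show ?case
    by (rule Ck_on_SucI[where f' = "\<lambda>x v. L (frechet_derivative f (at x) v)"])
       (use Suc assms in \<open>auto intro!: bounded_linear.has_derivative[OF assms(1)]
           Ck_on_has_derivative\<close>)
qed

lemma Ck_on_add:
  assumes "open S" "Ck_on k f S" "Ck_on k g S"
  shows "Ck_on k (\<lambda>x. f x + g x) S"
  using assms(2,3)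
proof (induction k arbitrary: f g)
  case 0
  then show ?case by (simp add: continuous_on_add)
next
  case (Suc k)
  show ?case
    by (rule Ck_on_SucI[where
          f' = "\<lambda>x v. frechet_derivative f (at x) v + frechet_derivative g (at x) v"])
       (use Suc assms in \<open>auto intro!: has_derivative_add Ck_on_has_derivative\<close>)
qed

text \<open>One Leibniz rule serves products, inner products and scalar multiples, which are
  obtained below as instances.\<close>

lemma Ck_on_bounded_bilinear:
  assumes "bounded_bilinear P" "open S" "Ck_on k f S" "Ck_on k g S"
  shows "Ck_on k (\<lambda>x. P (f x) (g x)) S"
  using assms(3,4)
proof (induction k arbitrary: f g)
  case 0
  then show ?case
    using assms(1) by (simp add: bounded_bilinear.continuous_on)
next
  case (Suc k)
  show ?case
  proof (rule Ck_on_SucI[where f' = "\<lambda>x v. P (f x) (frechet_derivative g (at x) v)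
           + P (frechet_derivative f (at x) v) (g x)"])
    show "open S" by fact
    show "((\<lambda>x. P (f x) (g x)) has_derivative
           (\<lambda>v. P (f x) (frechet_derivative g (at x) v) +
                P (frechet_derivative f (at x) v) (g x))) (at x)" if "x \<in> S" for x
      using Suc.prems that
      by (intro bounded_bilinear.FDERIV[OF assms(1)] Ck_on_has_derivative)
    show "Ck_on k (\<lambda>x. P (f x) (frechet_derivative g (at x) v) +
                P (frechet_derivative f (at x) v) (g x)) S" for v
      using Suc.prems Ck_on_SucD[OF Suc.prems(1)] Ck_on_SucD[OF Suc.prems(2)]
      by (intro Ck_on_add assms(2) Suc.IH) auto
  qed
qed

lemma Ck_on_sum:
  assumes "open S" "\<And>i. i \<in> I \<Longrightarrow> Ck_on k (f i) S"
  shows "Ck_on k (\<lambda>x. \<Sum>i\<in>I. f i x) S"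
  using assms(2)
proof (induction I rule: infinite_finite_induct)
  case (insert i I)
  then show ?case by (simp add: Ck_on_add assms(1))
qed (auto intro: Ck_on_const assms(1))

text \<open>In v -> Df(g x)(Dg x v) the point x occurs both in the linear map and in its argument.
  Expanding Dg x v in the standard basis separates the two: the derivative becomes a finite sum of
  products of functions already known to be \<open>Ck_on k\<close>.\<close>

lemma Ck_on_compose:
  fixes f :: "'b::euclidean_space \<Rightarrow> 'c::real_normed_vector"
    and g :: "'a::euclidean_space \<Rightarrow> 'b"
  assumes "open S" "g ` S \<subseteq> T" "Ck_on k f T" "Ck_on k g S"
  shows "Ck_on k (\<lambda>x. f (g x)) S"
  using assms(3,4)
proof (induction k arbitrary: f)
  case 0
  then show ?case
    using assms(2) by (auto intro: continuous_on_compose2)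
next
  case (Suc k)
  let ?f' = "\<lambda>x. frechet_derivative f (at x)" and ?g' = "\<lambda>x. frechet_derivative g (at x)"
  show ?case
  proof (rule Ck_on_SucI[where f' = "\<lambda>x v. \<Sum>b\<in>Basis. (?g' x v \<bullet> b) *\<^sub>R ?f' (g x) b"])
    show "open S" by fact
    show "((\<lambda>x. f (g x)) has_derivative
           (\<lambda>v. \<Sum>b\<in>Basis. (?g' x v \<bullet> b) *\<^sub>R ?f' (g x) b)) (at x)" if "x \<in> S" for x
    proof -
      have f: "(f has_derivative ?f' (g x)) (at (g x))"
        using Suc.prems(1) that assms(2) by (intro Ck_on_has_derivative) auto
      have g: "(g has_derivative ?g' x) (at x)"
        using Suc.prems(2) that by (intro Ck_on_has_derivative) auto
      have lin: "linear (?f' (g x))"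
        using f has_derivative_linear by blast
      have "?f' (g x) (?g' x v) = (\<Sum>b\<in>Basis. (?g' x v \<bullet> b) *\<^sub>R ?f' (g x) b)" for v
        by (subst (1) euclidean_representation[symmetric, of "?g' x v"])
           (simp add: linear_sum[OF lin] linear_scale[OF lin])
      with has_derivative_compose[OF g f] show ?thesis
        by simp
    qed
    have "Ck_on k g S"
      using Ck_on_SucD[OF Suc.prems(2)] .
    then have "Ck_on k (\<lambda>x. ?f' (g x) b) S" for b
      using Suc.prems(1) by (intro Suc.IH) auto
    moreover have "Ck_on k (\<lambda>x. ?g' x v \<bullet> b) S" for v b
      using Suc.prems(2) assms(1)
      by (intro Ck_on_bounded_linear[OF bounded_linear_inner_left]) auto
    ultimately show "Ck_on k (\<lambda>x. \<Sum>b\<in>Basis. (?g' x v \<bullet> b) *\<^sub>R ?f' (g x) b) S" for v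
      by (intro Ck_on_sum assms(1) Ck_on_bounded_bilinear[OF bounded_bilinear_scaleR])
  qed
qed

section \<open>Closure properties of smooth maps\<close>

lemma smooth_onI: "open S \<Longrightarrow> (\<And>k. Ck_on k f S) \<Longrightarrow> smooth_on f S"
  by (simp add: smooth_on_def)

lemma smooth_on_open: "smooth_on f S \<Longrightarrow> open S"
  by (simp add: smooth_on_def)

lemma smooth_on_Ck: "smooth_on f S \<Longrightarrow> Ck_on k f S"
  by (simp add: smooth_on_def)

lemma smooth_on_continuous_on: "smooth_on f S \<Longrightarrow> continuous_on S f"
  using smooth_on_Ck[of f S 0] by simp

lemma smooth_on_has_derivative:
  "smooth_on f S \<Longrightarrow> x \<in> S \<Longrightarrow> (f has_derivative frechet_derivative f (at x)) (at x)"
  using smooth_on_Ck[of f S "Suc 0"] Ck_on_has_derivative by blast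

lemma smooth_on_cong:
  "smooth_on f S \<Longrightarrow> (\<And>x. x \<in> S \<Longrightarrow> f x = g x) \<Longrightarrow> smooth_on g S"
  unfolding smooth_on_def using Ck_on_cong by blast

lemma smooth_on_frechet_derivative:
  "smooth_on f S \<Longrightarrow> smooth_on (\<lambda>x. frechet_derivative f (at x) v) S"
  unfolding smooth_on_def using Ck_on.simps(2) by blast

lemma smooth_on_subset:
  assumes "smooth_on f S" "open T" "T \<subseteq> S"
  shows "smooth_on f T"
proof -
  have "Ck_on k f S \<Longrightarrow> Ck_on k f T" for k
  proof (induction k arbitrary: f)
    case 0
    then show ?case using assms(3) by (auto intro: continuous_on_subset)
  qed (use assms(3) in auto)
  then show ?thesis using assms by (simp add: smooth_on_def)
qed

lemma smooth_on_const: "open S \<Longrightarrow> smooth_on (\<lambda>x. c) S"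
  by (simp add: smooth_on_def Ck_on_const)

lemma smooth_on_ident: "open S \<Longrightarrow> smooth_on (\<lambda>x. x) S"
proof (rule smooth_onI)
  assume "open S"
  fix k
  show "Ck_on k (\<lambda>x. x) S"
  proof (cases k)
    case (Suc l)
    show ?thesis unfolding Suc
      by (rule Ck_on_SucI[where f' = "\<lambda>x v. v"]) (auto intro: \<open>open S\<close> Ck_on_const)
  qed auto
qed

lemma smooth_on_bounded_linear:
  "bounded_linear L \<Longrightarrow> smooth_on f S \<Longrightarrow> smooth_on (\<lambda>x. L (f x)) S"
  by (simp add: smooth_on_def Ck_on_bounded_linear)

lemma smooth_on_bounded_bilinear:
  "bounded_bilinear P \<Longrightarrow> smooth_on f S \<Longrightarrow> smooth_on g S \<Longrightarrow> smooth_on (\<lambda>x. P (f x) (g x)) S"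
  by (simp add: smooth_on_def Ck_on_bounded_bilinear)

lemma smooth_on_add:
  "smooth_on f S \<Longrightarrow> smooth_on g S \<Longrightarrow> smooth_on (\<lambda>x. f x + g x) S"
  by (simp add: smooth_on_def Ck_on_add)

lemma smooth_on_sum:
  "open S \<Longrightarrow> (\<And>i. i \<in> I \<Longrightarrow> smooth_on (f i) S) \<Longrightarrow> smooth_on (\<lambda>x. \<Sum>i\<in>I. f i x) S"
  by (simp add: smooth_on_def Ck_on_sum)

lemmas smooth_on_scaleR = smooth_on_bounded_bilinear[OF bounded_bilinear_scaleR]
lemmas smooth_on_inner = smooth_on_bounded_bilinear[OF bounded_bilinear_inner]
lemmas smooth_on_mult = smooth_on_bounded_bilinear[OF bounded_bilinear_mult]
lemmas smooth_on_minus = smooth_on_bounded_linear[OF bounded_linear_minus[OF bounded_linear_ident]]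
lemmas smooth_on_vec_nth = smooth_on_bounded_linear[OF bounded_linear_vec_nth]

lemma smooth_on_diff:
  fixes f :: "_ \<Rightarrow> 'b::real_normed_vector"
  shows "smooth_on f S \<Longrightarrow> smooth_on g S \<Longrightarrow> smooth_on (\<lambda>x. f x - g x) S"
  using smooth_on_add[OF _ smooth_on_minus, of f S g] by simp

lemma smooth_on_prod:
  fixes f :: "'i \<Rightarrow> 'a::euclidean_space \<Rightarrow> real"
  assumes "open S" "\<And>i. i \<in> I \<Longrightarrow> smooth_on (f i) S"
  shows "smooth_on (\<lambda>x. \<Prod>i\<in>I. f i x) S"
  using assms(2)
proof (induction I rule: infinite_finite_induct)
  case (insert i I)
  then show ?case by (simp add: smooth_on_mult)
qed (auto intro: smooth_on_const assms(1))

lemma smooth_on_compose: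
  fixes f :: "'b::euclidean_space \<Rightarrow> 'c::real_normed_vector"
    and g :: "'a::euclidean_space \<Rightarrow> 'b"
  assumes "smooth_on f T" "smooth_on g S" "g ` S \<subseteq> T"
  shows "smooth_on (\<lambda>x. f (g x)) S"
  using assms Ck_on_compose by (metis smooth_on_def)

lemma Ck_on_real_SucI:
  fixes f f' :: "real \<Rightarrow> real"
  assumes "open S" "\<And>x. x \<in> S \<Longrightarrow> (f has_real_derivative f' x) (at x)" "Ck_on k f' S"
  shows "Ck_on (Suc k) f S"
  using assms
  by (intro Ck_on_SucI[where f' = "\<lambda>x v. f' x * v"])
     (auto simp: has_field_derivative_def
       intro!: Ck_on_bounded_linear[OF bounded_linear_mult_left])

lemma smooth_on_inverse_real: "smooth_on (inverse :: real \<Rightarrow> real) (- {0})"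
proof (rule smooth_onI)
  show "open (- {0::real})" by auto
  show "Ck_on k (inverse :: real \<Rightarrow> real) (- {0})" for k
  proof (induction k)
    case 0
    then show ?case by (auto intro!: continuous_intros)
  next
    case (Suc k)
    show ?case
      by (rule Ck_on_real_SucI[where f' = "\<lambda>x. - (inverse x * inverse x)"])
         (use Suc in \<open>auto intro!: derivative_eq_intros
            Ck_on_bounded_linear[OF bounded_linear_minus[OF bounded_linear_ident]]
            Ck_on_bounded_bilinear[OF bounded_bilinear_mult]\<close>)
  qed
qed

lemma smooth_on_inverse:
  fixes f :: "'a::euclidean_space \<Rightarrow> real"
  assumes "smooth_on f S" "\<And>x. x \<in> S \<Longrightarrow> f x \<noteq> 0"
  shows "smooth_on (\<lambda>x. inverse (f x)) S"
  by (rule smooth_on_compose[OF smooth_on_inverse_real assms(1)]) (use assms(2) in auto)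

lemma smooth_on_divide:
  fixes f :: "'a::euclidean_space \<Rightarrow> real"
  assumes "smooth_on f S" "smooth_on g S" "\<And>x. x \<in> S \<Longrightarrow> g x \<noteq> 0"
  shows "smooth_on (\<lambda>x. f x / g x) S"
  unfolding divide_inverse by (intro smooth_on_mult smooth_on_inverse assms)

lemma smooth_on_ln:
  fixes f :: "'a::euclidean_space \<Rightarrow> real"
  assumes "smooth_on f S" "\<And>x. x \<in> S \<Longrightarrow> f x > 0"
  shows "smooth_on (\<lambda>x. ln (f x)) S"
proof -
  have "Ck_on k (ln :: real \<Rightarrow> real) {0<..}" for k
  proof (cases k)
    case 0
    then show ?thesis using continuous_on_ln[of "{0<..}" "\<lambda>x. x"] by auto
  next
    case (Suc l)
    have "smooth_on (inverse :: real \<Rightarrow> real) {0<..}"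
      by (rule smooth_on_subset[OF smooth_on_inverse_real]) auto
    then show ?thesis unfolding Suc
      by (intro Ck_on_real_SucI[where f' = inverse])
         (auto intro!: derivative_eq_intros smooth_on_Ck simp: inverse_eq_divide)
  qed
  then have "smooth_on (ln :: real \<Rightarrow> real) {0<..}"
    by (auto intro: smooth_onI)
  from smooth_on_compose[OF this assms(1)] show ?thesis
    using assms(2) by (auto simp: image_subset_iff)
qed

lemma smooth_on_exp:
  fixes f :: "'a::euclidean_space \<Rightarrow> real"
  assumes "smooth_on f S"
  shows "smooth_on (\<lambda>x. exp (f x)) S"
proof -
  have "Ck_on k (exp :: real \<Rightarrow> real) UNIV" for k
  proof (induction k)
    case (Suc k)
    show ?case
      by (rule Ck_on_real_SucI[where f' = exp]) (use Suc in \<open>auto intro!: derivative_eq_intros\<close>)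
  qed (auto intro!: continuous_intros)
  then have "smooth_on (exp :: real \<Rightarrow> real) UNIV"
    by (auto intro: smooth_onI)
  from smooth_on_compose[OF this assms] show ?thesis
    by auto
qed

lemma smooth_on_sqrt:
  fixes f :: "'a::euclidean_space \<Rightarrow> real"
  assumes "smooth_on f S" "\<And>x. x \<in> S \<Longrightarrow> f x > 0"
  shows "smooth_on (\<lambda>x. sqrt (f x)) S"
proof -
  have "smooth_on (\<lambda>x. exp (ln (f x) / 2)) S"
    using assms by (intro smooth_on_exp smooth_on_divide smooth_on_ln smooth_on_const)
      (auto intro: smooth_on_open)
  then show ?thesis
    by (rule smooth_on_cong)
       (use assms(2) in \<open>auto simp: power2_eq_square simp flip: exp_add
          intro!: real_sqrt_unique[symmetric]\<close>)
qed

abbreviation pd :: "'m \<Rightarrow> (real^'m::finite \<Rightarrow> 'b::real_normed_vector) \<Rightarrow> real^'m \<Rightarrow> 'b"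
  where "pd \<equiv> partial_deriv"

lemma smooth_on_partial_deriv: "smooth_on f S \<Longrightarrow> smooth_on (pd i f) S"
  unfolding partial_deriv_def by (rule smooth_on_frechet_derivative)

section \<open>Symmetry of second derivatives\<close>

lemma has_real_derivative_along_line:
  fixes f :: "'a::real_normed_vector \<Rightarrow> real"
  assumes "(f has_derivative f') (at (p + s *\<^sub>R u))"
  shows "((\<lambda>s. f (p + s *\<^sub>R u)) has_real_derivative f' u) (at s)"
proof -
  have "((\<lambda>s. p + s *\<^sub>R u) has_derivative (\<lambda>h. h *\<^sub>R u)) (at s)"
    by (auto intro!: derivative_eq_intros)
  from has_derivative_compose[OF this assms]
  have "((\<lambda>s. f (p + s *\<^sub>R u)) has_derivative (\<lambda>h. f' (h *\<^sub>R u))) (at s)" .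
  moreover have "f' (h *\<^sub>R u) = f' u * h" for h
    using has_derivative_linear[OF assms] by (simp add: linear_scale)
  ultimately show ?thesis
    by (simp add: has_field_derivative_def)
qed

text \<open>The mean value theorem is applied twice: to the increment of f in direction v as a
  function of the step along u, and then to the u-derivative of f along v.\<close>

lemma second_difference_eq:
  fixes f :: "'a::euclidean_space \<Rightarrow> real"
  assumes f: "smooth_on f S" and t: "t > 0"
    and S: "\<And>a b. a \<in> {0..t} \<Longrightarrow> b \<in> {0..t} \<Longrightarrow> x + a *\<^sub>R u + b *\<^sub>R v \<in> S"
  obtains a b where "a \<in> {0..t}" "b \<in> {0..t}"
    "f (x + t *\<^sub>R u + t *\<^sub>R v) - f (x + t *\<^sub>R u) - f (x + t *\<^sub>R v) + f x =
     t * t * frechet_derivative (\<lambda>y. frechet_derivative f (at y) u)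
       (at (x + a *\<^sub>R u + b *\<^sub>R v)) v"
proof -
  define Du where "Du y = frechet_derivative f (at y) u" for y
  have f': "(f has_derivative frechet_derivative f (at y)) (at y)" if "y \<in> S" for y
    using smooth_on_has_derivative[OF f that] .
  have Du': "(Du has_derivative frechet_derivative Du (at y)) (at y)" if "y \<in> S" for y
    using smooth_on_has_derivative[OF smooth_on_frechet_derivative[OF f] that]
    by (simp add: Du_def[abs_def])
  define q where "q s = f ((x + t *\<^sub>R v) + s *\<^sub>R u) - f (x + s *\<^sub>R u)" for s
  have "DERIV q s :> Du ((x + t *\<^sub>R v) + s *\<^sub>R u) - Du (x + s *\<^sub>R u)"
    if "0 \<le> s" "s \<le> t" for s
    unfolding q_def Du_def
    using S[of s t] S[of s 0] that t
    by (intro DERIV_diff has_real_derivative_along_line f') (auto simp: algebra_simps)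
  from MVT2[OF t this] obtain a where a: "0 < a" "a < t"
    "q t - q 0 = t * (Du ((x + t *\<^sub>R v) + a *\<^sub>R u) - Du (x + a *\<^sub>R u))"
    by auto
  have "DERIV (\<lambda>s. Du ((x + a *\<^sub>R u) + s *\<^sub>R v)) s
      :> frechet_derivative Du (at ((x + a *\<^sub>R u) + s *\<^sub>R v)) v"
    if "0 \<le> s" "s \<le> t" for s
    using S[of a s] that a
    by (intro has_real_derivative_along_line Du') auto
  from MVT2[OF t this] obtain b where b: "0 < b" "b < t"
    "Du ((x + a *\<^sub>R u) + t *\<^sub>R v) - Du (x + a *\<^sub>R u) =
      t * frechet_derivative Du (at ((x + a *\<^sub>R u) + b *\<^sub>R v)) v"
    by auto
  show ?thesis
    using that[of a b] a b by (simp add: q_def Du_def[abs_def] algebra_simps)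
qed

text \<open>The second difference over a parallelogram does not change when u and v are exchanged.
  By \<open>second_difference_eq\<close> the two mixed derivatives therefore agree at two possibly
  different points near x, which continuity of both at x forbids if they differ at x.\<close>

lemma symmetric_second_derivative_real:
  fixes f :: "'a::euclidean_space \<Rightarrow> real"
  assumes f: "smooth_on f S" and x: "x \<in> S"
  shows "frechet_derivative (\<lambda>y. frechet_derivative f (at y) u) (at x) v =
         frechet_derivative (\<lambda>y. frechet_derivative f (at y) v) (at x) u"
proof (rule ccontr)
  define A where "A y = frechet_derivative (\<lambda>y. frechet_derivative f (at y) u) (at y) v" for y
  define B where "B y = frechet_derivative (\<lambda>y. frechet_derivative f (at y) v) (at y) u" for y
  assume "\<not> ?thesis"
  then have e: "\<bar>A x - B x\<bar> / 2 > 0" (is "?e > 0") by (simp add: A_def B_def)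
  have S: "open S" using f by (rule smooth_on_open)
  have "continuous_on S A" "continuous_on S B"
    unfolding A_def B_def
    by (intro smooth_on_continuous_on smooth_on_frechet_derivative f)+
  then have "isCont A x" "isCont B x"
    using S x continuous_on_eq_continuous_at by blast+
  then obtain d1 d2 where d1: "d1 > 0" "\<And>y. dist y x < d1 \<Longrightarrow> dist (A y) (A x) < ?e"
    and d2: "d2 > 0" "\<And>y. dist y x < d2 \<Longrightarrow> dist (B y) (B x) < ?e"
    using e unfolding continuous_at_eps_delta by (metis dist_commute)
  obtain d3 where d3: "d3 > 0" "ball x d3 \<subseteq> S"
    using S x open_contains_ball by blast
  define d where "d = Min {d1, d2, d3}"
  have d: "d > 0" "d \<le> d1" "d \<le> d2" "d \<le> d3"
    using d1 d2 d3 by (auto simp: d_def)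
  \<comment> \<open>This step keeps the whole parallelogram within d/2 of x; the summand 1 covers
    the case u = v = 0.\<close>
  define t where "t = d / (2 * (norm u + norm v + 1))"
  have t: "t > 0" using d by (simp add: t_def add_nonneg_pos)
  have close: "dist (x + a *\<^sub>R u + b *\<^sub>R v) x < d" if "a \<in> {0..t}" "b \<in> {0..t}" for a b
  proof -
    have "dist (x + a *\<^sub>R u + b *\<^sub>R v) x = norm (a *\<^sub>R u + b *\<^sub>R v)"
      by (simp add: dist_norm algebra_simps)
    also have "\<dots> \<le> a * norm u + b * norm v"
      using that norm_triangle_ineq[of "a *\<^sub>R u" "b *\<^sub>R v"] by simp
    also have "\<dots> \<le> t * norm u + t * norm v"
      using that by (intro add_mono mult_right_mono) auto
    also have "\<dots> \<le> t * (norm u + norm v + 1)"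
      using t by (simp add: algebra_simps)
    also have "\<dots> = d / 2"
    proof -
      have "norm u + norm v + 1 \<noteq> 0"
        using norm_ge_zero[of u] norm_ge_zero[of v] by linarith
      moreover have "d / (2 * c) * c = d / 2" if "c \<noteq> 0" for c :: real
        using that by simp
      ultimately show ?thesis unfolding t_def by blast
    qed
    finally show ?thesis using d by simp
  qed
  have in1: "x + a *\<^sub>R u + b *\<^sub>R v \<in> S" if "a \<in> {0..t}" "b \<in> {0..t}" for a b
    using close[OF that] d d3 by (auto simp: subset_eq dist_commute)
  have in2: "x + b *\<^sub>R v + a *\<^sub>R u \<in> S" if "b \<in> {0..t}" "a \<in> {0..t}" for a b
    using in1[OF that(2,1)] by (simp add: algebra_simps)
  obtain a b where ab: "a \<in> {0..t}" "b \<in> {0..t}"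
    "f (x + t *\<^sub>R u + t *\<^sub>R v) - f (x + t *\<^sub>R u) - f (x + t *\<^sub>R v) + f x =
     t * t * A (x + a *\<^sub>R u + b *\<^sub>R v)"
    unfolding A_def by (rule second_difference_eq[OF f t in1])
  obtain b' a' where ab': "b' \<in> {0..t}" "a' \<in> {0..t}"
    "f (x + t *\<^sub>R v + t *\<^sub>R u) - f (x + t *\<^sub>R v) - f (x + t *\<^sub>R u) + f x =
     t * t * B (x + b' *\<^sub>R v + a' *\<^sub>R u)"
    unfolding B_def by (rule second_difference_eq[OF f t in2])
  have "t * t * A (x + a *\<^sub>R u + b *\<^sub>R v) = t * t * B (x + b' *\<^sub>R v + a' *\<^sub>R u)"
    using ab(3) ab'(3) by (simp add: algebra_simps)
  then have "A (x + a *\<^sub>R u + b *\<^sub>R v) = B (x + b' *\<^sub>R v + a' *\<^sub>R u)"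
    using t by simp
  moreover have "dist (A (x + a *\<^sub>R u + b *\<^sub>R v)) (A x) < ?e"
    using close[OF ab(1,2)] d by (intro d1) auto
  moreover have "dist (B (x + b' *\<^sub>R v + a' *\<^sub>R u)) (B x) < ?e"
    using close[OF ab'(2,1)] d by (intro d2) (auto simp: algebra_simps)
  ultimately show False
    by (simp add: dist_real_def abs_if split: if_splits)
qed

lemma frechet_derivative_bounded_linear:
  assumes "bounded_linear L" "smooth_on f S" "x \<in> S"
  shows "frechet_derivative (\<lambda>y. L (f y)) (at x) v = L (frechet_derivative f (at x) v)"
  using frechet_derivative_at[OF bounded_linear.has_derivative[OF assms(1)
        smooth_on_has_derivative[OF assms(2,3)]]] by metis

lemma frechet_derivative_cong:
  assumes "open S" "x \<in> S" "\<And>y. y \<in> S \<Longrightarrow> f y = g y"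
  shows "frechet_derivative f (at x) = frechet_derivative g (at x)"
proof -
  have "(f has_derivative D) (at x) \<longleftrightarrow> (g has_derivative D) (at x)" for D
    using assms by (metis (full_types) has_derivative_transform_within_open)
  then show ?thesis by (simp add: frechet_derivative_def)
qed

lemma symmetric_second_derivative:
  fixes f :: "'a::euclidean_space \<Rightarrow> 'b::euclidean_space"
  assumes f: "smooth_on f S" and x: "x \<in> S"
  shows "frechet_derivative (\<lambda>y. frechet_derivative f (at y) u) (at x) v =
         frechet_derivative (\<lambda>y. frechet_derivative f (at y) v) (at x) u"
proof (rule euclidean_eqI)
  fix b :: 'b
  have S: "open S" using f by (rule smooth_on_open)
  have *: "frechet_derivative (\<lambda>y. frechet_derivative f (at y) u) (at x) v \<bullet> b =
     frechet_derivative (\<lambda>y. frechet_derivative (\<lambda>y. f y \<bullet> b) (at y) u) (at x) v" for u v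
  proof -
    have "frechet_derivative (\<lambda>y. frechet_derivative (\<lambda>y. f y \<bullet> b) (at y) u) (at x) =
          frechet_derivative (\<lambda>y. frechet_derivative f (at y) u \<bullet> b) (at x)"
      using frechet_derivative_bounded_linear[OF bounded_linear_inner_left f]
      by (intro frechet_derivative_cong[OF S x]) auto
    then show ?thesis
      using frechet_derivative_bounded_linear[OF bounded_linear_inner_left
          smooth_on_frechet_derivative[OF f] x] by simp
  qed
  show "frechet_derivative (\<lambda>y. frechet_derivative f (at y) u) (at x) v \<bullet> b =
        frechet_derivative (\<lambda>y. frechet_derivative f (at y) v) (at x) u \<bullet> b"
    unfolding *
    by (rule symmetric_second_derivative_real[OF smooth_on_bounded_linear[OF
          bounded_linear_inner_left f] x])
qed

section \<open>Rules for partial derivatives\<close>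

lemma partial_deriv_commute:
  fixes f :: "real^'m \<Rightarrow> 'b::euclidean_space"
  assumes "smooth_on f S" "x \<in> S"
  shows "pd i (pd j f) x = pd j (pd i f) x"
  unfolding partial_deriv_def by (rule symmetric_second_derivative[OF assms])

lemma partial_deriv_cong:
  assumes "open S" "x \<in> S" "\<And>y. y \<in> S \<Longrightarrow> f y = g y"
  shows "pd i f x = pd i g x"
  unfolding partial_deriv_def using frechet_derivative_cong[OF assms] by simp

lemma partial_deriv_eqI:
  "(f has_derivative f') (at x) \<Longrightarrow> pd i f x = f' (axis i 1)"
  unfolding partial_deriv_def by (metis frechet_derivative_at)

lemma partial_deriv_const: "pd i (\<lambda>x. c) x = 0"
  by (simp add: partial_deriv_def)

lemma partial_deriv_bounded_linear:
  "bounded_linear L \<Longrightarrow> smooth_on f S \<Longrightarrow> x \<in> S \<Longrightarrow>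
    pd i (\<lambda>y. L (f y)) x = L (pd i f x)"
  unfolding partial_deriv_def by (rule frechet_derivative_bounded_linear)

lemmas partial_deriv_minus =
  partial_deriv_bounded_linear[OF bounded_linear_minus[OF bounded_linear_ident]]

lemma partial_deriv_bounded_bilinear:
  assumes "bounded_bilinear P" "smooth_on f S" "smooth_on g S" "x \<in> S"
  shows "pd i (\<lambda>y. P (f y) (g y)) x =
         P (f x) (pd i g x) + P (pd i f x) (g x)"
  using partial_deriv_eqI[OF bounded_bilinear.FDERIV[OF assms(1)
        smooth_on_has_derivative[OF assms(2,4)] smooth_on_has_derivative[OF assms(3,4)]]]
  by (simp add: partial_deriv_def)

lemmas partial_deriv_inner = partial_deriv_bounded_bilinear[OF bounded_bilinear_inner]
lemmas partial_deriv_scaleR = partial_deriv_bounded_bilinear[OF bounded_bilinear_scaleR]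
lemmas partial_deriv_mult = partial_deriv_bounded_bilinear[OF bounded_bilinear_mult]

lemma partial_deriv_add:
  assumes "smooth_on f S" "smooth_on g S" "x \<in> S"
  shows "pd i (\<lambda>y. f y + g y) x = pd i f x + pd i g x"
  using partial_deriv_eqI[OF has_derivative_add[OF
        smooth_on_has_derivative[OF assms(1,3)] smooth_on_has_derivative[OF assms(2,3)]]]
  by (simp add: partial_deriv_def)

lemma partial_deriv_diff:
  assumes "smooth_on f S" "smooth_on g S" "x \<in> S"
  shows "pd i (\<lambda>y. f y - g y) x = pd i f x - pd i g x"
  using partial_deriv_eqI[OF has_derivative_diff[OF
        smooth_on_has_derivative[OF assms(1,3)] smooth_on_has_derivative[OF assms(2,3)]]]
  by (simp add: partial_deriv_def)

lemma partial_deriv_sum: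
  assumes "\<And>k. k \<in> I \<Longrightarrow> smooth_on (f k) S" "x \<in> S"
  shows "pd i (\<lambda>y. \<Sum>k\<in>I. f k y) x = (\<Sum>k\<in>I. pd i (f k) x)"
  using partial_deriv_eqI[OF has_derivative_sum[of I f, OF smooth_on_has_derivative[OF assms(1,2)]]]
  by (simp add: partial_deriv_def)

lemma partial_deriv_real_chain:
  fixes f :: "real^'m \<Rightarrow> real"
  assumes "smooth_on f S" "x \<in> S" "(q has_real_derivative q') (at (f x))"
  shows "pd i (\<lambda>y. q (f y)) x = q' * pd i f x"
  using partial_deriv_eqI[OF has_derivative_compose[OF smooth_on_has_derivative[OF assms(1,2)]
      assms(3)[unfolded has_field_derivative_def]]]
  by (simp add: partial_deriv_def)

lemma frechet_derivative_eq_sum_partial_deriv: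
  fixes f :: "real^'m \<Rightarrow> 'b::real_normed_vector"
  assumes "f differentiable (at x)"
  shows "frechet_derivative f (at x) v = (\<Sum>k\<in>UNIV. v $ k *\<^sub>R pd k f x)"
proof -
  have lin: "linear (frechet_derivative f (at x))"
    using assms linear_frechet_derivative by blast
  have "v = (\<Sum>k\<in>UNIV. v $ k *\<^sub>R axis k 1)"
    by (simp add: vec_eq_iff axis_def if_distrib cong: if_cong)
  then have "frechet_derivative f (at x) v =
      frechet_derivative f (at x) (\<Sum>k\<in>UNIV. v $ k *\<^sub>R axis k 1)"
    by simp
  also have "\<dots> = (\<Sum>k\<in>UNIV. v $ k *\<^sub>R pd k f x)"
    by (simp add: linear_sum[OF lin] linear_scale[OF lin] partial_deriv_def)
  finally show ?thesis .
qed

lemma smooth_on_differentiable: "smooth_on f S \<Longrightarrow> x \<in> S \<Longrightarrow> f differentiable (at x)"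
  using smooth_on_has_derivative differentiable_def by blast

lemma partial_deriv_chain:
  fixes f :: "real^'k \<Rightarrow> 'b::real_normed_vector" and g :: "real^'m \<Rightarrow> real^'k"
  assumes "smooth_on f T" "smooth_on g S" "x \<in> S" "g x \<in> T"
  shows "pd i (\<lambda>y. f (g y)) x =
    (\<Sum>a\<in>UNIV. pd i g x $ a *\<^sub>R pd a f (g x))"
proof -
  have "pd i (\<lambda>y. f (g y)) x =
      frechet_derivative f (at (g x)) (pd i g x)"
    using partial_deriv_eqI[OF has_derivative_compose[OF smooth_on_has_derivative[OF assms(2,3)]
      smooth_on_has_derivative[OF assms(1,4)]]]
    by (simp add: partial_deriv_def)
  then show ?thesis
    using frechet_derivative_eq_sum_partial_deriv[OF smooth_on_differentiable[OF assms(1,4)]]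
    by simp
qed

text \<open>Everything is restricted to the coordinate line through x. If the second derivative were
  positive, the first would be positive just to the right of 0, and the mean value theorem would
  produce a value above the maximum.\<close>

lemma local_max_partial_deriv:
  fixes f :: "real^'m \<Rightarrow> real"
  assumes f: "smooth_on f S" and x: "x \<in> S" and max: "\<And>y. y \<in> S \<Longrightarrow> f y \<le> f x"
  shows "pd i f x = 0" "pd i (pd i f) x \<le> 0"
proof -
  define u :: "real^'m" where "u = axis i 1"
  have u: "norm u = 1" by (simp add: u_def)
  obtain d where d: "d > 0" "ball x d \<subseteq> S"
    using smooth_on_open[OF f] x open_contains_ball by blast
  have inS: "x + s *\<^sub>R u \<in> S" if "\<bar>s\<bar> < d" for s
    using d that u by (auto simp: subset_eq dist_norm)
  define q q' where "q s = f (x + s *\<^sub>R u)" and "q' s = pd i f (x + s *\<^sub>R u)" for s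
  have q: "DERIV q s :> q' s" if "\<bar>s\<bar> < d" for s
    unfolding q_def q'_def partial_deriv_def u_def[symmetric]
    by (intro has_real_derivative_along_line smooth_on_has_derivative[OF f] inS that)
  have q': "DERIV q' 0 :> pd i (pd i f) x"
    unfolding q'_def partial_deriv_def u_def[symmetric]
    using has_real_derivative_along_line[of "\<lambda>x. frechet_derivative f (at x) u" _ x 0 u]
      smooth_on_has_derivative[OF smooth_on_frechet_derivative[OF f] x] by auto
  have le: "q s \<le> q 0" if "\<bar>s\<bar> < d" for s
    using max[OF inS[OF that]] by (simp add: q_def)
  have 0: "q' 0 = 0"
    using DERIV_local_max[OF q[of 0] d(1)] le d by auto
  then show "pd i f x = 0" by (simp add: q'_def)
  show "pd i (pd i f) x \<le> 0"
  proof (rule ccontr)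
    assume "\<not> ?thesis"
    then obtain e where e: "e > 0" "\<And>h. 0 < h \<Longrightarrow> h < e \<Longrightarrow> q' 0 < q' (0 + h)"
      using DERIV_pos_inc_right[OF q'] by force
    define t where "t = min d e / 2"
    have t: "0 < t" "t < d" "t < e" using d e by (auto simp: t_def)
    have "\<exists>z>0. z < t \<and> q t - q 0 = (t - 0) * q' z"
      by (rule MVT2[OF t(1)]) (use q t in auto)
    then obtain z where z: "0 < z" "z < t" "q t - q 0 = t * q' z" by auto
    then have "q t - q 0 > 0" using e(2)[of z] t 0 by simp
    then show False using le[of t] t by simp
  qed
qed

subsection \<open>The metric induced by an immersion\<close>

lemma induced_metric_mult_vec:
  fixes X :: "real^'m::finite \<Rightarrow> real^'n::finite"
  assumes "X differentiable (at x)"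
  shows "(induced_metric X x *v c) $ i = pd i X x \<bullet> frechet_derivative X (at x) c"
  by (simp add: induced_metric_def matrix_vector_mult_def inner_sum_right mult.commute
      frechet_derivative_eq_sum_partial_deriv[OF assms])

text \<open>The metric is a Gram matrix: a vector c in its kernel satisfies |DX c|^2 = 0, and DX is
  injective.\<close>

lemma invertible_induced_metric:
  fixes X :: "real^'m::finite \<Rightarrow> real^'n::finite"
  assumes diff: "X differentiable (at x)" and inj: "inj (frechet_derivative X (at x))"
  shows "invertible (induced_metric X x)"
proof -
  have lin: "linear (frechet_derivative X (at x))"
    using diff linear_frechet_derivative by blast
  have "c = 0" if "induced_metric X x *v c = 0" for c
  proof -
    have "frechet_derivative X (at x) c \<bullet> frechet_derivative X (at x) c =
        (\<Sum>i\<in>UNIV. c $ i * (induced_metric X x *v c) $ i)"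
      by (subst (1) frechet_derivative_eq_sum_partial_deriv[OF diff])
         (simp add: inner_sum_left induced_metric_mult_vec[OF diff])
    then have "frechet_derivative X (at x) c = 0"
      by (simp add: that)
    then show ?thesis
      using inj lin linear_injective_0 by blast
  qed
  then show ?thesis
    using matrix_left_invertible_ker[of "induced_metric X x"] invertible_left_inverse by blast
qed

lemma inverse_metric_mult:
  fixes X :: "real^'m::finite \<Rightarrow> real^'n::finite"
  assumes "X differentiable (at x)" "inj (frechet_derivative X (at x))"
  shows "inverse_metric X x ** induced_metric X x = mat 1"
    and "induced_metric X x ** inverse_metric X x = mat 1"
  using someI_ex[OF invertible_induced_metric[OF assms, unfolded invertible_def]]
  unfolding inverse_metric_def matrix_inv_def by auto

lemma sum_inverse_metric_mult:
  fixes X :: "real^'m::finite \<Rightarrow> real^'n::finite"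
  assumes "X differentiable (at x)" "inj (frechet_derivative X (at x))"
  shows "(\<Sum>j\<in>UNIV. inverse_metric X x $ i $ j * (pd j X x \<bullet> pd k X x)) =
    (if i = k then 1 else 0)"
proof -
  have "(inverse_metric X x ** induced_metric X x) $ i $ k = (mat 1 :: real^'m^'m) $ i $ k"
    by (simp add: inverse_metric_mult[OF assms])
  then show ?thesis
    by (simp add: matrix_matrix_mult_def induced_metric_def mat_def)
qed

lemma trace_inverse_metric_mult:
  fixes X :: "real^'m::finite \<Rightarrow> real^'n::finite"
  assumes "X differentiable (at x)" "inj (frechet_derivative X (at x))"
  shows "(\<Sum>i\<in>UNIV. \<Sum>j\<in>UNIV. inverse_metric X x $ i $ j * (pd i X x \<bullet> pd j X x)) =
    real CARD('m)"
proof -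
  have "(\<Sum>j\<in>UNIV. inverse_metric X x $ i $ j * (pd i X x \<bullet> pd j X x)) = 1" for i
    using sum_inverse_metric_mult[OF assms, of i i] by (simp add: inner_commute)
  then show ?thesis by simp
qed

text \<open>The coefficients, in the basis \<open>pd k X x\<close>, of the tangential part of an
  ambient vector: pair with the basis, then raise the index with the inverse metric.\<close>

definition coords ::
  "(real^'m::finite \<Rightarrow> real^'n::finite) \<Rightarrow> real^'m \<Rightarrow> real^'n \<Rightarrow> real^'m" where
  "coords X x v = inverse_metric X x *v (\<chi> l. pd l X x \<bullet> v)"

lemma coords_nth:
  "coords X x v $ k = (\<Sum>l\<in>UNIV. inverse_metric X x $ k $ l * (pd l X x \<bullet> v))"
  by (simp add: coords_def matrix_vector_mult_def)

lemma coords_frechet_derivative: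
  fixes X :: "real^'m::finite \<Rightarrow> real^'n::finite"
  assumes "X differentiable (at x)" "inj (frechet_derivative X (at x))"
  shows "coords X x (frechet_derivative X (at x) c) = c"
proof -
  have "(\<chi> l. pd l X x \<bullet> frechet_derivative X (at x) c) = induced_metric X x *v c"
    by (simp add: vec_eq_iff induced_metric_mult_vec[OF assms(1)])
  then show ?thesis
    by (simp add: coords_def matrix_vector_mul_assoc inverse_metric_mult[OF assms])
qed

lemma frechet_derivative_coords:
  fixes X :: "real^'m::finite \<Rightarrow> real^'n::finite"
  assumes "X differentiable (at x)" "inj (frechet_derivative X (at x))" "v \<in> tangent_space X x"
  shows "frechet_derivative X (at x) (coords X x v) = v"
proof -
  obtain c where "v = frechet_derivative X (at x) c"
    using assms(3) by (auto simp: tangent_space_def)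
  then show ?thesis
    by (simp add: coords_frechet_derivative[OF assms(1,2)])
qed

section \<open>Tangent space, normal space and normal projection\<close>

lemma tangent_space_iff:
  fixes X :: "real^'m::finite \<Rightarrow> real^'n::finite"
  assumes "X differentiable (at x)"
  shows "v \<in> tangent_space X x \<longleftrightarrow> (\<exists>c. v = (\<Sum>k\<in>UNIV. c k *\<^sub>R pd k X x))"
proof
  assume "v \<in> tangent_space X x"
  then show "\<exists>c. v = (\<Sum>k\<in>UNIV. c k *\<^sub>R pd k X x)"
    using frechet_derivative_eq_sum_partial_deriv[OF assms] unfolding tangent_space_def by blast
next
  assume "\<exists>c. v = (\<Sum>k\<in>UNIV. c k *\<^sub>R pd k X x)"
  then obtain c where "v = (\<Sum>k\<in>UNIV. c k *\<^sub>R pd k X x)" by blast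
  then have "v = frechet_derivative X (at x) (\<chi> k. c k)"
    by (simp add: frechet_derivative_eq_sum_partial_deriv[OF assms])
  then show "v \<in> tangent_space X x"
    unfolding tangent_space_def by blast
qed

lemma subspace_tangent_space:
  "X differentiable (at x) \<Longrightarrow> subspace (tangent_space X x)"
  unfolding tangent_space_def
  using linear_frechet_derivative linear_subspace_image subspace_UNIV by blast

lemma partial_deriv_in_tangent_space: "pd i X x \<in> tangent_space X x"
  by (simp add: partial_deriv_def tangent_space_def)

lemma normal_space_iff:
  fixes X :: "real^'m::finite \<Rightarrow> real^'n::finite"
  assumes "X differentiable (at x)"
  shows "w \<in> normal_space X x \<longleftrightarrow> (\<forall>i. pd i X x \<bullet> w = 0)"
proof
  assume "w \<in> normal_space X x"
  then show "\<forall>i. pd i X x \<bullet> w = 0"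
    using partial_deriv_in_tangent_space
    by (auto simp: normal_space_def orthogonal_comp_def orthogonal_def)
next
  assume "\<forall>i. pd i X x \<bullet> w = 0"
  then show "w \<in> normal_space X x"
    by (auto simp: normal_space_def orthogonal_comp_def orthogonal_def tangent_space_iff[OF assms]
        inner_sum_left)
qed

lemma normal_part_eqI:
  assumes "X differentiable (at x)" "w \<in> normal_space X x" "v - w \<in> tangent_space X x"
  shows "normal_part X x v = w"
  unfolding normal_part_def using normal_part_unique[OF assms(1)] assms(2,3)
  by (intro the1_equality) auto

lemma normal_part:
  assumes "X differentiable (at x)"
  shows "normal_part X x v \<in> normal_space X x" "v - normal_part X x v \<in> tangent_space X x"
  using theI'[OF normal_part_unique[OF assms, of v]] unfolding normal_part_def by auto

lemma normal_part_eq_coords: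
  fixes X :: "real^'m::finite \<Rightarrow> real^'n::finite"
  assumes "X differentiable (at x)" "inj (frechet_derivative X (at x))"
  shows "normal_part X x v = v - frechet_derivative X (at x) (coords X x v)"
proof (rule normal_part_eqI[OF assms(1)])
  have "induced_metric X x *v coords X x v = (\<chi> l. pd l X x \<bullet> v)"
    by (simp add: coords_def matrix_vector_mul_assoc inverse_metric_mult[OF assms])
  then have "pd i X x \<bullet> frechet_derivative X (at x) (coords X x v) =
      pd i X x \<bullet> v" for i
    by (metis induced_metric_mult_vec[OF assms(1)] vec_lambda_beta)
  then show "v - frechet_derivative X (at x) (coords X x v) \<in> normal_space X x"
    by (simp add: normal_space_iff[OF assms(1)] inner_diff_right)
qed (simp add: tangent_space_def)

section \<open>Smooth dependence of inverse metric and projections\<close>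

lemma smooth_on_det:
  fixes A :: "'a::euclidean_space \<Rightarrow> real^'m^'m"
  assumes "open S" "\<And>i j. smooth_on (\<lambda>x. A x $ i $ j) S"
  shows "smooth_on (\<lambda>x. det (A x)) S"
  unfolding det_def
  by (intro smooth_on_sum smooth_on_mult smooth_on_prod smooth_on_const assms)

lemma smooth_on_induced_metric:
  fixes X :: "real^'m::finite \<Rightarrow> real^'n::finite"
  assumes "smooth_on X S"
  shows "smooth_on (\<lambda>x. induced_metric X x $ i $ j) S"
  using assms by (simp add: induced_metric_def smooth_on_inner smooth_on_partial_deriv)

text \<open>Cramer's rule writes each entry of the inverse as a quotient of determinants, hence as a
  smooth function of the metric coefficients.\<close>

lemma smooth_on_inverse_metric:
  fixes X :: "real^'m::finite \<Rightarrow> real^'n::finite"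
  assumes X: "smooth_on X S" and inj: "\<And>x. x \<in> S \<Longrightarrow> inj (frechet_derivative X (at x))"
  shows "smooth_on (\<lambda>x. inverse_metric X x $ i $ j) S"
proof -
  let ?C = "\<lambda>x. (\<chi> a b. if b = i then axis j 1 $ a else induced_metric X x $ a $ b) :: real^'m^'m"
  have S: "open S" using X by (rule smooth_on_open)
  have det: "det (induced_metric X x) \<noteq> 0" if "x \<in> S" for x
    using invertible_induced_metric[OF smooth_on_differentiable[OF X that] inj[OF that]]
      invertible_det_nz by blast
  have "smooth_on (\<lambda>x. det (?C x) / det (induced_metric X x)) S"
  proof (intro smooth_on_divide smooth_on_det S det)
    show "smooth_on (\<lambda>x. ?C x $ a $ b) S" for a b
      by (cases "b = i") (auto intro: smooth_on_const smooth_on_induced_metric S X)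
  qed (auto intro: smooth_on_induced_metric X)
  then show ?thesis
  proof (rule smooth_on_cong)
    fix x assume x: "x \<in> S"
    have "induced_metric X x *v (inverse_metric X x *v axis j 1) = axis j 1"
      by (simp add: matrix_vector_mul_assoc
          inverse_metric_mult[OF smooth_on_differentiable[OF X x] inj[OF x]])
    then have "inverse_metric X x *v axis j 1 = (\<chi> k. det (\<chi> a b. if b = k then axis j 1 $ a
        else induced_metric X x $ a $ b) / det (induced_metric X x))"
      using cramer[OF det[OF x]] by blast
    then have "(inverse_metric X x *v axis j 1) $ i = det (?C x) / det (induced_metric X x)"
      by simp
    moreover have "(inverse_metric X x *v axis j 1) $ i = inverse_metric X x $ i $ j"
      by (simp add: matrix_vector_mult_basis column_def)
    ultimately show "det (?C x) / det (induced_metric X x) = inverse_metric X x $ i $ j"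
      by simp
  qed
qed

lemma smooth_on_coords:
  fixes X :: "real^'m::finite \<Rightarrow> real^'n::finite"
  assumes X: "smooth_on X S" and inj: "\<And>x. x \<in> S \<Longrightarrow> inj (frechet_derivative X (at x))"
    and f: "smooth_on f S"
  shows "smooth_on (\<lambda>x. coords X x (f x) $ k) S"
  unfolding coords_nth
  by (intro smooth_on_sum smooth_on_mult smooth_on_inverse_metric smooth_on_inner
      smooth_on_partial_deriv X f inj smooth_on_open[OF X]) auto

lemma smooth_on_normal_part:
  fixes X :: "real^'m::finite \<Rightarrow> real^'n::finite"
  assumes X: "smooth_on X S" and inj: "\<And>x. x \<in> S \<Longrightarrow> inj (frechet_derivative X (at x))"
    and f: "smooth_on f S"
  shows "smooth_on (\<lambda>x. normal_part X x (f x)) S"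
proof -
  have "smooth_on (\<lambda>x. f x - (\<Sum>k\<in>UNIV. coords X x (f x) $ k *\<^sub>R pd k X x)) S"
    by (intro smooth_on_diff smooth_on_sum smooth_on_scaleR smooth_on_coords smooth_on_partial_deriv
        X f inj smooth_on_open[OF X]) auto
  then show ?thesis
    by (rule smooth_on_cong)
       (simp add: normal_part_eq_coords[OF smooth_on_differentiable[OF X] inj]
         frechet_derivative_eq_sum_partial_deriv[OF smooth_on_differentiable[OF X]])
qed

text \<open>The Christoffel terms are combinations of the tangent vectors \<open>pd k X x\<close>.
  The mean curvature can thus be tested against normal vectors through plain second derivatives, and
  no Christoffel symbol is ever computed.\<close>

lemma mean_curvature_tangent:
  fixes X :: "real^'m::finite \<Rightarrow> real^'n::finite"
  assumes "X differentiable (at x)"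
  shows "(\<Sum>i\<in>UNIV. \<Sum>j\<in>UNIV. inverse_metric X x $ i $ j *\<^sub>R pd i (pd j X) x)
    - mean_curvature X x \<in> tangent_space X x"
proof -
  note T = subspace_tangent_space[OF assms]
  have "(\<Sum>i\<in>UNIV. \<Sum>j\<in>UNIV. inverse_metric X x $ i $ j *\<^sub>R pd i (pd j X) x)
    - mean_curvature X x =
    (\<Sum>i\<in>UNIV. \<Sum>j\<in>UNIV. inverse_metric X x $ i $ j *\<^sub>R
      (\<Sum>k\<in>UNIV. christoffel X k i j x *\<^sub>R pd k X x))"
    unfolding mean_curvature_def second_fundamental_form_def
    by (simp add: sum_subtractf[symmetric] scaleR_diff_right)
  also have "\<dots> \<in> tangent_space X x"
    by (intro subspace_sum[OF T] subspace_scale[OF T] partial_deriv_in_tangent_space)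
  finally show ?thesis .
qed

section \<open>Self-shrinkers contained in a sphere\<close>

lemma sphere_immersion_normal:
  fixes X :: "real^'m::finite \<Rightarrow> real^'n::finite"
  assumes X: "smooth_on X S" and r: "\<And>x. x \<in> S \<Longrightarrow> (X x - a) \<bullet> (X x - a) = r" and x: "x \<in> S"
  shows "pd i X x \<bullet> (X x - a) = 0"
proof -
  have S: "open S" using X by (rule smooth_on_open)
  note Xa = smooth_on_diff[OF X smooth_on_const[OF S, of a]]
  have "pd i (\<lambda>x. (X x - a) \<bullet> (X x - a)) x = pd i (\<lambda>x. r) x"
    using r by (intro partial_deriv_cong[OF S x]) auto
  then show ?thesis
    using partial_deriv_inner[OF Xa Xa x, of i]
      partial_deriv_diff[OF X smooth_on_const[OF S, of a] x, of i]
    by (simp add: partial_deriv_const inner_commute)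
qed

text \<open>Differentiating the orthogonality of \<open>pd j X\<close> and X - a once more shows
  that the second derivatives of X paired with X - a give minus the metric, and the trace of the
  metric is m. As X - a is normal, the tangential correction does not contribute.\<close>

lemma sphere_immersion_mean_curvature:
  fixes X :: "real^'m::finite \<Rightarrow> real^'n::finite"
  assumes X: "smooth_on X S" and inj: "\<And>x. x \<in> S \<Longrightarrow> inj (frechet_derivative X (at x))"
    and r: "\<And>x. x \<in> S \<Longrightarrow> (X x - a) \<bullet> (X x - a) = r" and x: "x \<in> S"
  shows "mean_curvature X x \<bullet> (X x - a) = - real CARD('m)"
proof -
  have S: "open S" using X by (rule smooth_on_open)
  note Xa = smooth_on_diff[OF X smooth_on_const[OF S, of a]]
  note diff = smooth_on_differentiable[OF X x]
  have second: "pd i (pd j X) x \<bullet> (X x - a) =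
      - (pd i X x \<bullet> pd j X x)" for i j
  proof -
    have "pd i (\<lambda>x. pd j X x \<bullet> (X x - a)) x = pd i (\<lambda>x. 0) x"
      using sphere_immersion_normal[OF X r] by (intro partial_deriv_cong[OF S x]) auto
    then show ?thesis
      using partial_deriv_inner[OF smooth_on_partial_deriv[OF X] Xa x, of i j]
        partial_deriv_diff[OF X smooth_on_const[OF S, of a] x, of i]
      by (simp add: partial_deriv_const inner_commute)
  qed
  have "X x - a \<in> normal_space X x"
    using sphere_immersion_normal[OF X r x] by (simp add: normal_space_iff[OF diff])
  with mean_curvature_tangent[OF diff]
  have "((\<Sum>i\<in>UNIV. \<Sum>j\<in>UNIV. inverse_metric X x $ i $ j *\<^sub>R pd i (pd j X) x)
    - mean_curvature X x) \<bullet> (X x - a) = 0"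
    by (auto simp: normal_space_def orthogonal_comp_def orthogonal_def)
  then show ?thesis
    using trace_inverse_metric_mult[OF diff inj[OF x]]
    by (simp add: inner_diff_left inner_sum_left second sum_negf)
qed

lemma spherical_self_shrinker_local:
  fixes X :: "real^'m::finite \<Rightarrow> real^'n::finite"
  assumes X: "smooth_on X S" and inj: "\<And>x. x \<in> S \<Longrightarrow> inj (frechet_derivative X (at x))"
    and shr: "\<And>x. x \<in> S \<Longrightarrow> mean_curvature X x = - normal_part X x (X x)"
    and r: "\<And>x. x \<in> S \<Longrightarrow> (X x - a) \<bullet> (X x - a) = r" and x: "x \<in> S"
  shows "mean_curvature X x \<noteq> 0" "normal_connection X i (principal_normal X) x = 0"
proof -
  have S: "open S" using X by (rule smooth_on_open)
  define m where "m = real CARD('m)"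
  have m: "m > 0" by (simp add: m_def)
  note diff = smooth_on_differentiable[OF X]
  \<comment> \<open>X - a is normal, so X may be replaced by its normal part, which the shrinker
    equation identifies with - H.\<close>
  have 1: "X y \<bullet> (X y - a) = m" if y: "y \<in> S" for y
  proof -
    have n: "X y - a \<in> normal_space X y"
      using sphere_immersion_normal[OF X r y] by (simp add: normal_space_iff[OF diff[OF y]])
    have "(X y - normal_part X y (X y)) \<bullet> (X y - a) = 0"
      using normal_part(2)[OF diff[OF y], of "X y"] n
      by (auto simp: normal_space_def orthogonal_comp_def orthogonal_def)
    moreover have "normal_part X y (X y) \<bullet> (X y - a) = m"
      using sphere_immersion_mean_curvature[OF X inj r y] shr[OF y]
      by (simp add: m_def)
    ultimately show ?thesis by (simp add: inner_diff_left)
  qed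
  \<comment> \<open>Combined with the equation of the given sphere, this makes |X| constant. The
    preceding lemmas then apply again with centre 0, where X itself is normal and H = - X.\<close>
  have 2: "X y \<bullet> X y = 2 * m - r + a \<bullet> a" if y: "y \<in> S" for y
    using 1[OF y] r[OF y] by (simp add: inner_diff_left inner_diff_right inner_commute)
  then have r0: "(X y - 0) \<bullet> (X y - 0) = 2 * m - r + a \<bullet> a" if "y \<in> S" for y
    using that by simp
  have np: "normal_part X y (X y) = X y" if y: "y \<in> S" for y
    using sphere_immersion_normal[OF X r0 y] subspace_0[OF subspace_tangent_space[OF diff[OF y]]]
    by (intro normal_part_eqI[OF diff[OF y]]) (auto simp: normal_space_iff[OF diff[OF y]])
  have H: "mean_curvature X y = - X y" if y: "y \<in> S" for y
    using shr[OF y] np[OF y] by simp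
  have sq: "X y \<bullet> X y = m" if y: "y \<in> S" for y
    using sphere_immersion_mean_curvature[OF X inj r0 y] H[OF y] by (simp add: m_def)
  then have norm: "norm (X y) = sqrt m" if "y \<in> S" for y
    using that by (simp add: norm_eq_sqrt_inner)
  show "mean_curvature X x \<noteq> 0"
    using H[OF x] sq[OF x] m by auto
  \<comment> \<open>nu is a constant multiple of the position vector, so its derivatives are
    tangential.\<close>
  have "principal_normal X y = - (inverse (sqrt m)) *\<^sub>R X y" if "y \<in> S" for y
    using H[OF that] norm[OF that] by (simp add: principal_normal_def)
  then have "pd i (principal_normal X) x =
      pd i (\<lambda>y. (- inverse (sqrt m)) *\<^sub>R X y) x"
    by (intro partial_deriv_cong[OF S x]) auto
  also have "\<dots> = (- inverse (sqrt m)) *\<^sub>R pd i X x"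
    by (rule partial_deriv_bounded_linear[OF bounded_linear_scaleR_right X x])
  also have "\<dots> \<in> tangent_space X x"
    by (intro subspace_scale[OF subspace_tangent_space[OF diff[OF x]]]
        partial_deriv_in_tangent_space)
  finally have "pd i (principal_normal X) x \<in> tangent_space X x" .
  then show "normal_connection X i (principal_normal X) x = 0"
    unfolding normal_connection_def
    by (intro normal_part_eqI[OF diff[OF x]]) (auto simp: normal_space_iff[OF diff[OF x]])
qed

subsection \<open>Shrinkers with parallel principal normal\<close>

lemma partial_deriv_chain2:
  fixes X :: "real^'k::finite \<Rightarrow> 'b::real_normed_vector" and \<phi> :: "real^'m::finite \<Rightarrow> real^'k"
  assumes X: "smooth_on X S" and p: "smooth_on \<phi> T" and sub: "\<phi> ` T \<subseteq> S" and y: "y \<in> T"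
  shows "pd i (pd j (\<lambda>y. X (\<phi> y))) y =
    (\<Sum>b\<in>UNIV. pd i (pd j \<phi>) y $ b *\<^sub>R pd b X (\<phi> y)) +
    (\<Sum>a\<in>UNIV. \<Sum>b\<in>UNIV. (pd i \<phi> y $ a * pd j \<phi> y $ b) *\<^sub>R
      pd a (pd b X) (\<phi> y))"
proof -
  have T: "open T" using p by (rule smooth_on_open)
  have s1: "smooth_on (\<lambda>y. pd j \<phi> y $ b) T" for b
    by (intro smooth_on_vec_nth smooth_on_partial_deriv p)
  have s2: "smooth_on (\<lambda>y. pd b X (\<phi> y)) T" for b
    by (rule smooth_on_compose[OF smooth_on_partial_deriv[OF X] p sub])
  have "pd i (pd j (\<lambda>y. X (\<phi> y))) y =
    pd i (\<lambda>y. \<Sum>b\<in>UNIV. pd j \<phi> y $ b *\<^sub>R pd b X (\<phi> y)) y"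
    using sub by (intro partial_deriv_cong[OF T y] partial_deriv_chain[OF X p]) auto
  also have "\<dots> = (\<Sum>b\<in>UNIV. pd i (\<lambda>y. pd j \<phi> y $ b *\<^sub>R pd b X (\<phi> y)) y)"
    by (intro partial_deriv_sum[where S = T] smooth_on_scaleR s1 s2 y)
  also have "\<dots> = (\<Sum>b\<in>UNIV. pd i (pd j \<phi>) y $ b *\<^sub>R pd b X (\<phi> y) +
      (\<Sum>a\<in>UNIV. (pd i \<phi> y $ a * pd j \<phi> y $ b) *\<^sub>R
        pd a (pd b X) (\<phi> y)))"
  proof (rule sum.cong[OF refl])
    fix b
    have "pd i (\<lambda>y. pd j \<phi> y $ b) y = pd i (pd j \<phi>) y $ b"
      by (rule partial_deriv_bounded_linear[OF bounded_linear_vec_nth smooth_on_partial_deriv[OF p] y])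
    moreover have "pd i (\<lambda>y. pd b X (\<phi> y)) y =
       (\<Sum>a\<in>UNIV. pd i \<phi> y $ a *\<^sub>R pd a (pd b X) (\<phi> y))"
      using sub y by (intro partial_deriv_chain[OF smooth_on_partial_deriv[OF X] p y]) auto
    ultimately show "pd i (\<lambda>y. pd j \<phi> y $ b *\<^sub>R pd b X (\<phi> y)) y =
      pd i (pd j \<phi>) y $ b *\<^sub>R pd b X (\<phi> y) +
      (\<Sum>a\<in>UNIV. (pd i \<phi> y $ a * pd j \<phi> y $ b) *\<^sub>R
        pd a (pd b X) (\<phi> y))"
      using partial_deriv_scaleR[OF s1[of b] s2[of b] y, of i]
      by (simp add: scaleR_sum_right mult.commute add.commute)
  qed
  also have "\<dots> = (\<Sum>b\<in>UNIV. pd i (pd j \<phi>) y $ b *\<^sub>R pd b X (\<phi> y)) +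
    (\<Sum>b\<in>UNIV. \<Sum>a\<in>UNIV. (pd i \<phi> y $ a * pd j \<phi> y $ b) *\<^sub>R
      pd a (pd b X) (\<phi> y))"
    by (rule sum.distrib)
  also have "(\<Sum>b\<in>UNIV. \<Sum>a\<in>UNIV. (pd i \<phi> y $ a * pd j \<phi> y $ b) *\<^sub>R
      pd a (pd b X) (\<phi> y)) =
      (\<Sum>a\<in>UNIV. \<Sum>b\<in>UNIV. (pd i \<phi> y $ a * pd j \<phi> y $ b) *\<^sub>R
      pd a (pd b X) (\<phi> y))"
    by (rule sum.swap)
  finally show ?thesis .
qed

text \<open>The local hypotheses with H = h nu. All equations between normal vectors are stated as
  membership in the tangent space: D nu tangential means that nu is parallel, X + h nu tangential is
  the shrinker equation, and the last clause says that the mean curvature vector is h nu. In this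
  form they can be differentiated and are easily seen to be independent of the
  parametrisation.\<close>

definition shrinker_on ::
  "(real^'m::finite) set \<Rightarrow> (real^'m \<Rightarrow> real^'n::finite) \<Rightarrow> (real^'m \<Rightarrow> real^'n) \<Rightarrow> (real^'m \<Rightarrow> real) \<Rightarrow> bool"
  where "shrinker_on S X \<nu> h \<longleftrightarrow>
    smooth_on X S \<and> smooth_on \<nu> S \<and> smooth_on h S \<and>
    (\<forall>x\<in>S. inj (frechet_derivative X (at x)) \<and> h x > 0 \<and> \<nu> x \<bullet> \<nu> x = 1 \<and>
       \<nu> x \<in> normal_space X x \<and> (\<forall>i. pd i \<nu> x \<in> tangent_space X x) \<and>
       X x + h x *\<^sub>R \<nu> x \<in> tangent_space X x \<and>
       (\<Sum>i\<in>UNIV. \<Sum>j\<in>UNIV. inverse_metric X x $ i $ j *\<^sub>R pd i (pd j X) x)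
         - h x *\<^sub>R \<nu> x \<in> tangent_space X x)"

lemma shrinker_onD:
  assumes "shrinker_on S X \<nu> h"
  shows "smooth_on X S" "smooth_on \<nu> S" "smooth_on h S"
    and "x \<in> S \<Longrightarrow> inj (frechet_derivative X (at x))"
    and "x \<in> S \<Longrightarrow> h x > 0" "x \<in> S \<Longrightarrow> \<nu> x \<bullet> \<nu> x = 1" "x \<in> S \<Longrightarrow> \<nu> x \<in> normal_space X x"
    and "x \<in> S \<Longrightarrow> pd i \<nu> x \<in> tangent_space X x"
    and "x \<in> S \<Longrightarrow> X x + h x *\<^sub>R \<nu> x \<in> tangent_space X x"
    and "x \<in> S \<Longrightarrow> (\<Sum>i\<in>UNIV. \<Sum>j\<in>UNIV. inverse_metric X x $ i $ j *\<^sub>R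
          pd i (pd j X) x) - h x *\<^sub>R \<nu> x \<in> tangent_space X x"
    and "x \<in> S \<Longrightarrow> X differentiable (at x)" "x \<in> S \<Longrightarrow> \<nu> differentiable (at x)"
    and "open S"
  using assms smooth_on_differentiable smooth_on_open unfolding shrinker_on_def by blast+

text \<open>Here h is taken as |F^perp|, which equals |H| by the shrinker equation, because
  smoothness of the normal projection gives smoothness of h and nu at once.\<close>

lemma shrinker_onI:
  fixes X :: "real^'m::finite \<Rightarrow> real^'n::finite"
  assumes X: "smooth_on X S" and inj: "\<And>x. x \<in> S \<Longrightarrow> inj (frechet_derivative X (at x))"
    and shr: "\<And>x. x \<in> S \<Longrightarrow> mean_curvature X x = - normal_part X x (X x)"
    and H: "\<And>x. x \<in> S \<Longrightarrow> mean_curvature X x \<noteq> 0"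
    and par: "\<And>x i. x \<in> S \<Longrightarrow> normal_connection X i (principal_normal X) x = 0"
  shows "shrinker_on S X (principal_normal X) (\<lambda>x. norm (normal_part X x (X x)))"
proof -
  have S: "open S" using X by (rule smooth_on_open)
  have n: "normal_part X x (X x) \<noteq> 0" if "x \<in> S" for x
    using H[OF that] shr[OF that] by auto
  have sm: "smooth_on (\<lambda>x. normal_part X x (X x)) S"
    by (rule smooth_on_normal_part[OF X inj X])
  have smh: "smooth_on (\<lambda>x. norm (normal_part X x (X x))) S"
    unfolding norm_eq_sqrt_inner using n by (intro smooth_on_sqrt smooth_on_inner sm) auto
  have pn: "principal_normal X x = - (normal_part X x (X x) /\<^sub>R norm (normal_part X x (X x)))"
    if "x \<in> S" for x
    using shr[OF that] by (simp add: principal_normal_def)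
  have "smooth_on (\<lambda>x. - (normal_part X x (X x) /\<^sub>R norm (normal_part X x (X x)))) S"
    using n by (intro smooth_on_minus smooth_on_scaleR smooth_on_inverse smh sm) auto
  then have smn: "smooth_on (principal_normal X) S"
    by (rule smooth_on_cong) (simp add: pn)
  show ?thesis
    unfolding shrinker_on_def
  proof (intro conjI ballI allI)
    fix x assume x: "x \<in> S"
    note diff = smooth_on_differentiable[OF X x]
    have hn: "norm (normal_part X x (X x)) *\<^sub>R principal_normal X x = - normal_part X x (X x)"
      using n[OF x] pn[OF x] by simp
    show "0 < norm (normal_part X x (X x))" using n[OF x] by simp
    have "norm (principal_normal X x) = 1"
      using H[OF x] by (simp add: principal_normal_def)
    then show "principal_normal X x \<bullet> principal_normal X x = 1"
      by (simp add: dot_square_norm)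
    show "principal_normal X x \<in> normal_space X x"
      using normal_part(1)[OF diff, of "X x"] pn[OF x] by (simp add: normal_space_iff[OF diff])
    show "pd i (principal_normal X) x \<in> tangent_space X x" for i
      using normal_part(2)[OF diff, of "pd i (principal_normal X) x"] par[OF x, of i]
      by (simp add: normal_connection_def)
    show "X x + norm (normal_part X x (X x)) *\<^sub>R principal_normal X x \<in> tangent_space X x"
      using normal_part(2)[OF diff, of "X x"] hn by simp
    show "(\<Sum>i\<in>UNIV. \<Sum>j\<in>UNIV. inverse_metric X x $ i $ j *\<^sub>R pd i (pd j X) x)
         - norm (normal_part X x (X x)) *\<^sub>R principal_normal X x \<in> tangent_space X x"
      using mean_curvature_tangent[OF diff] hn shr[OF x] by simp
  qed (use X smn smh inj in auto)
qed

section \<open>Invariance under reparametrisation\<close>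

lemma frechet_derivative_compose_eq:
  assumes "smooth_on X S" "smooth_on \<phi> T" "\<phi> ` T \<subseteq> S" "y \<in> T"
    and "\<And>y. y \<in> T \<Longrightarrow> Y y = X (\<phi> y)"
  shows "frechet_derivative Y (at y) v =
    frechet_derivative X (at (\<phi> y)) (frechet_derivative \<phi> (at y) v)"
proof -
  have "frechet_derivative Y (at y) = frechet_derivative (X o \<phi>) (at y)"
    using assms by (intro frechet_derivative_cong[OF smooth_on_open[OF assms(2)] assms(4)]) auto
  also have "\<dots> = frechet_derivative X (at (\<phi> y)) o frechet_derivative \<phi> (at y)"
    using assms by (intro frechet_derivative_compose smooth_on_differentiable) auto
  finally show ?thesis by simp
qed

lemma shrinker_on_reparam:
  fixes X :: "real^'m::finite \<Rightarrow> real^'n::finite" and \<phi> :: "real^'m \<Rightarrow> real^'m"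
  assumes shr: "shrinker_on S X \<nu> h" and p: "smooth_on \<phi> T" and sub: "\<phi> ` T \<subseteq> S"
    and inj: "\<And>y. y \<in> T \<Longrightarrow> inj (frechet_derivative \<phi> (at y))"
  shows "shrinker_on T (\<lambda>y. X (\<phi> y)) (\<lambda>y. \<nu> (\<phi> y)) (\<lambda>y. h (\<phi> y))"
proof -
  note s = shrinker_onD[OF shr]
  let ?Y = "\<lambda>y. X (\<phi> y)"
  have Y: "smooth_on ?Y T" "smooth_on (\<lambda>y. \<nu> (\<phi> y)) T" "smooth_on (\<lambda>y. h (\<phi> y)) T"
    by (intro smooth_on_compose[OF _ p sub] s)+
  have DY: "frechet_derivative ?Y (at y) v =
      frechet_derivative X (at (\<phi> y)) (frechet_derivative \<phi> (at y) v)" if "y \<in> T" for y v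
    using frechet_derivative_compose_eq[OF s(1) p sub that] by simp
  have injY: "inj (frechet_derivative ?Y (at y))" if "y \<in> T" for y
    using inj_compose[OF s(4) inj[OF that], of "\<phi> y"] that sub
    by (auto simp: DY[OF that] o_def inj_def)
  have tang: "tangent_space ?Y y = tangent_space X (\<phi> y)" if y: "y \<in> T" for y
  proof -
    have "linear (frechet_derivative \<phi> (at y))"
      using p y linear_frechet_derivative smooth_on_differentiable by blast
    then have "surj (frechet_derivative \<phi> (at y))"
      using inj[OF y] by (rule linear_inj_imp_surj)
    moreover have "tangent_space ?Y y =
        frechet_derivative X (at (\<phi> y)) ` range (frechet_derivative \<phi> (at y))"
      by (simp add: tangent_space_def DY[OF y] image_image)
    ultimately show ?thesis
      by (simp add: tangent_space_def)
  qed
  show ?thesis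
    unfolding shrinker_on_def
  proof (intro conjI ballI allI)
    fix y assume y: "y \<in> T"
    then have py: "\<phi> y \<in> S" using sub by auto
    note T = subspace_tangent_space[OF s(11)[OF py]]
    show "inj (frechet_derivative ?Y (at y))" using injY[OF y] .
    show "0 < h (\<phi> y)" "\<nu> (\<phi> y) \<bullet> \<nu> (\<phi> y) = 1" using s(5,6)[OF py] by auto
    show "\<nu> (\<phi> y) \<in> normal_space ?Y y"
      using s(7)[OF py] by (simp add: normal_space_def tang[OF y])
    show "X (\<phi> y) + h (\<phi> y) *\<^sub>R \<nu> (\<phi> y) \<in> tangent_space ?Y y"
      using s(9)[OF py] by (simp add: tang[OF y])
    show "pd i (\<lambda>y. \<nu> (\<phi> y)) y \<in> tangent_space ?Y y" for i
      unfolding tang[OF y] partial_deriv_chain[OF s(2) p y py]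
      by (intro subspace_sum[OF T] subspace_scale[OF T] s(8) py)
    define J :: "real^'m^'m" where "J = (\<chi> a i. pd i \<phi> y $ a)"
    let ?g = "induced_metric X (\<phi> y)" and ?G = "inverse_metric X (\<phi> y)"
      and ?g' = "induced_metric ?Y y" and ?G' = "inverse_metric ?Y y"
    note GX = inverse_metric_mult[OF s(11)[OF py] s(4)[OF py]]
    note GY = inverse_metric_mult[OF smooth_on_differentiable[OF Y(1) y] injY[OF y]]
    have "?g' = transpose J ** ?g ** J"
    proof -
      have "?g' $ i $ j = (transpose J ** ?g ** J) $ i $ j" for i j
      proof -
        have "?g' $ i $ j = (\<Sum>b\<in>UNIV. \<Sum>a\<in>UNIV. J $ a $ i * J $ b $ j *
            (pd a X (\<phi> y) \<bullet> pd b X (\<phi> y)))"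
          by (simp add: induced_metric_def partial_deriv_chain[OF s(1) p y py] J_def
              inner_sum_left inner_sum_right sum_distrib_left mult_ac)
        also have "\<dots> = (transpose J ** ?g ** J) $ i $ j"
          by (simp add: matrix_matrix_mult_def transpose_def induced_metric_def
              sum_distrib_left mult_ac)
        finally show ?thesis .
      qed
      then show ?thesis by (simp add: vec_eq_iff)
    qed
    \<comment> \<open>Inverting g' = J^T g J without inverting J: a left inverse of a square matrix
      is also a right inverse, so J G' is moved to the other side and the product is multiplied by
      G.\<close>
    then have "(transpose J ** ?g) ** (J ** ?G') = mat 1"
      using GY(2) by (simp add: matrix_mul_assoc)
    then have "(J ** ?G') ** (transpose J ** ?g) = mat 1"
      using matrix_left_right_inverse by blast
    then have "(J ** ?G' ** transpose J) ** (?g ** ?G) = ?G"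
      by (simp add: matrix_mul_assoc)
    then have JGJ: "J ** ?G' ** transpose J = ?G"
      by (simp add: GX)
    have G: "?G $ a $ b = (\<Sum>i\<in>UNIV. \<Sum>j\<in>UNIV. ?G' $ i $ j *
        (pd i \<phi> y $ a * pd j \<phi> y $ b))" for a b
    proof -
      have "?G $ a $ b = (\<Sum>j\<in>UNIV. \<Sum>i\<in>UNIV. ?G' $ i $ j *
        (pd i \<phi> y $ a * pd j \<phi> y $ b))"
        unfolding JGJ[symmetric]
        by (simp add: matrix_matrix_mult_def transpose_def J_def sum_distrib_left mult_ac)
      then show ?thesis by (subst sum.swap)
    qed
    let ?H = "\<lambda>a b. pd a (pd b X) (\<phi> y)"
    \<comment> \<open>The second derivatives of the coordinate change only contribute tangent
      vectors; the trace condition is a statement modulo the tangent space.\<close>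
    define c where "c i j = (\<Sum>b\<in>UNIV. pd i (pd j \<phi>) y $ b *\<^sub>R
        pd b X (\<phi> y))" for i j
    have c: "c i j \<in> tangent_space X (\<phi> y)" for i j
      unfolding c_def by (intro subspace_sum[OF T] subspace_scale[OF T] partial_deriv_in_tangent_space)
    have "(\<Sum>i\<in>UNIV. \<Sum>j\<in>UNIV. ?G' $ i $ j *\<^sub>R pd i (pd j ?Y) y) =
      (\<Sum>i\<in>UNIV. \<Sum>j\<in>UNIV. ?G' $ i $ j *\<^sub>R c i j) +
      (\<Sum>i\<in>UNIV. \<Sum>j\<in>UNIV. \<Sum>a\<in>UNIV. \<Sum>b\<in>UNIV.
        (?G' $ i $ j * (pd i \<phi> y $ a * pd j \<phi> y $ b)) *\<^sub>R ?H a b)"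
      by (simp add: partial_deriv_chain2[OF s(1) p sub y] c_def[symmetric] scaleR_add_right
          sum.distrib scaleR_sum_right)
    also have "(\<Sum>i\<in>UNIV. \<Sum>j\<in>UNIV. \<Sum>a\<in>UNIV. \<Sum>b\<in>UNIV.
        (?G' $ i $ j * (pd i \<phi> y $ a * pd j \<phi> y $ b)) *\<^sub>R ?H a b) =
       (\<Sum>(i,j,a,b)\<in>UNIV.
        (?G' $ i $ j * (pd i \<phi> y $ a * pd j \<phi> y $ b)) *\<^sub>R ?H a b)"
      by (simp add: sum.cartesian_product flip: UNIV_Times_UNIV)
    also have "\<dots> = (\<Sum>(a,b,i,j)\<in>UNIV.
        (?G' $ i $ j * (pd i \<phi> y $ a * pd j \<phi> y $ b)) *\<^sub>R ?H a b)"
      by (rule sum.reindex_bij_witness[of _ "\<lambda>(a,b,i,j). (i,j,a,b)" "\<lambda>(i,j,a,b). (a,b,i,j)"]) auto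
    also have "\<dots> = (\<Sum>a\<in>UNIV. \<Sum>b\<in>UNIV. \<Sum>i\<in>UNIV. \<Sum>j\<in>UNIV.
        (?G' $ i $ j * (pd i \<phi> y $ a * pd j \<phi> y $ b)) *\<^sub>R ?H a b)"
      by (simp add: sum.cartesian_product flip: UNIV_Times_UNIV)
    also have "\<dots> = (\<Sum>a\<in>UNIV. \<Sum>b\<in>UNIV. ?G $ a $ b *\<^sub>R ?H a b)"
      by (simp add: G scaleR_sum_left)
    finally have eq: "(\<Sum>i\<in>UNIV. \<Sum>j\<in>UNIV. ?G' $ i $ j *\<^sub>R pd i (pd j ?Y) y)
        - h (\<phi> y) *\<^sub>R \<nu> (\<phi> y) =
        (\<Sum>i\<in>UNIV. \<Sum>j\<in>UNIV. ?G' $ i $ j *\<^sub>R c i j) +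
        ((\<Sum>a\<in>UNIV. \<Sum>b\<in>UNIV. ?G $ a $ b *\<^sub>R ?H a b) - h (\<phi> y) *\<^sub>R \<nu> (\<phi> y))"
      by simp
    show "(\<Sum>i\<in>UNIV. \<Sum>j\<in>UNIV. ?G' $ i $ j *\<^sub>R pd i (pd j ?Y) y)
        - h (\<phi> y) *\<^sub>R \<nu> (\<phi> y) \<in> tangent_space ?Y y"
      unfolding eq tang[OF y]
      by (intro subspace_add[OF T] subspace_sum[OF T] subspace_scale[OF T] c s(10) py)
  qed (use Y in auto)
qed

section \<open>The shape operator of nu and chart-independent quantities\<close>

definition shape :: "(real^'m::finite \<Rightarrow> real^'n::finite) \<Rightarrow> (real^'m \<Rightarrow> real^'n) \<Rightarrow> real^'m \<Rightarrow> real^'m^'m"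
  where "shape X \<nu> x = (\<chi> k i. - coords X x (pd i \<nu> x) $ k)"

text \<open>For a shape operator self-adjoint with respect to the induced metric this trace is
  |W|^2. In this form no metric appears, and invariance under conjugation is immediate.\<close>

definition shape_sq :: "(real^'m::finite \<Rightarrow> real^'n::finite) \<Rightarrow> (real^'m \<Rightarrow> real^'n) \<Rightarrow> real^'m \<Rightarrow> real"
  where "shape_sq X \<nu> x = trace (shape X \<nu> x ** shape X \<nu> x)"

text \<open>This is D nu(F^T), since X + h nu is the tangential part of the position. On a shrinker
  it equals minus the gradient of h (see \<open>dh_speed\<close>), written as an ambient vector so
  that different charts give the same value.\<close>

definition normal_speed ::
  "(real^'m::finite \<Rightarrow> real^'n::finite) \<Rightarrow> (real^'m \<Rightarrow> real^'n) \<Rightarrow> (real^'m \<Rightarrow> real) \<Rightarrow> real^'m \<Rightarrow> real^'n"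
  where "normal_speed X \<nu> h x =
    frechet_derivative \<nu> (at x) (coords X x (X x + h x *\<^sub>R \<nu> x))"

lemma weingarten_partial:
  assumes shr: "shrinker_on S X \<nu> h" and x: "x \<in> S"
  shows "pd i \<nu> x = - (\<Sum>k\<in>UNIV. shape X \<nu> x $ k $ i *\<^sub>R pd k X x)"
proof -
  note s = shrinker_onD[OF shr]
  have "pd i \<nu> x = frechet_derivative X (at x) (coords X x (pd i \<nu> x))"
    using frechet_derivative_coords[OF s(11)[OF x] s(4)[OF x] s(8)[OF x]] by simp
  then show ?thesis
    by (simp add: frechet_derivative_eq_sum_partial_deriv[OF s(11)[OF x]] shape_def sum_negf)
qed

lemma weingarten:
  assumes shr: "shrinker_on S X \<nu> h" and x: "x \<in> S"
  shows "frechet_derivative \<nu> (at x) v = - frechet_derivative X (at x) (shape X \<nu> x *v v)"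
proof -
  note s = shrinker_onD[OF shr]
  have "frechet_derivative \<nu> (at x) v =
     - (\<Sum>i\<in>UNIV. \<Sum>k\<in>UNIV. (shape X \<nu> x $ k $ i * v $ i) *\<^sub>R pd k X x)"
    by (simp add: frechet_derivative_eq_sum_partial_deriv[OF s(12)[OF x]]
        weingarten_partial[OF shr x] scaleR_sum_right sum_negf mult.commute)
  also have "\<dots> = - (\<Sum>k\<in>UNIV. \<Sum>i\<in>UNIV. (shape X \<nu> x $ k $ i * v $ i) *\<^sub>R pd k X x)"
    by (subst sum.swap) simp
  also have "\<dots> = - frechet_derivative X (at x) (shape X \<nu> x *v v)"
    by (simp add: frechet_derivative_eq_sum_partial_deriv[OF s(11)[OF x]]
        matrix_vector_mult_def scaleR_sum_left)
  finally show ?thesis .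
qed

text \<open>The Jacobian J of the coordinate change intertwines the two shape operators, J W' = W J,
  so they are conjugate and their squares have equal traces. Likewise J maps the coordinates of F^T
  in one chart to those in the other.\<close>

lemma reparam_invariants:
  fixes X :: "real^'m::finite \<Rightarrow> real^'n::finite" and Y :: "real^'m \<Rightarrow> real^'n"
  assumes X: "shrinker_on S X \<nu> h" and Y: "shrinker_on S' Y \<mu> k"
    and p: "smooth_on \<phi> T" and sub: "\<phi> ` T \<subseteq> S" and TS: "T \<subseteq> S'"
    and eq: "\<And>y. y \<in> T \<Longrightarrow> Y y = X (\<phi> y)" "\<And>y. y \<in> T \<Longrightarrow> \<mu> y = \<nu> (\<phi> y)"
      "\<And>y. y \<in> T \<Longrightarrow> k y = h (\<phi> y)"
    and y: "y \<in> T"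
  shows "shape_sq Y \<mu> y = shape_sq X \<nu> (\<phi> y)"
    and "normal_speed Y \<mu> k y = normal_speed X \<nu> h (\<phi> y)"
proof -
  note sX = shrinker_onD[OF X] and sY = shrinker_onD[OF Y]
  have py: "\<phi> y \<in> S" and y': "y \<in> S'" using sub TS y by auto
  let ?D = "frechet_derivative \<phi> (at y)"
  have lin: "linear ?D"
    using p y linear_frechet_derivative smooth_on_differentiable by blast
  define J where "J = matrix ?D"
  have J: "?D v = J *v v" for v
    using lin by (simp add: J_def matrix_works)
  have DY: "frechet_derivative Y (at y) v = frechet_derivative X (at (\<phi> y)) (J *v v)" for v
    using frechet_derivative_compose_eq[OF sX(1) p sub y eq(1)] by (simp add: J)
  have Dm: "frechet_derivative \<mu> (at y) v = frechet_derivative \<nu> (at (\<phi> y)) (J *v v)" for v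
    using frechet_derivative_compose_eq[OF sX(2) p sub y eq(2)] by (simp add: J)
  have injX: "frechet_derivative X (at (\<phi> y)) a = frechet_derivative X (at (\<phi> y)) b \<Longrightarrow> a = b" for a b
    using sX(4)[OF py] by (simp add: inj_def)
  \<comment> \<open>DY factors through J, so J inherits injectivity from the immersion Y.\<close>
  have "inj ((*v) J)"
    using sY(4)[OF y'] by (auto simp: inj_def DY)
  then obtain J' where J': "J' ** J = mat 1"
    using matrix_left_invertible_injective[of J] by auto
  then have J'': "J ** J' = mat 1"
    using matrix_left_right_inverse by blast
  let ?W = "shape X \<nu> (\<phi> y)" and ?W' = "shape Y \<mu> y"
  have "J *v (?W' *v v) = ?W *v (J *v v)" for v
    using weingarten[OF Y y', of v] weingarten[OF X py, of "J *v v"]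
    by (intro injX) (simp add: DY Dm)
  then have JW: "J ** ?W' = ?W ** J"
    by (simp add: matrix_eq matrix_vector_mul_assoc)
  have "shape_sq Y \<mu> y = trace ((J' ** J) ** ?W' ** ?W')"
    by (simp add: shape_sq_def J')
  also have "\<dots> = trace (J' ** ((J ** ?W') ** ?W'))"
    by (simp add: matrix_mul_assoc)
  also have "\<dots> = trace (J' ** ((?W ** J) ** ?W'))"
    by (simp only: JW)
  also have "\<dots> = trace (J' ** (?W ** (J ** ?W')))"
    by (simp add: matrix_mul_assoc)
  also have "\<dots> = trace (J' ** (?W ** (?W ** J)))"
    by (simp only: JW)
  also have "\<dots> = trace (J' ** (?W ** ?W ** J))"
    by (simp add: matrix_mul_assoc)
  also have "\<dots> = trace ((?W ** ?W ** J) ** J')"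
    by (rule trace_mul_sym)
  also have "\<dots> = trace (?W ** ?W ** (J ** J'))"
    by (simp add: matrix_mul_assoc)
  finally show "shape_sq Y \<mu> y = shape_sq X \<nu> (\<phi> y)"
    by (simp add: shape_sq_def J'')
  let ?t = "X (\<phi> y) + h (\<phi> y) *\<^sub>R \<nu> (\<phi> y)"
  have "frechet_derivative X (at (\<phi> y)) (J *v coords Y y ?t) = ?t"
    using frechet_derivative_coords[OF sY(11)[OF y'] sY(4)[OF y'] sY(9)[OF y']]
    by (simp add: DY eq y)
  also have "\<dots> = frechet_derivative X (at (\<phi> y)) (coords X (\<phi> y) ?t)"
    using frechet_derivative_coords[OF sX(11)[OF py] sX(4)[OF py] sX(9)[OF py]] by simp
  finally have "J *v coords Y y ?t = coords X (\<phi> y) ?t"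
    by (rule injX)
  then show "normal_speed Y \<mu> k y = normal_speed X \<nu> h (\<phi> y)"
    by (simp add: normal_speed_def Dm eq y)
qed

lemma shape_sq_eq: "shape_sq X \<nu> x = (\<Sum>i\<in>UNIV. \<Sum>k\<in>UNIV. shape X \<nu> x $ k $ i * shape X \<nu> x $ i $ k)"
  by (simp add: shape_sq_def trace_def matrix_matrix_mult_def mult.commute)

lemma smooth_on_shape:
  assumes shr: "shrinker_on S X \<nu> h"
  shows "smooth_on (\<lambda>x. shape X \<nu> x $ k $ i) S"
proof -
  note s = shrinker_onD[OF shr]
  have "smooth_on (\<lambda>x. - coords X x (pd i \<nu> x) $ k) S"
    by (intro smooth_on_minus smooth_on_coords s smooth_on_partial_deriv)
  then show ?thesis by (simp add: shape_def)
qed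

lemma smooth_on_shape_sq:
  assumes shr: "shrinker_on S X \<nu> h"
  shows "smooth_on (shape_sq X \<nu>) S"
  unfolding shape_sq_eq[abs_def]
  by (intro smooth_on_sum smooth_on_mult smooth_on_shape[OF shr] shrinker_onD(13)[OF shr])

lemma smooth_on_normal_speed:
  assumes shr: "shrinker_on S X \<nu> h"
  shows "smooth_on (normal_speed X \<nu> h) S"
proof -
  note s = shrinker_onD[OF shr]
  have "smooth_on (\<lambda>x. \<Sum>k\<in>UNIV. coords X x (X x + h x *\<^sub>R \<nu> x) $ k *\<^sub>R pd k \<nu> x) S"
    by (intro smooth_on_sum smooth_on_scaleR smooth_on_coords smooth_on_add smooth_on_partial_deriv s)
  then show ?thesis
    by (rule smooth_on_cong)
       (simp add: normal_speed_def frechet_derivative_eq_sum_partial_deriv[OF s(12)])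
qed

subsection \<open>Coordinates adapted to a point\<close>

lemma quadratic_map:
  fixes l :: "'m::finite \<Rightarrow> 'b::euclidean_space" and q :: "'m \<Rightarrow> 'm \<Rightarrow> 'b" and x0 :: 'b
  assumes sym: "\<And>i j. q i j = q j i"
    and \<phi>_def: "\<phi> = (\<lambda>y::real^'m. x0 + (\<Sum>i\<in>UNIV. y $ i *\<^sub>R l i) +
    (1/2) *\<^sub>R (\<Sum>i\<in>UNIV. \<Sum>j\<in>UNIV. (y $ i * y $ j) *\<^sub>R q i j))"
  shows "smooth_on \<phi> UNIV"
    and "pd i \<phi> y = l i + (\<Sum>j\<in>UNIV. y $ j *\<^sub>R q i j)"
    and "pd j (pd i \<phi>) y = q i j"
proof -
  have nth: "smooth_on (\<lambda>y::real^'m. y $ i) UNIV" for i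
    by (intro smooth_on_vec_nth smooth_on_ident) auto
  show "smooth_on \<phi> UNIV"
    unfolding \<phi>_def
    by (intro smooth_on_add smooth_on_sum smooth_on_scaleR smooth_on_mult smooth_on_const nth) auto
  have d1: "pd i \<phi> y = l i + (\<Sum>j\<in>UNIV. y $ j *\<^sub>R q i j)" for i y
  proof -
    have "(\<phi> has_derivative (\<lambda>v. (\<Sum>i\<in>UNIV. v $ i *\<^sub>R l i) +
      (1/2) *\<^sub>R (\<Sum>i\<in>UNIV. \<Sum>j\<in>UNIV. (y $ i * v $ j + v $ i * y $ j) *\<^sub>R q i j))) (at y)"
      unfolding \<phi>_def
      by (auto intro!: derivative_eq_intros bounded_linear.has_derivative[OF bounded_linear_vec_nth]
          simp: scaleR_add_left sum.distrib)
    from partial_deriv_eqI[OF this, of i]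
    have "pd i \<phi> y = (\<Sum>a\<in>UNIV. axis i 1 $ a *\<^sub>R l a) +
      (1/2) *\<^sub>R (\<Sum>a\<in>UNIV. \<Sum>b\<in>UNIV. (y $ a * axis i 1 $ b + axis i 1 $ a * y $ b) *\<^sub>R q a b)" .
    also have "(\<Sum>a\<in>UNIV. axis i (1::real) $ a *\<^sub>R l a) = l i"
      by (simp add: axis_def if_distrib if_distribR cong: if_cong)
    also have "(\<Sum>a\<in>UNIV. \<Sum>b\<in>UNIV. (y $ a * axis i 1 $ b + axis i 1 $ a * y $ b) *\<^sub>R q a b) =
       (\<Sum>a\<in>UNIV. y $ a *\<^sub>R q a i) + (\<Sum>b\<in>UNIV. y $ b *\<^sub>R q i b)"
    proof -
      have "(\<Sum>a\<in>UNIV. \<Sum>b\<in>UNIV. (axis i 1 $ a * y $ b) *\<^sub>R q a b) =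
          (\<Sum>a\<in>UNIV. if a = i then (\<Sum>b\<in>UNIV. y $ b *\<^sub>R q i b) else 0)"
        by (intro sum.cong) (auto simp: axis_def)
      moreover have "(\<Sum>a\<in>UNIV. \<Sum>b\<in>UNIV. (y $ a * axis i 1 $ b) *\<^sub>R q a b) =
          (\<Sum>a\<in>UNIV. \<Sum>b\<in>UNIV. if b = i then y $ a *\<^sub>R q a i else 0)"
        by (intro sum.cong) (auto simp: axis_def)
      ultimately show ?thesis
        by (simp add: scaleR_add_left sum.distrib)
    qed
    also have "\<dots> = 2 *\<^sub>R (\<Sum>b\<in>UNIV. y $ b *\<^sub>R q i b)"
      by (simp add: sym[of _ i] scaleR_2)
    finally show ?thesis by simp
  qed
  then show "pd i \<phi> y = l i + (\<Sum>j\<in>UNIV. y $ j *\<^sub>R q i j)" .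
  have "((\<lambda>y. l i + (\<Sum>j\<in>UNIV. y $ j *\<^sub>R q i j)) has_derivative
      (\<lambda>v. \<Sum>j\<in>UNIV. v $ j *\<^sub>R q i j)) (at y)"
    by (auto intro!: derivative_eq_intros bounded_linear.has_derivative[OF bounded_linear_vec_nth])
  from partial_deriv_eqI[OF this, of j]
  show "pd j (pd i \<phi>) y = q i j"
    unfolding d1[abs_def] by (simp add: axis_def if_distrib if_distribR cong: if_cong)
qed

text \<open>The linear part of the coordinate change pulls back an orthonormal basis of the tangent
  space. The quadratic part is chosen to cancel the tangential components of the second derivatives
  at the base point. The metric is then the identity to first order at 0; its second derivatives
  survive and carry the curvature.\<close>

lemma adapted_coordinates:
  fixes X :: "real^'m::finite \<Rightarrow> real^'n::finite"
  assumes X: "smooth_on X S" and inj: "\<And>x. x \<in> S \<Longrightarrow> inj (frechet_derivative X (at x))"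
    and x0: "x0 \<in> S"
  obtains \<phi> :: "real^'m \<Rightarrow> real^'m" and T where "smooth_on \<phi> T" "\<phi> ` T \<subseteq> S" "0 \<in> T" "\<phi> 0 = x0"
    and "\<And>y. y \<in> T \<Longrightarrow> inj (frechet_derivative \<phi> (at y))"
    and "\<And>i j. pd i (\<lambda>y. X (\<phi> y)) 0 \<bullet> pd j (\<lambda>y. X (\<phi> y)) 0 =
      (if i = j then 1 else 0)"
    and "\<And>i j k. pd i (pd j (\<lambda>y. X (\<phi> y))) 0 \<bullet>
      pd k (\<lambda>y. X (\<phi> y)) 0 = 0"
proof -
  let ?D = "frechet_derivative X (at x0)"
  have S: "open S" using X by (rule smooth_on_open)
  note diff = smooth_on_differentiable[OF X x0]
  have lin: "linear ?D" using diff by (rule linear_frechet_derivative)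
  note T = subspace_tangent_space[OF diff]
  have dim: "dim (tangent_space X x0) = CARD('m)"
    unfolding tangent_space_def
    using dim_image_eq[OF lin, of UNIV] inj[OF x0] by simp
  obtain B where B: "B \<subseteq> tangent_space X x0" "pairwise orthogonal B"
    "\<And>x. x \<in> B \<Longrightarrow> norm x = 1" "card B = CARD('m)"
    using orthonormal_basis_subspace[OF T] dim by metis
  have "finite B" using B(4) by (metis card.infinite card_eq_0_iff finite UNIV_not_empty)
  then obtain e :: "'m \<Rightarrow> real^'n" where e: "bij_betw e UNIV B"
    using B(4) finite_same_card_bij[of "UNIV::'m set" B] by auto
  have eB: "e i \<in> B" for i using e by (auto simp: bij_betw_def)
  have ee: "e i \<bullet> e j = (if i = j then 1 else 0)" for i j
  proof (cases "i = j")
    case False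
    then have "e i \<noteq> e j" using e by (auto simp: bij_betw_def inj_def)
    then show ?thesis
      using B(2) eB[of i] eB[of j] False by (auto simp: pairwise_def orthogonal_def)
  qed (use B(3)[OF eB[of i]] in \<open>simp add: dot_square_norm\<close>)
  define l where "l i = coords X x0 (e i)" for i
  have Dl: "?D (l i) = e i" for i
    unfolding l_def using frechet_derivative_coords[OF diff inj[OF x0]] eB B(1) by blast
  define v where "v i j = (\<Sum>a\<in>UNIV. \<Sum>b\<in>UNIV. (l i $ a * l j $ b) *\<^sub>R
      pd a (pd b X) x0)" for i j
  define q where "q i j = - coords X x0 (v i j)" for i j
  have vs: "v i j = v j i" for i j
  proof -
    have "v i j = (\<Sum>b\<in>UNIV. \<Sum>a\<in>UNIV. (l i $ a * l j $ b) *\<^sub>R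
      pd a (pd b X) x0)"
      unfolding v_def by (rule sum.swap)
    also have "\<dots> = v j i"
      unfolding v_def
      by (intro sum.cong refl) (simp add: partial_deriv_commute[OF X x0] mult.commute)
    finally show ?thesis .
  qed
  then have qs: "q i j = q j i" for i j by (simp add: q_def)
  define \<phi> where "\<phi> = (\<lambda>y::real^'m. x0 + (\<Sum>i\<in>UNIV. y $ i *\<^sub>R l i) +
    (1/2) *\<^sub>R (\<Sum>i\<in>UNIV. \<Sum>j\<in>UNIV. (y $ i * y $ j) *\<^sub>R q i j))"
  note quad = quadratic_map[OF qs \<phi>_def]
  have p0: "\<phi> 0 = x0" by (simp add: \<phi>_def)
  have l: "pd i \<phi> 0 = l i" for i by (simp add: quad)
  define J :: "real^'m \<Rightarrow> real^'m^'m" where "J y = (\<chi> a i. pd i \<phi> y $ a)" for y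
  have J: "frechet_derivative \<phi> (at y) c = J y *v c" for y c
    by (simp add: frechet_derivative_eq_sum_partial_deriv[OF
        smooth_on_differentiable[OF quad(1) UNIV_I]] J_def matrix_vector_mult_def vec_eq_iff
        mult.commute)
  have injJ: "inj (frechet_derivative \<phi> (at y)) \<longleftrightarrow> det (J y) \<noteq> 0" for y
  proof -
    have "frechet_derivative \<phi> (at y) = (*v) (J y)" using J by auto
    then show ?thesis
      using inj_matrix_vector_mult[of "J y"] matrix_left_invertible_injective[of "J y"]
        invertible_left_inverse[of "J y"] invertible_det_nz[of "J y"] by auto
  qed
  have "smooth_on (\<lambda>y. det (J y)) UNIV"
    by (intro smooth_on_det) (simp_all add: J_def smooth_on_vec_nth smooth_on_partial_deriv quad(1))
  then have contJ: "continuous_on UNIV (\<lambda>y. det (J y))" by (rule smooth_on_continuous_on)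
  have contp: "continuous_on UNIV \<phi>" using quad(1) by (rule smooth_on_continuous_on)
  \<comment> \<open>The quadratic map is defined everywhere; T is where it stays in S and remains a
    local diffeomorphism.\<close>
  define T where "T = \<phi> -` S \<inter> (\<lambda>y. det (J y)) -` (- {0})"
  have oT: "open T"
    unfolding T_def using contJ contp S by (intro open_Int open_vimage) auto
  have Dp0: "?D (frechet_derivative \<phi> (at 0) c) = (\<Sum>i\<in>UNIV. c $ i *\<^sub>R e i)" for c
    by (simp add: frechet_derivative_eq_sum_partial_deriv[OF
        smooth_on_differentiable[OF quad(1) UNIV_I]] l linear_sum[OF lin] linear_scale[OF lin] Dl)
  have "inj (frechet_derivative \<phi> (at 0))"
  proof (rule injI)
    fix c d assume "frechet_derivative \<phi> (at 0) c = frechet_derivative \<phi> (at 0) d"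
    then have "(\<Sum>i\<in>UNIV. c $ i *\<^sub>R e i) \<bullet> e k = (\<Sum>i\<in>UNIV. d $ i *\<^sub>R e i) \<bullet> e k" for k
      using Dp0 by metis
    then show "c = d"
      by (simp add: inner_sum_left ee vec_eq_iff if_distrib cong: if_cong)
  qed
  then have 0: "0 \<in> T"
    using injJ p0 x0 by (simp add: T_def)
  have pT: "smooth_on \<phi> T" "\<phi> ` T \<subseteq> S"
    using smooth_on_subset[OF quad(1) oT] by (auto simp: T_def)
  have Y1: "pd i (\<lambda>y. X (\<phi> y)) 0 = e i" for i
  proof -
    have "pd i (\<lambda>y. X (\<phi> y)) 0 = ?D (l i)"
      using partial_deriv_chain[OF X pT(1) 0, of i] p0 x0
      by (simp add: l frechet_derivative_eq_sum_partial_deriv[OF diff])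
    then show ?thesis by (simp add: Dl)
  qed
  have Y2: "pd i (pd j (\<lambda>y. X (\<phi> y))) 0 \<in> normal_space X x0" for i j
  proof -
    have "pd i (pd j (\<lambda>y. X (\<phi> y))) 0 = ?D (q j i) + v i j"
      using partial_deriv_chain2[OF X pT 0, of i j] p0
      by (simp add: l quad(3) v_def frechet_derivative_eq_sum_partial_deriv[OF diff])
    also have "\<dots> = normal_part X x0 (v i j)"
      by (simp add: q_def vs[of j i] normal_part_eq_coords[OF diff inj[OF x0]] linear_neg[OF lin])
    also have "\<dots> \<in> normal_space X x0" by (rule normal_part(1)[OF diff])
    finally show ?thesis .
  qed
  show ?thesis
  proof (rule that[OF pT 0 p0])
    show "inj (frechet_derivative \<phi> (at y))" if "y \<in> T" for y
      using that injJ by (simp add: T_def)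
    show "pd i (\<lambda>y. X (\<phi> y)) 0 \<bullet> pd j (\<lambda>y. X (\<phi> y)) 0 =
      (if i = j then 1 else 0)" for i j
      by (simp add: Y1 ee)
    show "pd i (pd j (\<lambda>y. X (\<phi> y))) 0 \<bullet>
      pd k (\<lambda>y. X (\<phi> y)) 0 = 0" for i j k
    proof -
      have "e k \<in> tangent_space X x0" using eB B(1) by blast
      then show ?thesis
        using Y2[of i j] unfolding Y1
        by (auto simp: normal_space_def orthogonal_comp_def orthogonal_def inner_commute)
    qed
  qed
qed

subsection \<open>Gauss-Codazzi-Ricci calculus at a point\<close>

text \<open>The shrinker conditions hold on all of S and can be differentiated; the result is
  evaluated at 0, where the Christoffel symbols vanish, so that Hessians of functions and first
  covariant derivatives of tensors there are plain partial derivatives.\<close>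

locale adapted_shrinker =
  fixes S :: "(real^'m::finite) set" and X \<nu> :: "real^'m \<Rightarrow> real^'n::finite" and h :: "real^'m \<Rightarrow> real"
  assumes shr: "shrinker_on S X \<nu> h" and zero: "0 \<in> S"
    and orth: "pd i X 0 \<bullet> pd j X 0 = (if i = j then 1 else 0)"
    and nor: "pd i (pd j X) 0 \<bullet> pd k X 0 = 0"
begin

text \<open>The mixed tensor W_i^k, lower index first. It coincides with the symmetric form A.nu at
  0 only, where the metric is the identity.\<close>

abbreviation W where "W i k x \<equiv> shape X \<nu> x $ k $ i"
abbreviation \<theta> where "\<theta> k x \<equiv> coords X x (X x + h x *\<^sub>R \<nu> x) $ k"
abbreviation dX where "dX i \<equiv> pd i X"
abbreviation d2X where "d2X i j \<equiv> pd i (pd j X)"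
abbreviation d3X where "d3X i j k \<equiv> pd i (pd j (pd k X))"
abbreviation W2 where "W2 \<equiv> (\<Sum>i\<in>UNIV. \<Sum>k\<in>UNIV. (W i k 0)\<^sup>2)"

lemmas sX = shrinker_onD(1)[OF shr] and s\<nu> = shrinker_onD(2)[OF shr] and sh = shrinker_onD(3)[OF shr]
lemmas inj = shrinker_onD(4)[OF shr] and hpos = shrinker_onD(5)[OF shr]
lemmas diffX = shrinker_onD(11)[OF shr] and diff\<nu> = shrinker_onD(12)[OF shr]
lemmas openS = shrinker_onD(13)[OF shr]
lemmas s\<nu>1 = smooth_on_partial_deriv[OF s\<nu>]
lemmas sh1 = smooth_on_partial_deriv[OF sh]
lemmas sX1 = smooth_on_partial_deriv[OF sX]
lemmas sX2 = smooth_on_partial_deriv[OF sX1]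

lemma sW: "smooth_on (W i k) S"
  by (rule smooth_on_shape[OF shr])

lemmas sW1 = smooth_on_partial_deriv[OF sW]

lemma s\<theta>: "smooth_on (\<theta> k) S"
  by (intro smooth_on_coords sX inj smooth_on_add smooth_on_scaleR sh s\<nu>)

lemmas s\<theta>1 = smooth_on_partial_deriv[OF s\<theta>]

lemma \<nu>_unit: "x \<in> S \<Longrightarrow> \<nu> x \<bullet> \<nu> x = 1"
  by (rule shrinker_onD(6)[OF shr])

lemma dX_\<nu>: "x \<in> S \<Longrightarrow> dX i x \<bullet> \<nu> x = 0"
  using shrinker_onD(7)[OF shr] normal_space_iff[OF diffX] by blast

lemma d\<nu>: "x \<in> S \<Longrightarrow> pd i \<nu> x = - (\<Sum>k\<in>UNIV. W i k x *\<^sub>R dX k x)"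
  by (rule weingarten_partial[OF shr])

lemma d\<nu>_\<nu>: "x \<in> S \<Longrightarrow> pd i \<nu> x \<bullet> \<nu> x = 0"
  by (simp add: d\<nu> inner_sum_left dX_\<nu>)

lemma position: "x \<in> S \<Longrightarrow> X x + h x *\<^sub>R \<nu> x = (\<Sum>k\<in>UNIV. \<theta> k x *\<^sub>R dX k x)"
  using frechet_derivative_coords[OF diffX inj shrinker_onD(9)[OF shr]]
  by (simp add: frechet_derivative_eq_sum_partial_deriv[OF diffX])

section \<open>Symmetry of the shape operator and its derivatives\<close>

lemma d2X_\<nu>:
  assumes x: "x \<in> S"
  shows "d2X i j x \<bullet> \<nu> x = - (dX j x \<bullet> pd i \<nu> x)"
proof -
  have "pd i (\<lambda>x. dX j x \<bullet> \<nu> x) x = pd i (\<lambda>x. 0) x"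
    by (intro partial_deriv_cong[OF openS x]) (simp add: dX_\<nu>)
  then show ?thesis
    using partial_deriv_inner[OF sX1[of j] s\<nu> x, of i] by (simp add: partial_deriv_const)
qed

lemma d2X_\<nu>_W:
  assumes x: "x \<in> S"
  shows "d2X i j x \<bullet> \<nu> x = (\<Sum>k\<in>UNIV. W i k x * (dX k x \<bullet> dX j x))"
  by (simp add: d2X_\<nu> x d\<nu> inner_sum_right inner_commute[of "dX j x"])

lemma d2X_commute: "x \<in> S \<Longrightarrow> d2X i j x = d2X j i x"
  by (rule partial_deriv_commute[OF sX])

lemma d3X_commute12: "x \<in> S \<Longrightarrow> d3X i j k x = d3X j i k x"
  by (rule partial_deriv_commute[OF sX1])

lemma d3X_commute23: "x \<in> S \<Longrightarrow> d3X i j k x = d3X i k j x"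
  by (intro partial_deriv_cong[OF openS]) (auto simp: d2X_commute)

text \<open>With its index lowered, W is the second fundamental form in direction nu. The symmetry
  is recorded on all of S so that it can be differentiated.\<close>

lemma W_lower_sym:
  assumes x: "x \<in> S"
  shows "(\<Sum>k\<in>UNIV. W i k x * (dX k x \<bullet> dX j x)) = (\<Sum>k\<in>UNIV. W j k x * (dX k x \<bullet> dX i x))"
  using d2X_\<nu>_W[OF x, of i j] d2X_\<nu>_W[OF x, of j i] d2X_commute[OF x, of i j] by simp

lemma d2X_\<nu>_0: "d2X i j 0 \<bullet> \<nu> 0 = W i j 0"
  by (simp add: d2X_\<nu>_W[OF zero] orth if_distrib cong: if_cong)

lemma W_sym: "W i k 0 = W k i 0"
  using d2X_\<nu>_0[of i k] d2X_\<nu>_0[of k i] d2X_commute[OF zero, of i k] by simp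

lemma mean_curvature_trace:
  assumes x: "x \<in> S"
  shows "h x = (\<Sum>i\<in>UNIV. W i i x)"
proof -
  let ?G = "inverse_metric X x"
  have "\<nu> x \<in> normal_space X x" by (rule shrinker_onD(7)[OF shr x])
  then have "((\<Sum>i\<in>UNIV. \<Sum>j\<in>UNIV. ?G $ i $ j *\<^sub>R d2X i j x) - h x *\<^sub>R \<nu> x) \<bullet> \<nu> x = 0"
    using shrinker_onD(10)[OF shr x]
    by (auto simp: normal_space_def orthogonal_comp_def orthogonal_def)
  then have "h x = (\<Sum>i\<in>UNIV. \<Sum>j\<in>UNIV. ?G $ i $ j * (d2X i j x \<bullet> \<nu> x))"
    by (simp add: inner_diff_left inner_sum_left \<nu>_unit x)
  also have "\<dots> = (\<Sum>i\<in>UNIV. \<Sum>j\<in>UNIV. \<Sum>k\<in>UNIV. W i k x * (?G $ i $ j * (dX j x \<bullet> dX k x)))"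
    unfolding d2X_\<nu>_W[OF x] by (simp add: sum_distrib_left inner_commute mult_ac)
  also have "\<dots> = (\<Sum>i\<in>UNIV. \<Sum>k\<in>UNIV. \<Sum>j\<in>UNIV. W i k x * (?G $ i $ j * (dX j x \<bullet> dX k x)))"
    by (intro sum.cong refl sum.swap)
  also have "\<dots> = (\<Sum>i\<in>UNIV. \<Sum>k\<in>UNIV. W i k x * (if i = k then 1 else 0))"
    by (simp add: sum_inverse_metric_mult[OF diffX[OF x] inj[OF x]] flip: sum_distrib_left)
  finally show ?thesis by (simp add: if_distrib cong: if_cong)
qed

lemma sum_orth: "(\<Sum>k\<in>UNIV. c k * (dX k 0 \<bullet> dX j 0)) = c j"
  by (simp add: orth if_distrib cong: if_cong)

lemma dmetric_0: "pd p (\<lambda>x. dX i x \<bullet> dX j x) 0 = 0"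
  using partial_deriv_inner[OF sX1[of i] sX1[of j] zero, of p] nor[of p i j] nor[of p j i]
  by (simp add: inner_commute)

lemma d2metric_0: "pd q (pd p (\<lambda>x. dX i x \<bullet> dX j x)) 0 =
   d3X q p i 0 \<bullet> dX j 0 + d3X q p j 0 \<bullet> dX i 0 + d2X p i 0 \<bullet> d2X q j 0 + d2X q i 0 \<bullet> d2X p j 0"
proof -
  have "pd q (pd p (\<lambda>x. dX i x \<bullet> dX j x)) 0 =
    pd q (\<lambda>x. dX i x \<bullet> d2X p j x + d2X p i x \<bullet> dX j x) 0"
    by (intro partial_deriv_cong[OF openS zero] partial_deriv_inner[OF sX1 sX1])
  also have "\<dots> = pd q (\<lambda>x. dX i x \<bullet> d2X p j x) 0 + pd q (\<lambda>x. d2X p i x \<bullet> dX j x) 0"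
    by (intro partial_deriv_add[where S = S] smooth_on_inner sX1 sX2 zero)
  finally show ?thesis
    using partial_deriv_inner[OF sX1[of i] sX2[of p j] zero, of q]
      partial_deriv_inner[OF sX2[of p i] sX1[of j] zero, of q]
    by (simp add: inner_commute)
qed

lemma dW_lower:
  assumes x: "x \<in> S"
  shows "pd p (\<lambda>x. \<Sum>k\<in>UNIV. W i k x * (dX k x \<bullet> dX j x)) x =
    (\<Sum>k\<in>UNIV. W i k x * pd p (\<lambda>x. dX k x \<bullet> dX j x) x +
      pd p (W i k) x * (dX k x \<bullet> dX j x))"
  unfolding partial_deriv_sum[OF smooth_on_mult[OF sW smooth_on_inner[OF sX1 sX1]] x]
  by (intro sum.cong refl partial_deriv_mult[OF sW smooth_on_inner[OF sX1 sX1] x])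

lemma dW_lower_0:
  "pd p (\<lambda>x. \<Sum>k\<in>UNIV. W i k x * (dX k x \<bullet> dX j x)) 0 = pd p (W i j) 0"
  by (simp add: dW_lower[OF zero] dmetric_0 orth if_distrib cong: if_cong)

lemma d2W_lower_0:
  "pd q (pd p (\<lambda>x. \<Sum>k\<in>UNIV. W i k x * (dX k x \<bullet> dX j x))) 0 =
    pd q (pd p (W i j)) 0 +
    (\<Sum>k\<in>UNIV. W i k 0 * pd q (pd p (\<lambda>x. dX k x \<bullet> dX j x)) 0)"
proof -
  have sg: "smooth_on (\<lambda>x. dX k x \<bullet> dX j x) S" for k
    by (intro smooth_on_inner sX1)
  note sg1 = smooth_on_partial_deriv[OF sg]
  have "pd q (pd p (\<lambda>x. \<Sum>k\<in>UNIV. W i k x * (dX k x \<bullet> dX j x))) 0 =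
    pd q (\<lambda>x. \<Sum>k\<in>UNIV. W i k x * pd p (\<lambda>x. dX k x \<bullet> dX j x) x +
      pd p (W i k) x * (dX k x \<bullet> dX j x)) 0"
    by (intro partial_deriv_cong[OF openS zero] dW_lower)
  also have "\<dots> = (\<Sum>k\<in>UNIV. pd q (\<lambda>x. W i k x * pd p (\<lambda>x. dX k x \<bullet> dX j x) x +
      pd p (W i k) x * (dX k x \<bullet> dX j x)) 0)"
    by (intro partial_deriv_sum[where S = S] smooth_on_add smooth_on_mult sW sW1 sg sg1 zero)
  also have "\<dots> = (\<Sum>k\<in>UNIV. W i k 0 * pd q (pd p (\<lambda>x. dX k x \<bullet> dX j x)) 0 +
      pd q (pd p (W i k)) 0 * (dX k 0 \<bullet> dX j 0))"
  proof (intro sum.cong refl)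
    fix k
    have "pd q (\<lambda>x. W i k x * pd p (\<lambda>x. dX k x \<bullet> dX j x) x +
      pd p (W i k) x * (dX k x \<bullet> dX j x)) 0 =
      pd q (\<lambda>x. W i k x * pd p (\<lambda>x. dX k x \<bullet> dX j x) x) 0 +
      pd q (\<lambda>x. pd p (W i k) x * (dX k x \<bullet> dX j x)) 0"
      by (intro partial_deriv_add[where S = S] smooth_on_mult sW sW1 sg sg1 zero)
    then show "pd q (\<lambda>x. W i k x * pd p (\<lambda>x. dX k x \<bullet> dX j x) x +
      pd p (W i k) x * (dX k x \<bullet> dX j x)) 0 =
      W i k 0 * pd q (pd p (\<lambda>x. dX k x \<bullet> dX j x)) 0 +
      pd q (pd p (W i k)) 0 * (dX k 0 \<bullet> dX j 0)"
      using partial_deriv_mult[OF sW[of k i] sg1[of p k] zero, of q]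
        partial_deriv_mult[OF sW1[of p k i] sg[of k] zero, of q]
      by (simp add: dmetric_0)
  qed
  finally show ?thesis
    by (simp add: sum.distrib sum_orth)
qed

lemma dW_sym: "pd p (W i j) 0 = pd p (W j i) 0"
  unfolding dW_lower_0[symmetric] by (intro partial_deriv_cong[OF openS zero] W_lower_sym)

text \<open>Symmetry is a property of the lowered form. Differentiating it twice brings in the
  second derivatives of the metric, so the mixed second derivatives of W are symmetric only up to
  curvature terms.\<close>

lemma d2W_sym:
  "pd q (pd p (W i j)) 0 +
    (\<Sum>k\<in>UNIV. W i k 0 * pd q (pd p (\<lambda>x. dX k x \<bullet> dX j x)) 0) =
   pd q (pd p (W j i)) 0 +
    (\<Sum>k\<in>UNIV. W j k 0 * pd q (pd p (\<lambda>x. dX k x \<bullet> dX i x)) 0)"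
proof -
  have "pd p (\<lambda>x. \<Sum>k\<in>UNIV. W i k x * (dX k x \<bullet> dX j x)) x =
    pd p (\<lambda>x. \<Sum>k\<in>UNIV. W j k x * (dX k x \<bullet> dX i x)) x" if "x \<in> S" for x
    by (intro partial_deriv_cong[OF openS that] W_lower_sym)
  then show ?thesis
    unfolding d2W_lower_0[symmetric] by (intro partial_deriv_cong[OF openS zero])
qed

section \<open>Codazzi and Ricci equations\<close>

lemma d2\<nu>:
  assumes x: "x \<in> S"
  shows "pd j (pd i \<nu>) x =
    - (\<Sum>k\<in>UNIV. pd j (W i k) x *\<^sub>R dX k x + W i k x *\<^sub>R d2X j k x)"
proof -
  have "pd j (pd i \<nu>) x = pd j (\<lambda>x. - (\<Sum>k\<in>UNIV. W i k x *\<^sub>R dX k x)) x"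
    by (intro partial_deriv_cong[OF openS x] d\<nu>)
  also have "\<dots> = - pd j (\<lambda>x. \<Sum>k\<in>UNIV. W i k x *\<^sub>R dX k x) x"
    by (intro partial_deriv_minus[where S = S] smooth_on_sum smooth_on_scaleR sW sX1 openS x)
  also have "pd j (\<lambda>x. \<Sum>k\<in>UNIV. W i k x *\<^sub>R dX k x) x =
      (\<Sum>k\<in>UNIV. pd j (\<lambda>x. W i k x *\<^sub>R dX k x) x)"
    by (intro partial_deriv_sum[where S = S] smooth_on_scaleR sW sX1 x)
  also have "\<dots> = (\<Sum>k\<in>UNIV. pd j (W i k) x *\<^sub>R dX k x + W i k x *\<^sub>R d2X j k x)"
    by (intro sum.cong refl) (simp add: partial_deriv_scaleR[OF sW sX1 x] add.commute)
  finally show ?thesis .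
qed

text \<open>The tangential part of this identity is the Codazzi equation, the normal part the Ricci equation.\<close>

lemma codazzi_ricci:
  assumes x: "x \<in> S"
  shows "(\<Sum>k\<in>UNIV. pd j (W i k) x *\<^sub>R dX k x + W i k x *\<^sub>R d2X j k x) =
    (\<Sum>k\<in>UNIV. pd i (W j k) x *\<^sub>R dX k x + W j k x *\<^sub>R d2X i k x)"
  using partial_deriv_commute[OF s\<nu> x, of i j] d2\<nu>[OF x, of i j] d2\<nu>[OF x, of j i] by simp

lemma codazzi: "pd j (W i l) 0 = pd i (W j l) 0"
proof -
  have *: "(\<Sum>k\<in>UNIV. pd j (W i k) 0 *\<^sub>R dX k 0 + W i k 0 *\<^sub>R d2X j k 0) \<bullet> dX l 0 =
    pd j (W i l) 0" for i j
    by (simp add: inner_sum_left inner_add_left sum_orth nor sum.distrib)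
  show ?thesis
    unfolding *[symmetric] codazzi_ricci[OF zero, of j i] ..
qed

lemma dW_rotate: "pd i (W j k) 0 = pd k (W i j) 0"
  by (metis codazzi dW_sym)

lemma ricci: "(\<Sum>k\<in>UNIV. W i k 0 *\<^sub>R d2X j k 0) = (\<Sum>k\<in>UNIV. W j k 0 *\<^sub>R d2X i k 0)"
  using codazzi_ricci[OF zero, of j i] by (simp add: sum.distrib codazzi[where j = j and i = i])

text \<open>The tangential part of the derivative of \<open>codazzi_ricci\<close>. At 0 the second
  derivatives of X are normal, so products with first derivatives of W drop out and only third
  derivatives of X remain.\<close>

lemma d_codazzi:
  "pd p (pd j (W i l)) 0 + (\<Sum>k\<in>UNIV. W i k 0 * (d3X p j k 0 \<bullet> dX l 0)) =
   pd p (pd i (W j l)) 0 + (\<Sum>k\<in>UNIV. W j k 0 * (d3X p i k 0 \<bullet> dX l 0))"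
proof -
  have *: "pd p (\<lambda>x. \<Sum>k\<in>UNIV. pd j (W i k) x *\<^sub>R dX k x + W i k x *\<^sub>R d2X j k x) 0 \<bullet> dX l 0
    = pd p (pd j (W i l)) 0 + (\<Sum>k\<in>UNIV. W i k 0 * (d3X p j k 0 \<bullet> dX l 0))" for i j
  proof -
    have "pd p (\<lambda>x. \<Sum>k\<in>UNIV. pd j (W i k) x *\<^sub>R dX k x + W i k x *\<^sub>R d2X j k x) 0 =
      (\<Sum>k\<in>UNIV. pd p (\<lambda>x. pd j (W i k) x *\<^sub>R dX k x + W i k x *\<^sub>R d2X j k x) 0)"
      by (intro partial_deriv_sum[where S = S] smooth_on_add smooth_on_scaleR sW sW1 sX1 sX2 zero)
    also have "\<dots> = (\<Sum>k\<in>UNIV. pd p (\<lambda>x. pd j (W i k) x *\<^sub>R dX k x) 0 +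
        pd p (\<lambda>x. W i k x *\<^sub>R d2X j k x) 0)"
      by (intro sum.cong refl partial_deriv_add[where S = S] smooth_on_scaleR sW sW1 sX1 sX2 zero)
    also have "\<dots> = (\<Sum>k\<in>UNIV. pd j (W i k) 0 *\<^sub>R d2X p k 0 +
        pd p (pd j (W i k)) 0 *\<^sub>R dX k 0 +
        (W i k 0 *\<^sub>R d3X p j k 0 + pd p (W i k) 0 *\<^sub>R d2X j k 0))"
      by (simp add: partial_deriv_scaleR[OF sW sX2 zero] partial_deriv_scaleR[OF sW1 sX1 zero])
    finally show ?thesis
      by (simp add: inner_sum_left inner_add_left sum_orth nor sum.distrib)
  qed
  have "pd p (\<lambda>x. \<Sum>k\<in>UNIV. pd j (W i k) x *\<^sub>R dX k x + W i k x *\<^sub>R d2X j k x) 0 =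
    pd p (\<lambda>x. \<Sum>k\<in>UNIV. pd i (W j k) x *\<^sub>R dX k x + W j k x *\<^sub>R d2X i k x) 0"
    by (intro partial_deriv_cong[OF openS zero] codazzi_ricci)
  then show ?thesis
    by (simp flip: *)
qed

section \<open>Derivatives of the shrinker equation\<close>

lemma d_position:
  assumes x: "x \<in> S"
  shows "dX j x + pd j h x *\<^sub>R \<nu> x + h x *\<^sub>R pd j \<nu> x =
    (\<Sum>k\<in>UNIV. pd j (\<theta> k) x *\<^sub>R dX k x + \<theta> k x *\<^sub>R d2X j k x)"
proof -
  have "pd j (\<lambda>x. X x + h x *\<^sub>R \<nu> x) x = pd j (\<lambda>x. \<Sum>k\<in>UNIV. \<theta> k x *\<^sub>R dX k x) x"
    by (intro partial_deriv_cong[OF openS x] position)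
  also have "\<dots> = (\<Sum>k\<in>UNIV. pd j (\<lambda>x. \<theta> k x *\<^sub>R dX k x) x)"
    by (intro partial_deriv_sum[where S = S] smooth_on_scaleR s\<theta> sX1 x)
  finally show ?thesis
    using partial_deriv_add[OF sX smooth_on_scaleR[OF sh s\<nu>] x, of j]
    by (simp add: partial_deriv_scaleR[OF sh s\<nu> x] partial_deriv_scaleR[OF s\<theta> sX1 x] add_ac)
qed

text \<open>The tangential part of \<open>d_position\<close>: the covariant derivative of F^T is the
  identity minus h W.\<close>

lemma d\<theta>_0: "pd j (\<theta> l) 0 = (if j = l then 1 else 0) - h 0 * W j l 0"
proof -
  have "(dX j 0 + pd j h 0 *\<^sub>R \<nu> 0 + h 0 *\<^sub>R pd j \<nu> 0) \<bullet> dX l 0 =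
    (\<Sum>k\<in>UNIV. pd j (\<theta> k) 0 *\<^sub>R dX k 0 + \<theta> k 0 *\<^sub>R d2X j k 0) \<bullet> dX l 0"
    by (simp only: d_position[OF zero])
  then have "dX j 0 \<bullet> dX l 0 - h 0 * W j l 0 = pd j (\<theta> l) 0"
    using dX_\<nu>[OF zero, of l]
    by (simp add: d\<nu>[OF zero] inner_add_left inner_diff_left inner_sum_left inner_commute[of "\<nu> 0"] sum_orth nor
        sum.distrib)
  then show ?thesis by (simp add: orth)
qed

text \<open>The nu-component of \<open>d_position\<close>, in which only h and A.nu survive; at 0 it
  says D h = W(F^T).\<close>

lemma dh:
  assumes x: "x \<in> S"
  shows "pd j h x = (\<Sum>k\<in>UNIV. \<theta> k x * (d2X j k x \<bullet> \<nu> x))"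
proof -
  have "(dX j x + pd j h x *\<^sub>R \<nu> x + h x *\<^sub>R pd j \<nu> x) \<bullet> \<nu> x =
    (\<Sum>k\<in>UNIV. pd j (\<theta> k) x *\<^sub>R dX k x + \<theta> k x *\<^sub>R d2X j k x) \<bullet> \<nu> x"
    by (simp only: d_position[OF x])
  then show ?thesis
    by (simp add: inner_add_left inner_sum_left dX_\<nu>[OF x] \<nu>_unit[OF x] d\<nu>_\<nu>[OF x])
qed

lemma dh_0: "pd j h 0 = (\<Sum>k\<in>UNIV. \<theta> k 0 * W j k 0)"
  by (simp add: dh[OF zero] d2X_\<nu>_0)

text \<open>Codazzi makes D W symmetric in all three indices at 0. Therefore the derivative of
  W(F^T) contains the derivative of W in direction F^T, the term that the drift of L later
  absorbs.\<close>

lemma d2h_0: "pd i (pd j h) 0 =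
    W i j 0 - h 0 * (\<Sum>k\<in>UNIV. W i k 0 * W j k 0) + (\<Sum>k\<in>UNIV. \<theta> k 0 * pd k (W i j) 0)"
proof -
  have sb: "smooth_on (\<lambda>x. d2X j k x \<bullet> \<nu> x) S" for k
    by (intro smooth_on_inner sX2 s\<nu>)
  have b: "pd i (\<lambda>x. d2X j k x \<bullet> \<nu> x) 0 = pd k (W i j) 0" for k
  proof -
    have "pd i (\<lambda>x. d2X j k x \<bullet> \<nu> x) 0 =
        pd i (\<lambda>x. \<Sum>l\<in>UNIV. W j l x * (dX l x \<bullet> dX k x)) 0"
      by (intro partial_deriv_cong[OF openS zero] d2X_\<nu>_W)
    then show ?thesis
      by (simp add: dW_lower_0 dW_rotate[where i = i and j = j and k = k])
  qed
  have "pd i (pd j h) 0 = pd i (\<lambda>x. \<Sum>k\<in>UNIV. \<theta> k x * (d2X j k x \<bullet> \<nu> x)) 0"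
    by (intro partial_deriv_cong[OF openS zero] dh)
  also have "\<dots> = (\<Sum>k\<in>UNIV. pd i (\<lambda>x. \<theta> k x * (d2X j k x \<bullet> \<nu> x)) 0)"
    by (intro partial_deriv_sum[where S = S] smooth_on_mult s\<theta> sb zero)
  also have "\<dots> = (\<Sum>k\<in>UNIV. \<theta> k 0 * pd k (W i j) 0 +
      ((if i = k then 1 else 0) - h 0 * W i k 0) * W j k 0)"
    by (simp add: partial_deriv_mult[OF s\<theta> sb zero] b d\<theta>_0 d2X_\<nu>_0)
  also have "\<dots> = (\<Sum>k\<in>UNIV. \<theta> k 0 * pd k (W i j) 0) +
      ((\<Sum>k\<in>UNIV. (if i = k then 1 else 0) * W j k 0) - h 0 * (\<Sum>k\<in>UNIV. W i k 0 * W j k 0))"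
    by (simp add: sum.distrib left_diff_distrib sum_subtractf sum_distrib_left mult.assoc)
  also have "(\<Sum>k\<in>UNIV. (if i = k then 1 else 0) * W j k 0) = (\<Sum>k\<in>UNIV. if i = k then W j k 0 else 0)"
    by (intro sum.cong) auto
  finally show ?thesis
    by (simp add: W_sym[of i j])
qed


section \<open>Trace identities at the base point\<close>

abbreviation G where "G i j x \<equiv> inverse_metric X x $ i $ j"
abbreviation lap :: "(real^'m \<Rightarrow> 'b::real_normed_vector) \<Rightarrow> 'b"
  where "lap f \<equiv> (\<Sum>p\<in>UNIV. pd p (pd p f) 0)"

lemma G_0: "G i j 0 = (if i = j then 1 else 0)"
  using sum_inverse_metric_mult[OF diffX[OF zero] inj[OF zero], of i j] by (simp add: sum_orth)

lemma sG: "smooth_on (G i j) S"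
  by (intro smooth_on_inverse_metric sX inj)

lemma dG_0: "pd p (G i j) 0 = 0"
proof -
  have "pd p (\<lambda>x. \<Sum>k\<in>UNIV. G i k x * (dX k x \<bullet> dX j x)) 0 =
      pd p (\<lambda>x. if i = j then 1 else 0) 0"
    by (intro partial_deriv_cong[OF openS zero] sum_inverse_metric_mult[OF diffX inj])
  moreover have "pd p (\<lambda>x. \<Sum>k\<in>UNIV. G i k x * (dX k x \<bullet> dX j x)) 0 =
      (\<Sum>k\<in>UNIV. pd p (\<lambda>x. G i k x * (dX k x \<bullet> dX j x)) 0)"
    by (intro partial_deriv_sum[where S = S] smooth_on_mult smooth_on_inner sG sX1 zero)
  ultimately show ?thesis
    by (simp add: partial_deriv_mult[OF sG smooth_on_inner[OF sX1 sX1] zero] dmetric_0 sum_orth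
        partial_deriv_const)
qed

lemma mean_curvature_0: "(\<Sum>i\<in>UNIV. d2X i i 0) = h 0 *\<^sub>R \<nu> 0"
proof -
  let ?N = "(\<Sum>i\<in>UNIV. d2X i i 0) - h 0 *\<^sub>R \<nu> 0"
  have "(\<Sum>i\<in>UNIV. \<Sum>j\<in>UNIV. G i j 0 *\<^sub>R d2X i j 0) = (\<Sum>i\<in>UNIV. d2X i i 0)"
    by (simp add: G_0 if_distrib if_distribR cong: if_cong)
  then have t: "?N \<in> tangent_space X 0"
    using shrinker_onD(10)[OF shr zero] by simp
  have "dX k 0 \<bullet> ?N = 0" for k
    by (simp add: inner_diff_right inner_sum_right inner_commute[of "dX k 0" "d2X _ _ _"] nor dX_\<nu>[OF zero])
  then have "?N \<in> normal_space X 0"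
    using normal_space_iff[OF diffX[OF zero]] by blast
  with t have "?N \<bullet> ?N = 0"
    unfolding normal_space_def orthogonal_comp_def orthogonal_def by blast
  then show ?thesis by simp
qed

text \<open>The vector N is tangential on S and vanishes at 0. Its coefficients tau vanish there as
  well, so the derivative of N at 0 is again tangential and has no component along the normal vector
  \<xi>.\<close>

lemma d_mean_curvature_0:
  assumes \<xi>: "\<And>k. dX k 0 \<bullet> \<xi> = 0"
  shows "(\<Sum>i\<in>UNIV. d3X p i i 0 \<bullet> \<xi>) = pd p h 0 * (\<nu> 0 \<bullet> \<xi>)"
proof -
  define N where "N x = (\<Sum>i\<in>UNIV. \<Sum>j\<in>UNIV. G i j x *\<^sub>R d2X i j x) - h x *\<^sub>R \<nu> x" for x
  define \<tau> where "\<tau> k x = coords X x (N x) $ k" for k x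
  have sN: "smooth_on N S"
    unfolding N_def
    by (intro smooth_on_diff smooth_on_sum smooth_on_scaleR sG sX2 sh s\<nu> openS)
  have s\<tau>: "smooth_on (\<tau> k) S" for k
    unfolding \<tau>_def by (intro smooth_on_coords sX inj sN)
  have N: "N x = (\<Sum>k\<in>UNIV. \<tau> k x *\<^sub>R dX k x)" if x: "x \<in> S" for x
    using frechet_derivative_coords[OF diffX[OF x] inj[OF x] shrinker_onD(10)[OF shr x]]
    by (simp add: frechet_derivative_eq_sum_partial_deriv[OF diffX[OF x]] N_def \<tau>_def)
  have "N 0 = 0"
    using mean_curvature_0 by (simp add: N_def G_0 if_distrib if_distribR cong: if_cong)
  then have \<tau>0: "\<tau> k 0 = 0" for k
    by (simp add: \<tau>_def coords_nth)
  have "pd p N 0 = pd p (\<lambda>x. \<Sum>k\<in>UNIV. \<tau> k x *\<^sub>R dX k x) 0"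
    by (intro partial_deriv_cong[OF openS zero] N)
  also have "\<dots> = (\<Sum>k\<in>UNIV. pd p (\<lambda>x. \<tau> k x *\<^sub>R dX k x) 0)"
    by (intro partial_deriv_sum[where S = S] smooth_on_scaleR s\<tau> sX1 zero)
  also have "\<dots> = (\<Sum>k\<in>UNIV. pd p (\<tau> k) 0 *\<^sub>R dX k 0)"
    by (simp add: partial_deriv_scaleR[OF s\<tau> sX1 zero] \<tau>0)
  finally have "pd p N 0 \<bullet> \<xi> = 0"
    by (simp add: inner_sum_left \<xi>)
  moreover have "pd p N 0 = (\<Sum>i\<in>UNIV. d3X p i i 0) -
      (h 0 *\<^sub>R pd p \<nu> 0 + pd p h 0 *\<^sub>R \<nu> 0)"
  proof -
    have "pd p N 0 = pd p (\<lambda>x. \<Sum>i\<in>UNIV. \<Sum>j\<in>UNIV. G i j x *\<^sub>R d2X i j x) 0 -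
        pd p (\<lambda>x. h x *\<^sub>R \<nu> x) 0"
      unfolding N_def
      by (intro partial_deriv_diff[where S = S] smooth_on_sum smooth_on_scaleR sG sX2 sh s\<nu> openS zero)
    also have "pd p (\<lambda>x. \<Sum>i\<in>UNIV. \<Sum>j\<in>UNIV. G i j x *\<^sub>R d2X i j x) 0 =
        (\<Sum>i\<in>UNIV. pd p (\<lambda>x. \<Sum>j\<in>UNIV. G i j x *\<^sub>R d2X i j x) 0)"
      by (intro partial_deriv_sum[where S = S] smooth_on_sum smooth_on_scaleR sG sX2 openS zero)
    also have "\<dots> = (\<Sum>i\<in>UNIV. \<Sum>j\<in>UNIV. pd p (\<lambda>x. G i j x *\<^sub>R d2X i j x) 0)"
      by (intro sum.cong refl partial_deriv_sum[where S = S] smooth_on_scaleR sG sX2 zero)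
    also have "\<dots> = (\<Sum>i\<in>UNIV. d3X p i i 0)"
      by (simp add: partial_deriv_scaleR[OF sG sX2 zero] dG_0 G_0 if_distrib if_distribR cong: if_cong)
    finally show ?thesis
      by (simp add: partial_deriv_scaleR[OF sh s\<nu> zero])
  qed
  moreover have "pd p \<nu> 0 \<bullet> \<xi> = 0"
    by (simp add: d\<nu>[OF zero] inner_sum_left \<xi>)
  ultimately show ?thesis
    by (simp add: inner_diff_left inner_add_left inner_sum_left)
qed

text \<open>The second derivative of the shrinker equation, paired with an arbitrary normal vector
  and not only with nu, in order to reach the components of A orthogonal to nu.\<close>

lemma d2_position_normal:
  assumes \<xi>: "\<And>k. dX k 0 \<bullet> \<xi> = 0"
  shows "d2X p j 0 \<bullet> \<xi> + pd p (pd j h) 0 * (\<nu> 0 \<bullet> \<xi>)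
      - h 0 * (\<Sum>k\<in>UNIV. W j k 0 * (d2X p k 0 \<bullet> \<xi>)) =
    (\<Sum>k\<in>UNIV. pd j (\<theta> k) 0 * (d2X p k 0 \<bullet> \<xi>) + pd p (\<theta> k) 0 * (d2X j k 0 \<bullet> \<xi>)
      + \<theta> k 0 * (d3X p j k 0 \<bullet> \<xi>))"
proof -
  have n1: "pd i \<nu> 0 \<bullet> \<xi> = 0" for i
    by (simp add: d\<nu>[OF zero] inner_sum_left \<xi>)
  have n2: "pd p (pd j \<nu>) 0 \<bullet> \<xi> = - (\<Sum>k\<in>UNIV. W j k 0 * (d2X p k 0 \<bullet> \<xi>))"
    by (simp add: d2\<nu>[OF zero] inner_sum_left inner_add_left \<xi>)
  have "pd p (\<lambda>x. dX j x + pd j h x *\<^sub>R \<nu> x + h x *\<^sub>R pd j \<nu> x) 0 =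
    pd p (\<lambda>x. \<Sum>k\<in>UNIV. pd j (\<theta> k) x *\<^sub>R dX k x + \<theta> k x *\<^sub>R d2X j k x) 0"
    by (intro partial_deriv_cong[OF openS zero] d_position)
  also have "\<dots> = (\<Sum>k\<in>UNIV. pd p (\<lambda>x. pd j (\<theta> k) x *\<^sub>R dX k x + \<theta> k x *\<^sub>R d2X j k x) 0)"
    by (intro partial_deriv_sum[where S = S] smooth_on_add smooth_on_scaleR s\<theta> s\<theta>1 sX1 sX2 zero)
  also have "\<dots> = (\<Sum>k\<in>UNIV. pd p (\<lambda>x. pd j (\<theta> k) x *\<^sub>R dX k x) 0
      + pd p (\<lambda>x. \<theta> k x *\<^sub>R d2X j k x) 0)"
    by (intro sum.cong refl partial_deriv_add[where S = S] smooth_on_scaleR s\<theta> s\<theta>1 sX1 sX2 zero)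
  finally have "pd p (\<lambda>x. dX j x + pd j h x *\<^sub>R \<nu> x + h x *\<^sub>R pd j \<nu> x) 0 \<bullet> \<xi> =
    (\<Sum>k\<in>UNIV. pd j (\<theta> k) 0 * (d2X p k 0 \<bullet> \<xi>) + pd p (\<theta> k) 0 * (d2X j k 0 \<bullet> \<xi>)
      + \<theta> k 0 * (d3X p j k 0 \<bullet> \<xi>))"
    by (simp add: partial_deriv_scaleR[OF s\<theta> sX2 zero] partial_deriv_scaleR[OF s\<theta>1 sX1 zero]
        inner_sum_left inner_add_left \<xi> algebra_simps)
  moreover have "pd p (\<lambda>x. dX j x + pd j h x *\<^sub>R \<nu> x + h x *\<^sub>R pd j \<nu> x) 0 =
    d2X p j 0 + pd p (\<lambda>x. pd j h x *\<^sub>R \<nu> x) 0 +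
    pd p (\<lambda>x. h x *\<^sub>R pd j \<nu> x) 0"
  proof -
    have "pd p (\<lambda>x. dX j x + pd j h x *\<^sub>R \<nu> x + h x *\<^sub>R pd j \<nu> x) 0 =
      pd p (\<lambda>x. dX j x + pd j h x *\<^sub>R \<nu> x) 0 +
      pd p (\<lambda>x. h x *\<^sub>R pd j \<nu> x) 0"
      by (intro partial_deriv_add[where S = S] smooth_on_add smooth_on_scaleR sX1 sh sh1 s\<nu> s\<nu>1 zero)
    also have "pd p (\<lambda>x. dX j x + pd j h x *\<^sub>R \<nu> x) 0 =
       d2X p j 0 + pd p (\<lambda>x. pd j h x *\<^sub>R \<nu> x) 0"
      by (intro partial_deriv_add[where S = S] smooth_on_scaleR sX1 sh1 s\<nu> zero)
    finally show ?thesis .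
  qed
  ultimately show ?thesis
    by (simp add: partial_deriv_scaleR[OF sh s\<nu>1 zero] partial_deriv_scaleR[OF sh1 s\<nu> zero]
        inner_add_left n1 n2)
qed

text \<open>The trace of \<open>d2_position_normal\<close>. Since D F^T is the identity minus h W,
  it produces the contraction of W with A, while the right side sees \<xi> only through its product
  with nu: the contraction is a multiple of nu.\<close>

lemma laplace_position_normal:
  assumes \<xi>: "\<And>k. dX k 0 \<bullet> \<xi> = 0"
  shows "h 0 * ((\<Sum>p\<in>UNIV. \<Sum>k\<in>UNIV. W p k 0 *\<^sub>R d2X p k 0) \<bullet> \<xi>) =
    (h 0 - lap h + (\<Sum>k\<in>UNIV. \<theta> k 0 * pd k h 0)) * (\<nu> 0 \<bullet> \<xi>)"
proof -
  define B where "B = (\<Sum>p\<in>UNIV. \<Sum>k\<in>UNIV. W p k 0 * (d2X p k 0 \<bullet> \<xi>))"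
  have H: "(\<Sum>p\<in>UNIV. d2X p p 0 \<bullet> \<xi>) = h 0 * (\<nu> 0 \<bullet> \<xi>)"
    using mean_curvature_0 by (simp flip: inner_sum_left)
  have "(\<Sum>p\<in>UNIV. d2X p p 0 \<bullet> \<xi>) + lap h * (\<nu> 0 \<bullet> \<xi>) - h 0 * B =
    (\<Sum>p\<in>UNIV. d2X p p 0 \<bullet> \<xi> + pd p (pd p h) 0 * (\<nu> 0 \<bullet> \<xi>)
      - h 0 * (\<Sum>k\<in>UNIV. W p k 0 * (d2X p k 0 \<bullet> \<xi>)))"
    by (simp add: B_def sum.distrib sum_subtractf sum_distrib_left sum_distrib_right)
  also have "\<dots> = (\<Sum>p\<in>UNIV. \<Sum>k\<in>UNIV. pd p (\<theta> k) 0 * (d2X p k 0 \<bullet> \<xi>)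
      + pd p (\<theta> k) 0 * (d2X p k 0 \<bullet> \<xi>) + \<theta> k 0 * (d3X p p k 0 \<bullet> \<xi>))"
    by (intro sum.cong refl d2_position_normal \<xi>)
  also have "\<dots> = 2 * (\<Sum>p\<in>UNIV. \<Sum>k\<in>UNIV. pd p (\<theta> k) 0 * (d2X p k 0 \<bullet> \<xi>))
      + (\<Sum>p\<in>UNIV. \<Sum>k\<in>UNIV. \<theta> k 0 * (d3X p p k 0 \<bullet> \<xi>))"
    by (simp add: sum.distrib sum_distrib_left mult_ac)
  also have "(\<Sum>p\<in>UNIV. \<Sum>k\<in>UNIV. pd p (\<theta> k) 0 * (d2X p k 0 \<bullet> \<xi>)) =
      (\<Sum>p\<in>UNIV. \<Sum>k\<in>UNIV. (if p = k then d2X p k 0 \<bullet> \<xi> else 0) - h 0 * (W p k 0 * (d2X p k 0 \<bullet> \<xi>)))"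
    by (intro sum.cong refl) (auto simp: d\<theta>_0 left_diff_distrib)
  also have "\<dots> = (\<Sum>p\<in>UNIV. d2X p p 0 \<bullet> \<xi>) - h 0 * B"
    by (simp add: B_def sum_subtractf sum_distrib_left)
  \<comment> \<open>Commuting derivatives puts the traced pair last, where
    \<open>d_mean_curvature_0\<close> applies.\<close>
  also have "(\<Sum>p\<in>UNIV. \<Sum>k\<in>UNIV. \<theta> k 0 * (d3X p p k 0 \<bullet> \<xi>)) =
      (\<Sum>k\<in>UNIV. \<theta> k 0 * (\<Sum>p\<in>UNIV. d3X k p p 0 \<bullet> \<xi>))"
  proof -
    have "d3X p p k 0 = d3X k p p 0" for p k
      using d3X_commute23[OF zero, of p p k] d3X_commute12[OF zero, of p k p] by (rule trans)
    then show ?thesis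
      by (subst sum.swap) (simp add: sum_distrib_left)
  qed
  also have "\<dots> = (\<Sum>k\<in>UNIV. \<theta> k 0 * pd k h 0) * (\<nu> 0 \<bullet> \<xi>)"
    by (simp add: d_mean_curvature_0[OF \<xi>] sum_distrib_right mult.assoc)
  finally have "h 0 * B = (h 0 - lap h + (\<Sum>k\<in>UNIV. \<theta> k 0 * pd k h 0)) * (\<nu> 0 \<bullet> \<xi>)"
    unfolding H by (simp add: algebra_simps)
  then show ?thesis by (simp add: B_def inner_sum_left)
qed

lemma lap_h: "lap h = h 0 - h 0 * W2 + (\<Sum>k\<in>UNIV. \<theta> k 0 * pd k h 0)"
proof -
  have "(\<Sum>p\<in>UNIV. \<Sum>k\<in>UNIV. W p k 0 *\<^sub>R d2X p k 0) \<bullet> \<nu> 0 = W2"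
    by (simp add: inner_sum_left d2X_\<nu>_0 power2_eq_square)
  then show ?thesis
    using laplace_position_normal[of "\<nu> 0"] dX_\<nu>[OF zero] \<nu>_unit[OF zero] by simp
qed

text \<open>The contraction V is itself normal, so \<xi> = V is admissible. The factor found there
  is h |W|^2 by \<open>lap_h\<close>, and V.nu = |W|^2.\<close>

lemma shape_contraction_normal: "(\<Sum>p\<in>UNIV. \<Sum>k\<in>UNIV. W p k 0 *\<^sub>R d2X p k 0) \<bullet>
    (\<Sum>p\<in>UNIV. \<Sum>k\<in>UNIV. W p k 0 *\<^sub>R d2X p k 0) = W2\<^sup>2"
proof -
  let ?V = "\<Sum>p\<in>UNIV. \<Sum>k\<in>UNIV. W p k 0 *\<^sub>R d2X p k 0"
  have V\<nu>: "?V \<bullet> \<nu> 0 = W2"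
    by (simp add: inner_sum_left d2X_\<nu>_0 power2_eq_square)
  have "dX k 0 \<bullet> ?V = 0" for k
    by (simp add: inner_sum_right inner_commute[of "dX k 0" "d2X _ _ _"] nor)
  from laplace_position_normal[OF this]
  have "h 0 * (?V \<bullet> ?V) = h 0 * (W2 * (\<nu> 0 \<bullet> ?V))"
    by (simp add: lap_h)
  then show ?thesis
    using hpos[OF zero] V\<nu> by (simp add: inner_commute power2_eq_square)
qed

end

section \<open>Simons' identity\<close>

lemma sum4_eq:
  fixes f :: "'a::finite \<Rightarrow> 'a \<Rightarrow> 'a \<Rightarrow> 'a \<Rightarrow> 'b::comm_monoid_add"
  shows "(\<Sum>i\<in>UNIV. \<Sum>l\<in>UNIV. \<Sum>p\<in>UNIV. \<Sum>k\<in>UNIV. f i l p k) = (\<Sum>(i,l,p,k)\<in>UNIV. f i l p k)"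
  by (simp add: sum.cartesian_product flip: UNIV_Times_UNIV)

context adapted_shrinker
begin

text \<open>The two derivative indices of the Laplacian are moved onto the trace of W, which is h.
  Every exchange of indices costs third derivatives of X or products of second derivatives; these
  together are the curvature terms.\<close>

lemma lap_W: "lap (W i l) = pd i (pd l h) 0 +
    (\<Sum>p\<in>UNIV. \<Sum>k\<in>UNIV.
      W p k 0 * (d3X i l k 0 \<bullet> dX p 0 - d3X i p l 0 \<bullet> dX k 0) +
      W l k 0 * (d3X i p p 0 \<bullet> dX k 0) - W i k 0 * (d3X p p k 0 \<bullet> dX l 0) +
      W l k 0 * (d2X p k 0 \<bullet> d2X i p 0 + d2X i k 0 \<bullet> d2X p p 0) -
      W p k 0 * (d2X p k 0 \<bullet> d2X i l 0 + d2X i k 0 \<bullet> d2X p l 0))"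
proof -
  define D2 where "D2 p q i l = pd p (pd q (W i l)) 0" for p q i l
  have D2c: "D2 p q i l = D2 q p i l" for p q i l
    unfolding D2_def by (rule partial_deriv_commute[OF sW zero])
  define R where "R p j k l = d3X p j k 0 \<bullet> dX l 0" for p j k l
  have R12: "R p j k l = R j p k l" and R23: "R p j k l = R p k j l" for p j k l
    unfolding R_def using d3X_commute12[OF zero] d3X_commute23[OF zero] by metis+
  have cod: "D2 p j i l + (\<Sum>k\<in>UNIV. W i k 0 * R p j k l) =
      D2 p i j l + (\<Sum>k\<in>UNIV. W j k 0 * R p i k l)" for p i j l
    unfolding D2_def R_def by (rule d_codazzi)
  have sym: "D2 q p i j + (\<Sum>k\<in>UNIV. W i k 0 *
        (R q p k j + R q p j k + d2X p k 0 \<bullet> d2X q j 0 + d2X q k 0 \<bullet> d2X p j 0)) =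
      D2 q p j i + (\<Sum>k\<in>UNIV. W j k 0 *
        (R q p k i + R q p i k + d2X p k 0 \<bullet> d2X q i 0 + d2X q k 0 \<bullet> d2X p i 0))" for q p i j
    unfolding D2_def R_def by (rule d2W_sym[unfolded d2metric_0])
  have hh: "pd i (pd l h) 0 = (\<Sum>p\<in>UNIV. D2 i l p p)"
  proof -
    have "pd l h x = (\<Sum>p\<in>UNIV. pd l (W p p) x)" if x: "x \<in> S" for x
    proof -
      have "pd l h x = pd l (\<lambda>x. \<Sum>p\<in>UNIV. W p p x) x"
        by (intro partial_deriv_cong[OF openS x] mean_curvature_trace)
      also have "\<dots> = (\<Sum>p\<in>UNIV. pd l (W p p) x)"
        by (rule partial_deriv_sum[OF sW x])
      finally show ?thesis .
    qed
    then have "pd i (pd l h) 0 =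
        pd i (\<lambda>x. \<Sum>p\<in>UNIV. pd l (W p p) x) 0"
      by (intro partial_deriv_cong[OF openS zero])
    also have "\<dots> = (\<Sum>p\<in>UNIV. D2 i l p p)"
      unfolding D2_def by (rule partial_deriv_sum[OF sW1 zero])
    finally show ?thesis .
  qed
  have "D2 p p i l = D2 i l p p + (\<Sum>k\<in>UNIV.
      W p k 0 * (R i l k p - R i p l k) +
      W l k 0 * R i p p k - W i k 0 * R p p k l +
      W l k 0 * (d2X p k 0 \<bullet> d2X i p 0 + d2X i k 0 \<bullet> d2X p p 0) -
      W p k 0 * (d2X p k 0 \<bullet> d2X i l 0 + d2X i k 0 \<bullet> d2X p l 0))" for p
  proof -
    \<comment> \<open>Codazzi exchanges i and p, the symmetry of W exchanges p and l, and Codazzi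
      again exchanges p and l in the outer slots.\<close>
    have 1: "D2 p p i l = D2 p i p l + (\<Sum>k\<in>UNIV. W p k 0 * R p i k l - W i k 0 * R p p k l)"
      using cod[of p p i l] by (simp add: sum_subtractf)
    have 2: "D2 i p p l = D2 i p l p + (\<Sum>k\<in>UNIV.
        W l k 0 * (R i p k p + R i p p k + d2X p k 0 \<bullet> d2X i p 0 + d2X i k 0 \<bullet> d2X p p 0) -
        W p k 0 * (R i p k l + R i p l k + d2X p k 0 \<bullet> d2X i l 0 + d2X i k 0 \<bullet> d2X p l 0))"
      using sym[of i p p l] by (simp add: sum_subtractf)
    have 3: "D2 i p l p = D2 i l p p + (\<Sum>k\<in>UNIV. W p k 0 * R i l k p - W l k 0 * R i p k p)"
      using cod[of i p l p] by (simp add: sum_subtractf)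
    have "D2 p p i l = D2 i l p p + ((\<Sum>k\<in>UNIV. W p k 0 * R p i k l - W i k 0 * R p p k l) +
       (\<Sum>k\<in>UNIV.
        W l k 0 * (R i p k p + R i p p k + d2X p k 0 \<bullet> d2X i p 0 + d2X i k 0 \<bullet> d2X p p 0) -
        W p k 0 * (R i p k l + R i p l k + d2X p k 0 \<bullet> d2X i l 0 + d2X i k 0 \<bullet> d2X p l 0)) +
       (\<Sum>k\<in>UNIV. W p k 0 * R i l k p - W l k 0 * R i p k p))"
      unfolding 1 D2c[of p i] 2 3 by simp
    then show ?thesis
      unfolding sum.distrib[symmetric] R12[of p i]
      by (simp add: algebra_simps)
  qed
  then have "(\<Sum>p\<in>UNIV. D2 p p i l) = (\<Sum>p\<in>UNIV. D2 i l p p) + (\<Sum>p\<in>UNIV. \<Sum>k\<in>UNIV.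
      W p k 0 * (R i l k p - R i p l k) +
      W l k 0 * R i p p k - W i k 0 * R p p k l +
      W l k 0 * (d2X p k 0 \<bullet> d2X i p 0 + d2X i k 0 \<bullet> d2X p p 0) -
      W p k 0 * (d2X p k 0 \<bullet> d2X i l 0 + d2X i k 0 \<bullet> d2X p l 0))"
    unfolding sum.distrib[symmetric] by simp
  then show ?thesis
    unfolding hh by (simp only: D2_def R_def)
qed

text \<open>Simons' identity, contracted with the shape operator.\<close>

lemma W_lap_W: "(\<Sum>i\<in>UNIV. \<Sum>l\<in>UNIV. W i l 0 * lap (W i l)) =
    W2 - W2\<^sup>2 + (\<Sum>k\<in>UNIV. \<theta> k 0 * (\<Sum>i\<in>UNIV. \<Sum>l\<in>UNIV. W i l 0 * pd k (W i l) 0))"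
proof -
  define w where "w i k = W i k 0" for i k
  have ws: "w i k = w k i" for i k unfolding w_def by (rule W_sym)
  define Y where "Y i k = d2X i k 0" for i k
  have Ys: "Y i k = Y k i" for i k unfolding Y_def by (rule d2X_commute[OF zero])
  define R where "R p j k l = d3X p j k 0 \<bullet> dX l 0" for p j k l
  have R12: "R p j k l = R j p k l" and R23: "R p j k l = R p k j l" for p j k l
    unfolding R_def using d3X_commute12[OF zero] d3X_commute23[OF zero] by metis+
  define Q where "Q f = (\<Sum>i\<in>UNIV. \<Sum>l\<in>UNIV. \<Sum>p\<in>UNIV. \<Sum>k\<in>UNIV. f i l p k)"
    for f :: "'m \<Rightarrow> 'm \<Rightarrow> 'm \<Rightarrow> 'm \<Rightarrow> real"
  define T3 where "T3 = (\<Sum>i\<in>UNIV. \<Sum>l\<in>UNIV. \<Sum>k\<in>UNIV. w i l * w i k * w l k)"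
  define th where "th = (\<Sum>i\<in>UNIV. \<Sum>l\<in>UNIV. w i l * (\<Sum>k\<in>UNIV. \<theta> k 0 * pd k (W i l) 0))"
  have W2: "W2 = (\<Sum>i\<in>UNIV. \<Sum>l\<in>UNIV. w i l * w i l)" by (simp add: w_def power2_eq_square)
  \<comment> \<open>After contraction with the symmetric w, the third-derivative terms cancel in
    pairs: each pair differs by a renaming of summation indices and a reordering of
    derivatives.\<close>
  have c1: "Q (\<lambda>i l p k. w i l * (w p k * R i l k p)) = Q (\<lambda>i l p k. w i l * (w p k * R i p l k))"
    unfolding Q_def sum4_eq
    by (rule sum.reindex_bij_witness[of _ "\<lambda>(i,l,p,k). (i,l,k,p)" "\<lambda>(i,l,p,k). (i,l,k,p)"])
       (auto simp: ws R23)
  have c2: "Q (\<lambda>i l p k. w i l * (w l k * R i p p k)) = Q (\<lambda>i l p k. w i l * (w i k * R p p k l))"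
    unfolding Q_def sum4_eq
  proof (rule sum.reindex_bij_witness[of _ "\<lambda>(i,l,p,k). (k,i,p,l)" "\<lambda>(i,l,p,k). (l,k,p,i)"])
    fix x :: "'m \<times> 'm \<times> 'm \<times> 'm"
    obtain i l p k where x: "x = (i,l,p,k)" by (cases x)
    have "R p p i k = R i p p k" using R12[of i p p k] R23[of p i p k] by simp
    then show "(case case x of (i,l,p,k) \<Rightarrow> (l,k,p,i) of (i,l,p,k) \<Rightarrow> w i l * (w i k * R p p k l)) =
        (case x of (i,l,p,k) \<Rightarrow> w i l * (w l k * R i p p k))"
      by (simp add: x ws[of l i])
  qed auto
  \<comment> \<open>Ricci's equation moves w from one factor Y to the other. This cross term
    involves all normal directions and would otherwise remain.\<close>
  have c3: "Q (\<lambda>i l p k. w i l * (w p k * (Y i k \<bullet> Y p l))) = Q (\<lambda>i l p k. w i l * (w l k * (Y p k \<bullet> Y i p)))"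
  proof -
    have "Q (\<lambda>i l p k. w i l * (w p k * (Y i k \<bullet> Y p l))) =
      (\<Sum>i\<in>UNIV. \<Sum>l\<in>UNIV. \<Sum>p\<in>UNIV. w i l * ((\<Sum>k\<in>UNIV. w p k *\<^sub>R Y i k) \<bullet> Y p l))"
      by (simp add: Q_def inner_sum_left sum_distrib_left)
    also have "\<dots> = (\<Sum>i\<in>UNIV. \<Sum>l\<in>UNIV. \<Sum>p\<in>UNIV. w i l * ((\<Sum>k\<in>UNIV. w i k *\<^sub>R Y p k) \<bullet> Y p l))"
      unfolding w_def Y_def by (simp only: ricci)
    also have "\<dots> = (\<Sum>l\<in>UNIV. \<Sum>i\<in>UNIV. \<Sum>p\<in>UNIV. w i l * ((\<Sum>k\<in>UNIV. w i k *\<^sub>R Y p k) \<bullet> Y p l))"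
      by (rule sum.swap)
    also have "\<dots> = Q (\<lambda>l i p k. w l i * (w i k * (Y p k \<bullet> Y l p)))"
      by (simp add: Q_def inner_sum_left sum_distrib_left ws Ys)
    finally show ?thesis .
  qed
  \<comment> \<open>The inner trace is the mean curvature vector h nu; the resulting cubic term
    cancels the one in the Hessian of h.\<close>
  have c4: "Q (\<lambda>i l p k. w i l * (w l k * (Y i k \<bullet> Y p p))) = h 0 * T3"
  proof -
    have "Q (\<lambda>i l p k. w i l * (w l k * (Y i k \<bullet> Y p p))) =
       (\<Sum>i\<in>UNIV. \<Sum>l\<in>UNIV. \<Sum>k\<in>UNIV. \<Sum>p\<in>UNIV. w i l * (w l k * (Y i k \<bullet> Y p p)))"
      unfolding Q_def by (intro sum.cong refl sum.swap)
    also have "\<dots> = (\<Sum>i\<in>UNIV. \<Sum>l\<in>UNIV. \<Sum>k\<in>UNIV. w i l * (w l k * (Y i k \<bullet> (\<Sum>p\<in>UNIV. Y p p))))"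
      by (simp add: inner_sum_right sum_distrib_left)
    also have "\<dots> = h 0 * T3"
      unfolding Y_def mean_curvature_0 T3_def
      by (simp add: d2X_\<nu>_0 sum_distrib_left flip: w_def) (simp add: mult_ac)
    finally show ?thesis .
  qed
  \<comment> \<open>This is |V|^2 for the contraction V of W with the full second fundamental form;
    it equals |W|^4 because V is parallel to nu.\<close>
  have c5: "Q (\<lambda>i l p k. w i l * (w p k * (Y p k \<bullet> Y i l))) = W2\<^sup>2"
    unfolding shape_contraction_normal[symmetric]
    by (simp add: Q_def inner_sum_left inner_sum_right sum_distrib_left flip: w_def Y_def)
  have th: "th = (\<Sum>k\<in>UNIV. \<theta> k 0 * (\<Sum>i\<in>UNIV. \<Sum>l\<in>UNIV. W i l 0 * pd k (W i l) 0))"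
  proof -
    have "th = (\<Sum>i\<in>UNIV. \<Sum>l\<in>UNIV. \<Sum>k\<in>UNIV. \<theta> k 0 * (w i l * pd k (W i l) 0))"
      by (simp add: th_def sum_distrib_left mult_ac)
    also have "\<dots> = (\<Sum>i\<in>UNIV. \<Sum>k\<in>UNIV. \<Sum>l\<in>UNIV. \<theta> k 0 * (w i l * pd k (W i l) 0))"
      by (intro sum.cong refl sum.swap)
    also have "\<dots> = (\<Sum>k\<in>UNIV. \<Sum>i\<in>UNIV. \<Sum>l\<in>UNIV. \<theta> k 0 * (w i l * pd k (W i l) 0))"
      by (rule sum.swap)
    finally show ?thesis by (simp add: sum_distrib_left w_def)
  qed
  have hess: "(\<Sum>i\<in>UNIV. \<Sum>l\<in>UNIV. w i l * pd i (pd l h) 0) = W2 - h 0 * T3 + th"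
  proof -
    have "(\<Sum>i\<in>UNIV. \<Sum>l\<in>UNIV. w i l * pd i (pd l h) 0) =
      (\<Sum>i\<in>UNIV. \<Sum>l\<in>UNIV. w i l * w i l - w i l * (h 0 * (\<Sum>k\<in>UNIV. w i k * w l k))
         + w i l * (\<Sum>k\<in>UNIV. \<theta> k 0 * pd k (W i l) 0))"
      by (simp add: d2h_0 algebra_simps flip: w_def)
    also have "\<dots> = W2 - (\<Sum>i\<in>UNIV. \<Sum>l\<in>UNIV. w i l * (h 0 * (\<Sum>k\<in>UNIV. w i k * w l k))) + th"
      by (simp only: sum.distrib sum_subtractf W2 th_def)
    also have "(\<Sum>i\<in>UNIV. \<Sum>l\<in>UNIV. w i l * (h 0 * (\<Sum>k\<in>UNIV. w i k * w l k))) = h 0 * T3"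
      by (simp add: T3_def sum_distrib_left mult_ac)
    finally show ?thesis .
  qed
  have "(\<Sum>i\<in>UNIV. \<Sum>l\<in>UNIV. W i l 0 * lap (W i l)) =
    (\<Sum>i\<in>UNIV. \<Sum>l\<in>UNIV. w i l * pd i (pd l h) 0 +
     (\<Sum>p\<in>UNIV. \<Sum>k\<in>UNIV.
       w i l * (w p k * R i l k p) - w i l * (w p k * R i p l k) +
       w i l * (w l k * R i p p k) - w i l * (w i k * R p p k l) +
       w i l * (w l k * (Y p k \<bullet> Y i p)) + w i l * (w l k * (Y i k \<bullet> Y p p)) -
       w i l * (w p k * (Y p k \<bullet> Y i l)) - w i l * (w p k * (Y i k \<bullet> Y p l))))"
    unfolding lap_W
    by (simp add: distrib_left sum_distrib_left flip: w_def Y_def R_def) (simp add: algebra_simps)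
  also have "\<dots> = (\<Sum>i\<in>UNIV. \<Sum>l\<in>UNIV. w i l * pd i (pd l h) 0) +
     (Q (\<lambda>i l p k. w i l * (w p k * R i l k p)) - Q (\<lambda>i l p k. w i l * (w p k * R i p l k)) +
      Q (\<lambda>i l p k. w i l * (w l k * R i p p k)) - Q (\<lambda>i l p k. w i l * (w i k * R p p k l)) +
      Q (\<lambda>i l p k. w i l * (w l k * (Y p k \<bullet> Y i p))) + Q (\<lambda>i l p k. w i l * (w l k * (Y i k \<bullet> Y p p))) -
      Q (\<lambda>i l p k. w i l * (w p k * (Y p k \<bullet> Y i l))) - Q (\<lambda>i l p k. w i l * (w p k * (Y i k \<bullet> Y p l))))"
    by (simp only: Q_def sum.distrib sum_subtractf)
  also have "\<dots> = W2 - W2\<^sup>2 + th"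
    unfolding hess c1 c2 c3 c4 c5 by simp
  finally show ?thesis unfolding th .
qed

end

subsection \<open>The maximum principle\<close>

text \<open>The function u of the overview. As tr W = h, it measures how far W is from a multiple of
  the identity, for which it takes its least value 1/m.\<close>

definition pinching :: "(real^'m::finite \<Rightarrow> real^'n::finite) \<Rightarrow> (real^'m \<Rightarrow> real^'n) \<Rightarrow> (real^'m \<Rightarrow> real) \<Rightarrow> real^'m \<Rightarrow> real"
  where "pinching X \<nu> h x = shape_sq X \<nu> x / (h x * h x)"

text \<open>
  The value of \<open>L E / E\<close> for \<open>E = exp (\<bar>F\<bar>\<^sup>2/2 - (log h)/s)\<close>.  The gradient of \<open>log h\<close> enters through
  \<open>z = D\<nu>(F\<^sup>T)\<close>: its inner product with \<open>F\<^sup>T\<close> is \<open>- (z \<bullet> F)/h\<close>, and its square is \<open>(z \<bullet> z)/h\<^sup>2\<close>.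
\<close>

definition barrier_rate :: "real \<Rightarrow> real \<Rightarrow> real \<Rightarrow> real \<Rightarrow> real^'n \<Rightarrow> real^'n::finite \<Rightarrow> real"
  where "barrier_rate m s u h z F = (m - 1/s) - h\<^sup>2 * (1 - u/s) +
    (1 - 1/s) * (- 2 * (z \<bullet> F) / h - (z \<bullet> z) / (h\<^sup>2 * s))"

context adapted_shrinker
begin

abbreviation u where "u \<equiv> pinching X \<nu> h"
abbreviation w where "w \<equiv> \<lambda>x. ln (h x)"
abbreviation f where "f \<equiv> \<lambda>x. X x \<bullet> X x / 2"
abbreviation z where "z \<equiv> normal_speed X \<nu> h"

section \<open>Derivatives of |W|^2, log h and |F|^2\<close>

lemma shape_sq_0: "shape_sq X \<nu> 0 = W2"
  by (simp add: shape_sq_eq power2_eq_square W_sym)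

lemma sshape_sq: "smooth_on (shape_sq X \<nu>) S"
  by (rule smooth_on_shape_sq[OF shr])

lemma su: "smooth_on u S"
  unfolding pinching_def[abs_def] using hpos
  by (intro smooth_on_divide sshape_sq smooth_on_mult sh) (metis mult_pos_pos less_irrefl)

lemma sw: "smooth_on w S"
  by (intro smooth_on_ln sh hpos)

lemma sf: "smooth_on f S"
  by (intro smooth_on_divide smooth_on_inner sX smooth_on_const openS) simp

lemma dshape_sq:
  assumes x: "x \<in> S"
  shows "pd p (shape_sq X \<nu>) x =
    (\<Sum>i\<in>UNIV. \<Sum>k\<in>UNIV. W i k x * pd p (W k i) x + pd p (W i k) x * W k i x)"
proof -
  have "pd p (shape_sq X \<nu>) x = (\<Sum>i\<in>UNIV. pd p (\<lambda>x. \<Sum>k\<in>UNIV. W i k x * W k i x) x)"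
    unfolding shape_sq_eq[abs_def]
    by (intro partial_deriv_sum[where S = S] smooth_on_sum smooth_on_mult sW openS x)
  also have "\<dots> = (\<Sum>i\<in>UNIV. \<Sum>k\<in>UNIV. pd p (\<lambda>x. W i k x * W k i x) x)"
    by (intro sum.cong refl partial_deriv_sum[where S = S] smooth_on_mult sW x)
  finally show ?thesis
    by (simp add: partial_deriv_mult[OF sW sW x])
qed

lemma dshape_sq_0: "pd p (shape_sq X \<nu>) 0 =
    2 * (\<Sum>i\<in>UNIV. \<Sum>k\<in>UNIV. W i k 0 * pd p (W i k) 0)"
proof -
  have "pd p (shape_sq X \<nu>) 0 =
     (\<Sum>i\<in>UNIV. \<Sum>k\<in>UNIV. 2 * (W i k 0 * pd p (W i k) 0))"
    unfolding dshape_sq[OF zero]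
  proof (intro sum.cong refl)
    fix i k
    show "W i k 0 * pd p (W k i) 0 + pd p (W i k) 0 * W k i 0 =
        2 * (W i k 0 * pd p (W i k) 0)"
      unfolding dW_sym[where i = k and j = i] W_sym[where i = k and k = i] by simp
  qed
  then show ?thesis by (simp add: sum_distrib_left)
qed

lemma lap_shape_sq: "lap (shape_sq X \<nu>) = 2 * (\<Sum>i\<in>UNIV. \<Sum>k\<in>UNIV. W i k 0 * lap (W i k)) +
    2 * (\<Sum>p\<in>UNIV. \<Sum>i\<in>UNIV. \<Sum>k\<in>UNIV. (pd p (W i k) 0)\<^sup>2)"
proof -
  have 2: "pd p (pd p (shape_sq X \<nu>)) 0 =
    (\<Sum>i\<in>UNIV. \<Sum>k\<in>UNIV. W i k 0 * pd p (pd p (W k i)) 0 +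
       W k i 0 * pd p (pd p (W i k)) 0 + 2 * (pd p (W i k) 0)\<^sup>2)" for p
  proof -
    have "pd p (pd p (shape_sq X \<nu>)) 0 =
      pd p (\<lambda>x. \<Sum>i\<in>UNIV. \<Sum>k\<in>UNIV. W i k x * pd p (W k i) x + pd p (W i k) x * W k i x) 0"
      by (intro partial_deriv_cong[OF openS zero] dshape_sq)
    also have "\<dots> = (\<Sum>i\<in>UNIV. pd p (\<lambda>x. \<Sum>k\<in>UNIV. W i k x * pd p (W k i) x + pd p (W i k) x * W k i x) 0)"
      by (intro partial_deriv_sum[where S = S] smooth_on_sum smooth_on_add smooth_on_mult sW sW1 openS zero)
    also have "\<dots> = (\<Sum>i\<in>UNIV. \<Sum>k\<in>UNIV. pd p (\<lambda>x. W i k x * pd p (W k i) x + pd p (W i k) x * W k i x) 0)"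
      by (intro sum.cong refl partial_deriv_sum[where S = S] smooth_on_add smooth_on_mult sW sW1 zero)
    also have "\<dots> = (\<Sum>i\<in>UNIV. \<Sum>k\<in>UNIV. pd p (\<lambda>x. W i k x * pd p (W k i) x) 0
        + pd p (\<lambda>x. pd p (W i k) x * W k i x) 0)"
      by (intro sum.cong refl partial_deriv_add[where S = S] smooth_on_mult sW sW1 zero)
    also have "\<dots> = (\<Sum>i\<in>UNIV. \<Sum>k\<in>UNIV. W i k 0 * pd p (pd p (W k i)) 0 +
       W k i 0 * pd p (pd p (W i k)) 0 + 2 * (pd p (W i k) 0)\<^sup>2)"
    proof (intro sum.cong refl)
      fix i k
      have "pd p (W k i) 0 = pd p (W i k) 0" by (rule dW_sym)
      then show "pd p (\<lambda>x. W i k x * pd p (W k i) x) 0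
        + pd p (\<lambda>x. pd p (W i k) x * W k i x) 0 =
        W i k 0 * pd p (pd p (W k i)) 0 +
        W k i 0 * pd p (pd p (W i k)) 0 + 2 * (pd p (W i k) 0)\<^sup>2"
        by (simp add: partial_deriv_mult[OF sW sW1 zero] partial_deriv_mult[OF sW1 sW zero]
            power2_eq_square)
    qed
    finally show ?thesis .
  qed
  \<comment> \<open>The second derivatives of the mixed tensor need not be symmetric in i and k, but
    W at 0 is, so exchanging the summation indices suffices.\<close>
  have "(\<Sum>i\<in>UNIV. \<Sum>k\<in>UNIV. W i k 0 * pd p (pd p (W k i)) 0) =
      (\<Sum>i\<in>UNIV. \<Sum>k\<in>UNIV. W i k 0 * pd p (pd p (W i k)) 0)" for p
    by (subst sum.swap) (simp add: W_sym)
  moreover have "(\<Sum>i\<in>UNIV. \<Sum>k\<in>UNIV. W k i 0 * pd p (pd p (W i k)) 0) =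
      (\<Sum>i\<in>UNIV. \<Sum>k\<in>UNIV. W i k 0 * pd p (pd p (W i k)) 0)" for p
    by (intro sum.cong refl) (metis W_sym)
  ultimately have "lap (shape_sq X \<nu>) = 2 * (\<Sum>p\<in>UNIV. \<Sum>i\<in>UNIV. \<Sum>k\<in>UNIV. W i k 0 * pd p (pd p (W i k)) 0) +
    2 * (\<Sum>p\<in>UNIV. \<Sum>i\<in>UNIV. \<Sum>k\<in>UNIV. (pd p (W i k) 0)\<^sup>2)"
    unfolding 2 sum.distrib by (simp add: sum.distrib sum_distrib_left)
  also have "(\<Sum>p\<in>UNIV. \<Sum>i\<in>UNIV. \<Sum>k\<in>UNIV. W i k 0 * pd p (pd p (W i k)) 0) =
      (\<Sum>i\<in>UNIV. \<Sum>k\<in>UNIV. \<Sum>p\<in>UNIV. W i k 0 * pd p (pd p (W i k)) 0)"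
    by (rule trans[OF sum.swap]) (intro sum.cong[OF refl] sum.swap)
  finally show ?thesis by (simp add: sum_distrib_left)
qed

lemma dh_dw: "x \<in> S \<Longrightarrow> pd p h x = h x * pd p w x"
  using partial_deriv_real_chain[OF sh _ DERIV_ln[OF hpos], of x p] hpos[of x] by simp

lemma d2h_d2w: "pd p (pd p h) 0 =
    h 0 * (pd p (pd p w) 0 + (pd p w 0)\<^sup>2)"
proof -
  have "pd p (pd p h) 0 = pd p (\<lambda>x. h x * pd p w x) 0"
    by (intro partial_deriv_cong[OF openS zero] dh_dw)
  then show ?thesis
    by (simp add: partial_deriv_mult[OF sh smooth_on_partial_deriv[OF sw] zero] dh_dw[OF zero]
        algebra_simps power2_eq_square)
qed

lemma df: "x \<in> S \<Longrightarrow> pd p f x = dX p x \<bullet> X x"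
  using partial_deriv_bounded_linear[OF bounded_linear_divide smooth_on_inner[OF sX sX], of x p 2]
    partial_deriv_inner[OF sX sX, of x p]
  by (simp add: inner_commute)

lemma df_0: "pd p f 0 = \<theta> p 0"
proof -
  have "(X 0 + h 0 *\<^sub>R \<nu> 0) \<bullet> dX p 0 = (\<Sum>k\<in>UNIV. \<theta> k 0 *\<^sub>R dX k 0) \<bullet> dX p 0"
    by (rule arg_cong[OF position[OF zero]])
  also have "\<dots> = \<theta> p 0"
    by (simp only: inner_sum_left inner_scaleR_left sum_orth)
  finally have "dX p 0 \<bullet> (X 0 + h 0 *\<^sub>R \<nu> 0) = \<theta> p 0"
    by (simp add: inner_commute)
  then show ?thesis
    by (simp add: df[OF zero] inner_add_right dX_\<nu>[OF zero])
qed

lemma lap_f: "lap f = real CARD('m) - (h 0)\<^sup>2"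
proof -
  have "(X 0 + h 0 *\<^sub>R \<nu> 0) \<bullet> \<nu> 0 = (\<Sum>k\<in>UNIV. \<theta> k 0 *\<^sub>R dX k 0) \<bullet> \<nu> 0"
    by (rule arg_cong[OF position[OF zero]])
  also have "\<dots> = 0"
    by (simp only: inner_sum_left inner_scaleR_left dX_\<nu>[OF zero] mult_zero_right sum.neutral_const)
  finally have "X 0 \<bullet> \<nu> 0 + h 0 = 0"
    by (simp add: inner_add_left \<nu>_unit[OF zero])
  then have X\<nu>: "\<nu> 0 \<bullet> X 0 = - h 0"
    by (simp add: inner_commute)
  have "pd p (pd p f) 0 = d2X p p 0 \<bullet> X 0 + 1" for p
  proof -
    have "pd p (pd p f) 0 = pd p (\<lambda>x. dX p x \<bullet> X x) 0"
      by (intro partial_deriv_cong[OF openS zero] df)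
    then show ?thesis
      by (simp add: partial_deriv_inner[OF sX1 sX zero] orth)
  qed
  then have "lap f = (\<Sum>p\<in>UNIV. d2X p p 0) \<bullet> X 0 + real CARD('m)"
    by (simp add: sum.distrib inner_sum_left)
  then show ?thesis
    by (simp add: mean_curvature_0 X\<nu> power2_eq_square)
qed

text \<open>As D nu takes tangential values, this identifies z with minus the gradient of h on all
  of S.\<close>

lemma dh_speed:
  assumes x: "x \<in> S"
  shows "pd j h x = - (dX j x \<bullet> z x)"
  by (simp add: dh[OF x] normal_speed_def d2X_commute[OF x, of j] d2X_\<nu>[OF x]
      frechet_derivative_eq_sum_partial_deriv[OF diff\<nu>[OF x]] inner_sum_right sum_negf)

lemma z_0: "z 0 = - (\<Sum>l\<in>UNIV. pd l h 0 *\<^sub>R dX l 0)"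
proof -
  have "z 0 = - (\<Sum>k\<in>UNIV. \<Sum>l\<in>UNIV. (\<theta> k 0 * W k l 0) *\<^sub>R dX l 0)"
    by (simp add: normal_speed_def frechet_derivative_eq_sum_partial_deriv[OF diff\<nu>[OF zero]]
        d\<nu>[OF zero] sum_negf scaleR_sum_right)
  also have "\<dots> = - (\<Sum>l\<in>UNIV. \<Sum>k\<in>UNIV. (\<theta> k 0 * W k l 0) *\<^sub>R dX l 0)"
    by (subst sum.swap) simp
  also have "\<dots> = - (\<Sum>l\<in>UNIV. (\<Sum>k\<in>UNIV. \<theta> k 0 * W k l 0) *\<^sub>R dX l 0)"
    by (simp add: scaleR_sum_left)
  finally show ?thesis
    by (simp add: dh_0 W_sym)
qed

section \<open>The operator L applied to pinching and barrier\<close>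

abbreviation drift :: "(real^'m \<Rightarrow> real) \<Rightarrow> real"
  where "drift q \<equiv> (\<Sum>p\<in>UNIV. (2 * pd p w 0 - \<theta> p 0) * pd p q 0)"

text \<open>The right side is 2 h^2 |DS|^2, because D(W/h) = (DW - W D log h)/h.\<close>

lemma pinching_subsolution: "(h 0)\<^sup>2 * (lap u + drift u) =
   2 * (\<Sum>p\<in>UNIV. \<Sum>i\<in>UNIV. \<Sum>k\<in>UNIV. (pd p (W i k) 0 - pd p w 0 * W i k 0)\<^sup>2)"
proof -
  define wp where "wp p = pd p w 0" for p
  define up where "up p = pd p u 0" for p
  define A where "A = (\<Sum>p\<in>UNIV. up p * wp p)"
  define B where "B = (\<Sum>p\<in>UNIV. \<theta> p 0 * up p)"
  define C where "C = (\<Sum>p\<in>UNIV. (wp p)\<^sup>2)"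
  define D where "D = (\<Sum>p\<in>UNIV. \<theta> p 0 * wp p)"
  define N where "N = (\<Sum>p\<in>UNIV. \<Sum>i\<in>UNIV. \<Sum>k\<in>UNIV. (pd p (W i k) 0)\<^sup>2)"
  note h0 = hpos[OF zero]
  have uh: "u x * (h x * h x) = shape_sq X \<nu> x" if "x \<in> S" for x
    using hpos[OF that] by (simp add: pinching_def)
  have u0: "W2 = u 0 * (h 0)\<^sup>2"
    using uh[OF zero] by (simp add: shape_sq_0 power2_eq_square)
  note shh = smooth_on_mult[OF sh sh] and su1 = smooth_on_partial_deriv[OF su]
  have q1: "pd p (shape_sq X \<nu>) x = u x * (2 * (h x * pd p h x)) + pd p u x * (h x * h x)"
    if x: "x \<in> S" for p x
  proof -
    have "pd p (shape_sq X \<nu>) x = pd p (\<lambda>x. u x * (h x * h x)) x"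
      by (intro partial_deriv_cong[OF openS x] uh[symmetric])
    then show ?thesis
      by (simp add: partial_deriv_mult[OF su shh x] partial_deriv_mult[OF sh sh x])
  qed
  have hp: "pd p h 0 = h 0 * wp p" for p
    by (simp add: dh_dw[OF zero] wp_def)
  have q1_0: "pd p (shape_sq X \<nu>) 0 = (h 0)\<^sup>2 * (up p + 2 * u 0 * wp p)" for p
    by (simp add: q1[OF zero] hp up_def power2_eq_square algebra_simps)
  have q2: "pd p (pd p (shape_sq X \<nu>)) 0 =
     (h 0)\<^sup>2 * pd p (pd p u) 0 + 4 * (h 0)\<^sup>2 * (up p * wp p) +
     2 * u 0 * ((h 0)\<^sup>2 * (wp p)\<^sup>2 + h 0 * pd p (pd p h) 0)" for p
  proof -
    have s: "smooth_on (\<lambda>x. h x * pd p h x) S" by (intro smooth_on_mult sh sh1)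
    have s2: "smooth_on (\<lambda>x. 2 * (h x * pd p h x)) S"
      by (intro smooth_on_mult s smooth_on_const openS)
    have "pd p (pd p (shape_sq X \<nu>)) 0 =
        pd p (\<lambda>x. u x * (2 * (h x * pd p h x)) + pd p u x * (h x * h x)) 0"
      by (intro partial_deriv_cong[OF openS zero] q1)
    also have "\<dots> = pd p (\<lambda>x. u x * (2 * (h x * pd p h x))) 0 +
        pd p (\<lambda>x. pd p u x * (h x * h x)) 0"
      by (intro partial_deriv_add[where S = S] smooth_on_mult[OF su s2] smooth_on_mult[OF su1 shh] zero)
    also have "\<dots> = u 0 * (2 * (h 0 * pd p (pd p h) 0 + pd p h 0 * pd p h 0))
       + up p * (2 * (h 0 * pd p h 0)) + (up p * (2 * (h 0 * pd p h 0)) +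
         pd p (pd p u) 0 * (h 0 * h 0))"
      by (simp add: partial_deriv_mult[OF su s2 zero] partial_deriv_mult[OF su1 shh zero]
          partial_deriv_mult[OF smooth_on_const[OF openS] s zero] partial_deriv_const
          partial_deriv_mult[OF sh sh1 zero] partial_deriv_mult[OF sh sh zero] up_def)
    finally show ?thesis
      by (simp add: hp power2_eq_square algebra_simps)
  qed
  have "lap (shape_sq X \<nu>) = (h 0)\<^sup>2 * lap u + 4 * (h 0)\<^sup>2 * A + 2 * u 0 * ((h 0)\<^sup>2 * C + h 0 * lap h)"
    by (simp add: q2 A_def C_def sum.distrib sum_distrib_left algebra_simps)
  moreover have "lap (shape_sq X \<nu>) = 2 * (W2 - W2\<^sup>2) + ((h 0)\<^sup>2 * (B + 2 * u 0 * D)) + 2 * N"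
  proof -
    have "2 * (\<Sum>k\<in>UNIV. \<theta> k 0 * (\<Sum>i\<in>UNIV. \<Sum>l\<in>UNIV. W i l 0 * pd k (W i l) 0)) =
       (\<Sum>k\<in>UNIV. \<theta> k 0 * pd k (shape_sq X \<nu>) 0)"
      by (simp add: dshape_sq_0 sum_distrib_left mult_ac)
    also have "\<dots> = (h 0)\<^sup>2 * (B + 2 * u 0 * D)"
      by (simp add: q1_0 B_def D_def sum.distrib sum_distrib_left algebra_simps)
    finally show ?thesis
      unfolding lap_shape_sq W_lap_W N_def by simp
  qed
  moreover have "lap h = h 0 - h 0 * W2 + h 0 * D"
    unfolding lap_h D_def by (simp add: hp sum_distrib_left mult_ac)
  \<comment> \<open>Two expressions for the Laplacian of |W|^2 = u h^2 are compared: the product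
    rule and Simons' identity. The terms |W|^2 - |W|^4 and those with D occur in both, on one side
    through the Laplacian of h, and cancel.\<close>
  ultimately have 1: "(h 0)\<^sup>2 * (lap u + 4 * A - B) + 2 * u 0 * (h 0)\<^sup>2 * C = 2 * N"
    unfolding u0 by (simp add: algebra_simps power2_eq_square)
  \<comment> \<open>Completing the square uses up half of the cross term 4 A; the other half is the
    part 2 (D log h) . D u of the drift.\<close>
  have "(\<Sum>p\<in>UNIV. \<Sum>i\<in>UNIV. \<Sum>k\<in>UNIV. (pd p (W i k) 0 - wp p * W i k 0)\<^sup>2) =
    (\<Sum>p\<in>UNIV. \<Sum>i\<in>UNIV. \<Sum>k\<in>UNIV. (pd p (W i k) 0)\<^sup>2 -
      wp p * (2 * (W i k 0 * pd p (W i k) 0)) + (wp p)\<^sup>2 * (W i k 0)\<^sup>2)"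
    by (intro sum.cong refl) (simp add: power2_eq_square algebra_simps)
  also have "\<dots> = N - (\<Sum>p\<in>UNIV. wp p * pd p (shape_sq X \<nu>) 0) + C * W2"
  proof -
    have "C * W2 = (\<Sum>p\<in>UNIV. (wp p)\<^sup>2 * W2)"
      unfolding C_def by (rule sum_distrib_right)
    then have "C * W2 = (\<Sum>p\<in>UNIV. \<Sum>i\<in>UNIV. \<Sum>k\<in>UNIV. (wp p)\<^sup>2 * (W i k 0)\<^sup>2)"
      by (simp add: sum_distrib_left)
    then show ?thesis
      by (simp add: sum.distrib sum_subtractf N_def dshape_sq_0 sum_distrib_left)
  qed
  also have "(\<Sum>p\<in>UNIV. wp p * pd p (shape_sq X \<nu>) 0) = (h 0)\<^sup>2 * (A + 2 * u 0 * C)"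
    by (simp add: q1_0 A_def C_def sum.distrib sum_distrib_left power2_eq_square algebra_simps)
  finally have 2: "(\<Sum>p\<in>UNIV. \<Sum>i\<in>UNIV. \<Sum>k\<in>UNIV. (pd p (W i k) 0 - wp p * W i k 0)\<^sup>2) =
     N - (h 0)\<^sup>2 * (A + u 0 * C)"
    by (simp add: u0 algebra_simps)
  have dr: "drift u = 2 * A - B"
    by (simp add: A_def B_def sum_distrib_left left_diff_distrib right_diff_distrib sum_subtractf mult_ac
        flip: wp_def up_def)
  show ?thesis
    unfolding wp_def[symmetric] 2 dr[folded wp_def] using 1 by (simp add: algebra_simps)
qed

lemma barrier_equation:
  assumes s: "s > 0"
  defines "E \<equiv> \<lambda>x. exp (f x - w x / s)"
  shows "smooth_on E S"
    and "lap E + drift E = E 0 * barrier_rate (real CARD('m)) s (u 0) (h 0) (z 0) (X 0)"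
proof -
  define v where "v x = f x - w x / s" for x
  define wp where "wp p = pd p w 0" for p
  define vp where "vp p = pd p v 0" for p
  define C where "C = (\<Sum>p\<in>UNIV. (wp p)\<^sup>2)"
  define D where "D = (\<Sum>p\<in>UNIV. \<theta> p 0 * wp p)"
  define T where "T = (\<Sum>p\<in>UNIV. (\<theta> p 0)\<^sup>2)"
  note h0 = hpos[OF zero]
  have sws: "smooth_on (\<lambda>x. w x / s) S"
    using s by (intro smooth_on_divide sw smooth_on_const openS) simp
  have sv: "smooth_on v S"
    unfolding v_def by (intro smooth_on_diff sf sws)
  show sE: "smooth_on E S"
    unfolding E_def by (intro smooth_on_exp smooth_on_diff sf sws)
  have Ev: "E = (\<lambda>x. exp (v x))" by (simp add: E_def v_def)
  have E1: "pd p E x = E x * pd p v x" if "x \<in> S" for p x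
    unfolding Ev by (rule partial_deriv_real_chain[OF sv that]) (auto intro!: derivative_eq_intros)
  have E2: "pd p (pd p E) 0 = E 0 * (pd p (pd p v) 0 + (vp p)\<^sup>2)" for p
  proof -
    have "pd p (pd p E) 0 = pd p (\<lambda>x. E x * pd p v x) 0"
      by (intro partial_deriv_cong[OF openS zero] E1)
    then show ?thesis
      by (simp add: partial_deriv_mult[OF sE smooth_on_partial_deriv[OF sv] zero] E1[OF zero] vp_def
          power2_eq_square algebra_simps)
  qed
  have v1: "pd p v x = pd p f x - pd p w x / s" if "x \<in> S" for p x
  proof -
    have "pd p (\<lambda>x. w x / s) x = pd p w x / s"
      by (rule partial_deriv_bounded_linear[OF bounded_linear_divide sw that])
    then show ?thesis
      unfolding v_def using partial_deriv_diff[OF sf sws that, of p] by simp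
  qed
  have vp: "vp p = \<theta> p 0 - wp p / s" for p
    by (simp add: vp_def v1[OF zero] df_0 wp_def)
  have v2: "pd p (pd p v) 0 = pd p (pd p f) 0 - pd p (pd p w) 0 / s" for p
  proof -
    note sf1 = smooth_on_partial_deriv[OF sf] and sw1 = smooth_on_partial_deriv[OF sw]
    have "pd p (pd p v) 0 = pd p (\<lambda>x. pd p f x - pd p w x / s) 0"
      by (intro partial_deriv_cong[OF openS zero] v1)
    also have "\<dots> = pd p (pd p f) 0 - pd p (\<lambda>x. pd p w x / s) 0"
      by (rule partial_deriv_diff[OF sf1 smooth_on_bounded_linear[OF bounded_linear_divide sw1] zero])
    also have "pd p (\<lambda>x. pd p w x / s) 0 = pd p (pd p w) 0 / s"
      by (rule partial_deriv_bounded_linear[OF bounded_linear_divide sw1 zero])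
    finally show ?thesis .
  qed
  have hp: "pd p h 0 = h 0 * wp p" for p
    by (simp add: dh_dw[OF zero] wp_def)
  have lh: "lap h = h 0 * (lap w + C)"
    by (simp add: d2h_d2w C_def wp_def sum.distrib sum_distrib_left distrib_left)
  have lh': "lap h = h 0 * (1 - W2 + D)"
    unfolding lap_h D_def by (simp add: hp sum_distrib_left algebra_simps)
  have W2: "W2 = u 0 * (h 0)\<^sup>2"
    using h0 by (simp add: pinching_def shape_sq_0 power2_eq_square)
  have "h 0 * (lap w + C) = h 0 * (1 - u 0 * (h 0)\<^sup>2 + D)"
    by (rule trans[OF lh[symmetric] lh'[unfolded W2]])
  then have "lap w + C = 1 - u 0 * (h 0)\<^sup>2 + D"
    by (rule iffD1[OF mult_left_cancel, rotated]) (use h0 in simp)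
  then have lw: "lap w = 1 - u 0 * (h 0)\<^sup>2 + D - C"
    by linarith
  have lv: "lap v = real CARD('m) - (h 0)\<^sup>2 - (1 - u 0 * (h 0)\<^sup>2 + D - C) / s"
    by (simp add: v2 sum_subtractf lap_f flip: sum_divide_distrib lw)
  have vv: "(\<Sum>p\<in>UNIV. (vp p)\<^sup>2) = T - 2 * D / s + C / s\<^sup>2"
  proof -
    have "(\<Sum>p\<in>UNIV. (vp p)\<^sup>2) = (\<Sum>p\<in>UNIV. (\<theta> p 0)\<^sup>2 - (2 / s) * (\<theta> p 0 * wp p) + (1 / s\<^sup>2) * (wp p)\<^sup>2)"
      by (intro sum.cong refl) (simp add: vp power2_eq_square algebra_simps)
    then show ?thesis
      by (simp only: sum.distrib sum_subtractf T_def C_def D_def flip: sum_distrib_left) simp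
  qed
  have dv: "(\<Sum>p\<in>UNIV. (2 * wp p - \<theta> p 0) * vp p) = 2 * D - 2 * C / s - T + D / s"
  proof -
    have "(\<Sum>p\<in>UNIV. (2 * wp p - \<theta> p 0) * vp p) =
      (\<Sum>p\<in>UNIV. (2 + 1/s) * (\<theta> p 0 * wp p) - (2 / s) * (wp p)\<^sup>2 - (\<theta> p 0)\<^sup>2)"
      by (intro sum.cong refl) (simp add: vp power2_eq_square algebra_simps)
    then show ?thesis
      by (simp only: sum.distrib sum_subtractf T_def C_def D_def flip: sum_distrib_left)
         (simp add: algebra_simps)
  qed
  \<comment> \<open>The gradient of log h is expressed through z and X, so that the rate can be
    evaluated in any chart.\<close>
  have zz: "z 0 \<bullet> z 0 = (h 0)\<^sup>2 * C"
  proof -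
    have "z 0 \<bullet> z 0 = - (\<Sum>l\<in>UNIV. pd l h 0 * (dX l 0 \<bullet> z 0))"
      by (subst z_0) (simp add: inner_sum_left)
    also have "\<dots> = (\<Sum>l\<in>UNIV. (pd l h 0)\<^sup>2)"
      using dh_speed[OF zero] by (simp add: power2_eq_square sum_negf[symmetric])
    finally show ?thesis
      by (simp add: hp C_def power_mult_distrib sum_distrib_left)
  qed
  have zX: "z 0 \<bullet> X 0 = - h 0 * D"
    unfolding z_0 D_def
    by (simp add: inner_sum_left hp sum_distrib_left sum_negf mult_ac flip: df[OF zero] df_0)
  have "lap E + drift E = E 0 * (lap v + (\<Sum>p\<in>UNIV. (vp p)\<^sup>2) + (\<Sum>p\<in>UNIV. (2 * wp p - \<theta> p 0) * vp p))"
    by (simp add: E2 E1[OF zero] vp_def[symmetric] wp_def[symmetric] sum_distrib_left sum.distrib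
        distrib_left mult_ac)
  \<comment> \<open>T cancels between \<open>vv\<close> and \<open>dv\<close>; the coefficients of D
    and C collect to 2 (1 - 1/s) and -(1 - 1/s)/s.\<close>
  also have "lap v + (\<Sum>p\<in>UNIV. (vp p)\<^sup>2) + (\<Sum>p\<in>UNIV. (2 * wp p - \<theta> p 0) * vp p) =
    barrier_rate (real CARD('m)) s (u 0) (h 0) (z 0) (X 0)"
    unfolding lv vv dv barrier_rate_def zz zX using h0 s
    by (simp add: field_simps power2_eq_square)
  finally show "lap E + drift E = E 0 * barrier_rate (real CARD('m)) s (u 0) (h 0) (z 0) (X 0)" .
qed

section \<open>Consequences at a maximum\<close>

lemma max_laplace_drift:
  assumes "smooth_on q S" "\<And>x. x \<in> S \<Longrightarrow> q x \<le> q 0"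
  shows "lap q + drift q \<le> 0"
  using local_max_partial_deriv[OF assms(1) zero assms(2)] by (simp add: sum_nonpos)

text \<open>At a maximum L u <= 0, so every square in \<open>pinching_subsolution\<close> vanishes
  and S is parallel at the point. If D log h is nonzero there, Codazzi makes W of rank one, hence
  |W|^2 = (tr W)^2 = h^2.\<close>

lemma max_pinching:
  assumes max: "\<And>x. x \<in> S \<Longrightarrow> u x \<le> u 0"
  shows "u 0 = 1 \<or> z 0 = 0"
proof (cases "\<forall>p. pd p w 0 = 0")
  case True
  then show ?thesis by (simp add: z_0 dh_dw[OF zero])
next
  case False
  define wp where "wp p = pd p w 0" for p
  define C where "C = (\<Sum>p\<in>UNIV. (wp p)\<^sup>2)"
  obtain p where "wp p \<noteq> 0" using False by (auto simp: wp_def)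
  then have C: "C > 0"
    unfolding C_def by (intro sum_pos2[of _ p]) auto
  have "(h 0)\<^sup>2 * (lap u + drift u) \<le> 0"
    using max_laplace_drift[OF su max] by (simp add: mult_nonneg_nonpos)
  then have "(\<Sum>p\<in>UNIV. \<Sum>i\<in>UNIV. \<Sum>k\<in>UNIV. (pd p (W i k) 0 - wp p * W i k 0)\<^sup>2) \<le> 0"
    unfolding pinching_subsolution wp_def by simp
  then have "(\<Sum>p\<in>UNIV. \<Sum>i\<in>UNIV. \<Sum>k\<in>UNIV. (pd p (W i k) 0 - wp p * W i k 0)\<^sup>2) = 0"
    by (intro antisym sum_nonneg) auto
  then have par: "pd p (W i k) 0 = wp p * W i k 0" for p i k
    by (simp add: sum_nonneg_eq_0_iff sum_nonneg)
  \<comment> \<open>With DW = W D log h, Codazzi becomes an algebraic symmetry of the tensor product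
    of wp and W. For wp nonzero it forces W = h wp wp / C, the factor h being fixed by the
    trace.\<close>
  have cod: "wp j * W i l 0 = wp i * W j l 0" for i j l
    using codazzi[where i = i and j = j and l = l] by (simp add: par)
  define y where "y l = (\<Sum>j\<in>UNIV. wp j * W j l 0)" for l
  have 1: "C * W i l 0 = wp i * y l" for i l
  proof -
    have "C * W i l 0 = (\<Sum>j\<in>UNIV. wp j * (wp j * W i l 0))"
      by (simp add: C_def sum_distrib_right power2_eq_square mult.assoc)
    also have "\<dots> = (\<Sum>j\<in>UNIV. wp i * (wp j * W j l 0))"
      by (intro sum.cong refl) (metis cod mult.left_commute)
    finally show ?thesis by (simp add: y_def sum_distrib_left)
  qed
  have tr: "C * h 0 = (\<Sum>i\<in>UNIV. wp i * y i)"
    by (simp add: mean_curvature_trace[OF zero] sum_distrib_left 1)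
  have "C * y l = wp l * (C * h 0)" for l
  proof -
    have "C * y l = (\<Sum>j\<in>UNIV. wp j * (C * W l j 0))"
      by (simp add: y_def sum_distrib_left mult_ac W_sym)
    also have "\<dots> = wp l * (\<Sum>j\<in>UNIV. wp j * y j)"
      by (simp add: 1 sum_distrib_left mult_ac)
    finally show ?thesis by (simp add: tr)
  qed
  then have y: "y l = h 0 * wp l" for l
    using C by (simp add: mult_ac)
  have "C\<^sup>2 * W2 = (\<Sum>i\<in>UNIV. \<Sum>k\<in>UNIV. (C * W i k 0)\<^sup>2)"
    by (simp add: sum_distrib_left power_mult_distrib)
  also have "\<dots> = (h 0)\<^sup>2 * (\<Sum>i\<in>UNIV. \<Sum>k\<in>UNIV. (wp i)\<^sup>2 * (wp k)\<^sup>2)"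
    by (simp add: 1 y sum_distrib_left power_mult_distrib mult_ac)
  also have "\<dots> = (h 0)\<^sup>2 * C\<^sup>2"
    by (simp add: C_def power2_eq_square sum_product)
  finally have "W2 = (h 0)\<^sup>2" using C by simp
  then show ?thesis
    using hpos[OF zero] by (simp add: pinching_def shape_sq_0 power2_eq_square)
qed

text \<open>At the maximum L (u + epsilon E) <= 0, while L u >= 0 everywhere; hence L E <= 0 there,
  and E is positive.\<close>

lemma max_barrier:
  assumes s: "s > 0" and \<epsilon>: "\<epsilon> > 0"
    and max: "\<And>x. x \<in> S \<Longrightarrow> u x + \<epsilon> * exp (f x - w x / s) \<le> u 0 + \<epsilon> * exp (f 0 - w 0 / s)"
  shows "barrier_rate (real CARD('m)) s (u 0) (h 0) (z 0) (X 0) \<le> 0"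
proof -
  define E where "E x = exp (f x - w x / s)" for x
  note E = barrier_equation[OF s, folded E_def[abs_def]]
  have seE: "smooth_on (\<lambda>x. \<epsilon> * E x) S"
    by (intro smooth_on_mult smooth_on_const openS E(1))
  have eE: "pd p (\<lambda>x. \<epsilon> * E x) x = \<epsilon> * pd p E x" if "x \<in> S" for p x
    by (rule partial_deriv_bounded_linear[OF bounded_linear_mult_right E(1) that])
  have 1: "pd p (\<lambda>x. u x + \<epsilon> * E x) x = pd p u x + \<epsilon> * pd p E x"
    if "x \<in> S" for p x
    using partial_deriv_add[OF su seE that, of p] eE[OF that] by simp
  have 2: "pd p (pd p (\<lambda>x. u x + \<epsilon> * E x)) 0 =
    pd p (pd p u) 0 + \<epsilon> * pd p (pd p E) 0" for p
  proof -
    note su1 = smooth_on_partial_deriv[OF su] and sE1 = smooth_on_partial_deriv[OF E(1)]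
    have "pd p (pd p (\<lambda>x. u x + \<epsilon> * E x)) 0 =
      pd p (\<lambda>x. pd p u x + \<epsilon> * pd p E x) 0"
      by (intro partial_deriv_cong[OF openS zero] 1)
    also have "\<dots> = pd p (pd p u) 0 + pd p (\<lambda>x. \<epsilon> * pd p E x) 0"
      by (rule partial_deriv_add[OF su1 smooth_on_mult[OF smooth_on_const[OF openS] sE1] zero])
    also have "pd p (\<lambda>x. \<epsilon> * pd p E x) 0 = \<epsilon> * pd p (pd p E) 0"
      by (rule partial_deriv_bounded_linear[OF bounded_linear_mult_right sE1 zero])
    finally show ?thesis .
  qed
  have "lap (\<lambda>x. u x + \<epsilon> * E x) + drift (\<lambda>x. u x + \<epsilon> * E x) \<le> 0"
    by (rule max_laplace_drift[OF smooth_on_add[OF su seE]]) (use max in \<open>simp add: E_def\<close>)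
  moreover have "lap (\<lambda>x. u x + \<epsilon> * E x) + drift (\<lambda>x. u x + \<epsilon> * E x) =
      (lap u + drift u) + \<epsilon> * (lap E + drift E)"
    by (simp add: 1[OF zero] 2 sum.distrib sum_distrib_left distrib_left distrib_right mult_ac)
  moreover have "lap u + drift u \<ge> 0"
  proof -
    have "(h 0)\<^sup>2 * (lap u + drift u) \<ge> 0"
      unfolding pinching_subsolution by (intro mult_nonneg_nonneg sum_nonneg) auto
    then show ?thesis
      using hpos[OF zero] by (simp add: zero_le_mult_iff)
  qed
  ultimately have "\<epsilon> * (lap E + drift E) \<le> 0" by linarith
  then have "\<epsilon> * E 0 * barrier_rate (real CARD('m)) s (u 0) (h 0) (z 0) (X 0) \<le> 0"
    unfolding E(2) by (simp add: E_def mult.assoc)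
  moreover have "\<epsilon> * E 0 > 0" using \<epsilon> by (simp add: E_def)
  ultimately show ?thesis by (metis mult_le_0_iff not_less)
qed

text \<open>Cauchy-Schwarz for the diagonal of W, whose sum is h.\<close>

lemma pinching_ge: "u 0 \<ge> 1 / real CARD('m)"
proof -
  have "(h 0)\<^sup>2 \<le> real CARD('m) * (\<Sum>i\<in>UNIV. (W i i 0)\<^sup>2)"
    unfolding mean_curvature_trace[OF zero]
    using sum_squared_le_sum_of_squares[of "\<lambda>i. W i i 0" "UNIV::'m set"] by (simp add: mult.commute)
  also have "(\<Sum>i\<in>UNIV. (W i i 0)\<^sup>2) \<le> W2"
    by (intro sum_mono member_le_sum) auto
  finally have "(h 0)\<^sup>2 \<le> real CARD('m) * W2"
    by (simp add: mult_left_mono)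
  then show ?thesis
    using hpos[OF zero] by (simp add: pinching_def shape_sq_0 field_simps power2_eq_square)
qed

text \<open>z = 0 on S makes the derivatives of h vanish, and \<open>lap_h\<close> reduces to 0 = h
  (1 - |W|^2).\<close>

lemma constant_mean_curvature:
  assumes "\<And>x. x \<in> S \<Longrightarrow> z x = 0"
  shows "shape_sq X \<nu> 0 = 1"
proof -
  have h1: "pd p h x = 0" if "x \<in> S" for p x
    using dh_speed[OF that] assms[OF that] by simp
  have "pd p (pd p h) 0 = pd p (\<lambda>x. 0) 0" for p
    by (intro partial_deriv_cong[OF openS zero] h1)
  then have "lap h = 0" by (simp add: partial_deriv_const)
  then show ?thesis
    using lap_h h1[OF zero] hpos[OF zero] by (simp add: shape_sq_0)
qed

end

subsection \<open>From charts to the manifold\<close>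

lemma shrinker_on_normal_part:
  assumes shr: "shrinker_on S X \<nu> h" and x: "x \<in> S"
  shows "normal_part X x (X x) = - (h x *\<^sub>R \<nu> x)"
  using shrinker_onD(7)[OF shr x] shrinker_onD(9)[OF shr x]
  by (intro normal_part_eqI[OF shrinker_onD(11)[OF shr x]])
     (auto simp: normal_space_iff[OF shrinker_onD(11)[OF shr x]])

text \<open>The normal part of the position determines the product h nu, and h > 0 with |nu| = 1
  separates the factors.\<close>

lemma shrinker_on_unique:
  assumes X: "shrinker_on S X \<nu> h" and Y: "shrinker_on S' Y \<mu> k"
    and T: "open T" "T \<subseteq> S" "T \<subseteq> S'" and eq: "\<And>y. y \<in> T \<Longrightarrow> X y = Y y" and y: "y \<in> T"
  shows "\<nu> y = \<mu> y" "h y = k y"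
proof -
  have "frechet_derivative X (at y) = frechet_derivative Y (at y)"
    by (rule frechet_derivative_cong[OF T(1) y eq])
  moreover have yS: "y \<in> S" "y \<in> S'" using T y by auto
  ultimately have "normal_part X y (X y) = normal_part Y y (Y y)"
    by (simp add: normal_part_def normal_space_def tangent_space_def eq y)
  then have *: "h y *\<^sub>R \<nu> y = k y *\<^sub>R \<mu> y"
    using shrinker_on_normal_part[OF X yS(1)] shrinker_on_normal_part[OF Y yS(2)] by simp
  have 1: "h y > 0" "k y > 0" "norm (\<nu> y) = 1" "norm (\<mu> y) = 1"
    using shrinker_onD(5,6)[OF X yS(1)] shrinker_onD(5,6)[OF Y yS(2)] by (auto simp: norm_eq_1)
  then show "h y = k y"
    using arg_cong[OF *, of norm] by simp
  then show "\<nu> y = \<mu> y"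
    using * 1 by simp
qed

text \<open>The locale speaks about the point 0 only. Any point can be moved there by adapted
  coordinates, and the invariants carry the conclusions back.\<close>

lemma adapted_at:
  fixes X :: "real^'m::finite \<Rightarrow> real^'n::finite"
  assumes shr: "shrinker_on S X \<nu> h" and x0: "x0 \<in> S"
  obtains \<phi> :: "real^'m \<Rightarrow> real^'m" and T where
    "adapted_shrinker T (\<lambda>y. X (\<phi> y)) (\<lambda>y. \<nu> (\<phi> y)) (\<lambda>y. h (\<phi> y))"
    "\<phi> 0 = x0" "\<phi> ` T \<subseteq> S" "0 \<in> T"
    "\<And>y. y \<in> T \<Longrightarrow> shape_sq (\<lambda>y. X (\<phi> y)) (\<lambda>y. \<nu> (\<phi> y)) y = shape_sq X \<nu> (\<phi> y)"
    "\<And>y. y \<in> T \<Longrightarrow> pinching (\<lambda>y. X (\<phi> y)) (\<lambda>y. \<nu> (\<phi> y)) (\<lambda>y. h (\<phi> y)) y = pinching X \<nu> h (\<phi> y)"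
    "\<And>y. y \<in> T \<Longrightarrow> normal_speed (\<lambda>y. X (\<phi> y)) (\<lambda>y. \<nu> (\<phi> y)) (\<lambda>y. h (\<phi> y)) y = normal_speed X \<nu> h (\<phi> y)"
proof -
  obtain \<phi> :: "real^'m \<Rightarrow> real^'m" and T where p: "smooth_on \<phi> T" "\<phi> ` T \<subseteq> S" "0 \<in> T" "\<phi> 0 = x0"
    and inj: "\<And>y. y \<in> T \<Longrightarrow> inj (frechet_derivative \<phi> (at y))"
    and ad: "\<And>i j. pd i (\<lambda>y. X (\<phi> y)) 0 \<bullet> pd j (\<lambda>y. X (\<phi> y)) 0 =
      (if i = j then 1 else 0)"
    "\<And>i j k. pd i (pd j (\<lambda>y. X (\<phi> y))) 0 \<bullet>
      pd k (\<lambda>y. X (\<phi> y)) 0 = 0"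
    using adapted_coordinates[OF shrinker_onD(1)[OF shr] shrinker_onD(4)[OF shr] x0] by blast
  note Y = shrinker_on_reparam[OF shr p(1,2) inj]
  note inv = reparam_invariants[OF shr Y p(1,2) order_refl refl refl refl]
  show ?thesis
  proof (rule that[OF _ p(4,2,3) inv(1) _ inv(2)])
    show "adapted_shrinker T (\<lambda>y. X (\<phi> y)) (\<lambda>y. \<nu> (\<phi> y)) (\<lambda>y. h (\<phi> y))"
      by unfold_locales (use Y p ad in auto)
  qed (simp_all add: pinching_def inv(1))
qed

section \<open>Pointwise results at arbitrary points of a chart\<close>

lemma shrinker_max_pinching:
  assumes shr: "shrinker_on S X \<nu> h" and x0: "x0 \<in> S"
    and max: "\<And>x. x \<in> S \<Longrightarrow> pinching X \<nu> h x \<le> pinching X \<nu> h x0"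
  shows "pinching X \<nu> h x0 = 1 \<or> normal_speed X \<nu> h x0 = 0"
  using adapted_at[OF shr x0]
proof cases
  case (1 \<phi> T)
  interpret adapted_shrinker T "\<lambda>y. X (\<phi> y)" "\<lambda>y. \<nu> (\<phi> y)" "\<lambda>y. h (\<phi> y)" by (rule 1(1))
  have "u y \<le> u 0" if "y \<in> T" for y
    using max[of "\<phi> y"] that 1(2-4,6) by auto
  from max_pinching[OF this] show ?thesis
    using 1(2,4,6,7) by simp
qed

lemma shrinker_max_barrier:
  fixes X :: "real^'m::finite \<Rightarrow> real^'n::finite"
  assumes shr: "shrinker_on S X \<nu> h" and x0: "x0 \<in> S" and s: "s > 0" and \<epsilon>: "\<epsilon> > 0"
    and max: "\<And>x. x \<in> S \<Longrightarrow> pinching X \<nu> h x + \<epsilon> * exp (X x \<bullet> X x / 2 - ln (h x) / s) \<le>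
      pinching X \<nu> h x0 + \<epsilon> * exp (X x0 \<bullet> X x0 / 2 - ln (h x0) / s)"
  shows "barrier_rate (real CARD('m)) s (pinching X \<nu> h x0) (h x0) (normal_speed X \<nu> h x0) (X x0) \<le> 0"
  using adapted_at[OF shr x0]
proof cases
  case (1 \<phi> T)
  interpret adapted_shrinker T "\<lambda>y. X (\<phi> y)" "\<lambda>y. \<nu> (\<phi> y)" "\<lambda>y. h (\<phi> y)" by (rule 1(1))
  have "u y + \<epsilon> * exp (f y - w y / s) \<le> u 0 + \<epsilon> * exp (f 0 - w 0 / s)" if "y \<in> T" for y
    using max[of "\<phi> y"] that 1(2-4,6) by auto
  from max_barrier[OF s \<epsilon> this] show ?thesis
    using 1(2,4,6,7) by simp
qed

lemma shrinker_pinching_ge: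
  fixes X :: "real^'m::finite \<Rightarrow> real^'n::finite"
  assumes shr: "shrinker_on S X \<nu> h" and x0: "x0 \<in> S"
  shows "pinching X \<nu> h x0 \<ge> 1 / real CARD('m)"
  using adapted_at[OF shr x0]
proof cases
  case (1 \<phi> T)
  interpret adapted_shrinker T "\<lambda>y. X (\<phi> y)" "\<lambda>y. \<nu> (\<phi> y)" "\<lambda>y. h (\<phi> y)" by (rule 1(1))
  show ?thesis using pinching_ge 1(2,4,6) by simp
qed

lemma shrinker_constant_mean_curvature:
  assumes shr: "shrinker_on S X \<nu> h" and x0: "x0 \<in> S"
    and z: "\<And>x. x \<in> S \<Longrightarrow> normal_speed X \<nu> h x = 0"
  shows "shape_sq X \<nu> x0 = 1"
  using adapted_at[OF shr x0]
proof cases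
  case (1 \<phi> T)
  interpret adapted_shrinker T "\<lambda>y. X (\<phi> y)" "\<lambda>y. \<nu> (\<phi> y)" "\<lambda>y. h (\<phi> y)" by (rule 1(1))
  have "normal_speed (\<lambda>y. X (\<phi> y)) (\<lambda>y. \<nu> (\<phi> y)) (\<lambda>y. h (\<phi> y)) y = 0" if "y \<in> T" for y
    using z[of "\<phi> y"] that 1(3,7) by auto
  from constant_mean_curvature[OF this] show ?thesis
    using 1(2,4,5) by simp
qed

text \<open>F = F^T - h nu is an orthogonal decomposition, so |F|^2 - h^2 = |F^T|^2.\<close>

lemma shrinker_norm_position:
  assumes shr: "shrinker_on S X \<nu> h" and x: "x \<in> S"
  shows "X x \<bullet> X x \<ge> (h x)\<^sup>2"
proof -
  have "X x \<bullet> \<nu> x = - h x"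
  proof -
    have "(X x + h x *\<^sub>R \<nu> x) \<bullet> \<nu> x = 0"
      using shrinker_onD(7,9)[OF shr x] by (auto simp: normal_space_def orthogonal_comp_def orthogonal_def)
    then show ?thesis using shrinker_onD(6)[OF shr x] by (simp add: inner_add_left)
  qed
  then have "X x \<bullet> X x - (h x)\<^sup>2 = (X x + h x *\<^sub>R \<nu> x) \<bullet> (X x + h x *\<^sub>R \<nu> x)"
    using shrinker_onD(6)[OF shr x]
    by (simp add: inner_add_left inner_add_right inner_commute[of "\<nu> x" "X x"] power2_eq_square)
  then show ?thesis using inner_ge_zero[of "X x + h x *\<^sub>R \<nu> x"] by linarith
qed

text \<open>At a maximum of |F|^2 its gradient 2 F^T vanishes.\<close>

lemma shrinker_max_norm_position:
  assumes shr: "shrinker_on S X \<nu> h" and x0: "x0 \<in> S"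
    and max: "\<And>x. x \<in> S \<Longrightarrow> X x \<bullet> X x \<le> X x0 \<bullet> X x0"
  shows "X x0 \<bullet> X x0 = (h x0)\<^sup>2"
proof -
  note s = shrinker_onD[OF shr]
  note diff = s(11)[OF x0]
  have "pd i X x0 \<bullet> X x0 = 0" for i
    using local_max_partial_deriv(1)[OF smooth_on_inner[OF s(1) s(1)] x0 max, of i]
      partial_deriv_inner[OF s(1) s(1) x0, of i]
    by (simp add: inner_commute)
  then have "X x0 \<in> normal_space X x0"
    by (simp add: normal_space_iff[OF diff])
  then have "normal_part X x0 (X x0) = X x0"
    using subspace_0[OF subspace_tangent_space[OF diff]] by (intro normal_part_eqI[OF diff]) auto
  then have "X x0 = - (h x0 *\<^sub>R \<nu> x0)"
    using shrinker_on_normal_part[OF shr x0] by simp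
  then have "X x0 \<bullet> X x0 = (h x0)\<^sup>2 * (\<nu> x0 \<bullet> \<nu> x0)"
    by (metis inner_minus_left inner_minus_right inner_scaleR_left inner_scaleR_right minus_minus
        mult.assoc power2_eq_square)
  then show ?thesis using s(6)[OF x0] by simp
qed

lemma smooth_on_pinching:
  assumes shr: "shrinker_on S X \<nu> h"
  shows "smooth_on (pinching X \<nu> h) S"
  unfolding pinching_def[abs_def] using shrinker_onD(5)[OF shr]
  by (intro smooth_on_divide smooth_on_shape_sq[OF shr] smooth_on_mult shrinker_onD(3)[OF shr])
     (metis mult_pos_pos less_irrefl)

section \<open>Charts, continuity and transition maps\<close>

lemma is_chart_inj_on:
  assumes "is_chart M c"
  shows "inj_on (chart_map c) (chart_dom c)"
proof -
  have "topspace (subtopology M (chart_dom c)) = chart_dom c"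
    using assms openin_subset[of M "chart_dom c"] by (auto simp: is_chart_def)
  then show ?thesis
    using assms homeomorphic_imp_injective_map unfolding is_chart_def by metis
qed

lemma in_chart_chart_map:
  assumes "is_chart M c" "p \<in> chart_dom c"
  shows "in_chart c f (chart_map c p) = f p"
  by (simp add: in_chart_def inv_into_f_f[OF is_chart_inj_on[OF assms(1)] assms(2)])

lemma continuous_map_charts:
  fixes g :: "'a \<Rightarrow> 'b::topological_space" and \<A> :: "('a, 'm::finite) chart set"
  assumes M: "smooth_manifold M \<A>"
    and cont: "\<And>c. c \<in> \<A> \<Longrightarrow> continuous_on (chart_image c) (g' c)"
    and g: "\<And>c p. c \<in> \<A> \<Longrightarrow> p \<in> chart_dom c \<Longrightarrow> g p = g' c (chart_map c p)"
  shows "continuous_map M euclidean g"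
  unfolding continuous_map_def
proof (intro conjI allI impI)
  fix U :: "'b set" assume U: "openin euclidean U"
  have "openin M {p \<in> chart_dom c. g p \<in> U}" if c: "c \<in> \<A>" for c
  proof -
    have ch: "is_chart M c" using M c by (simp add: smooth_manifold_def)
    then have top: "topspace (subtopology M (chart_dom c)) = chart_dom c"
      using openin_subset[of M "chart_dom c"] by (auto simp: is_chart_def)
    have "continuous_map (subtopology M (chart_dom c)) (top_of_set (chart_image c)) (chart_map c)"
      using ch by (simp add: is_chart_def homeomorphic_imp_continuous_map)
    moreover have "continuous_map (top_of_set (chart_image c)) euclidean (g' c)"
      using cont[OF c] by simp
    ultimately have "continuous_map (subtopology M (chart_dom c)) euclidean (g' c \<circ> chart_map c)"
      by (rule continuous_map_compose)
    then have "openin (subtopology M (chart_dom c)) {p \<in> chart_dom c. (g' c \<circ> chart_map c) p \<in> U}"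
      using U top unfolding continuous_map_def by metis
    moreover have "{p \<in> chart_dom c. (g' c \<circ> chart_map c) p \<in> U} = {p \<in> chart_dom c. g p \<in> U}"
      using g[OF c] by auto
    ultimately show ?thesis
      using ch openin_open_subtopology by (metis (no_types, lifting) is_chart_def)
  qed
  then have "openin M (\<Union>c\<in>\<A>. {p \<in> chart_dom c. g p \<in> U})"
    by blast
  moreover have "(\<Union>c\<in>\<A>. {p \<in> chart_dom c. g p \<in> U}) = {p \<in> topspace M. g p \<in> U}"
    using M by (auto simp: smooth_manifold_def)
  ultimately show "openin M {p \<in> topspace M. g p \<in> U}" by simp
qed auto

lemma compactin_attains_sup:
  fixes g :: "'a \<Rightarrow> real"
  assumes "compactin M C" "C \<noteq> {}" "continuous_map M euclidean g"
  obtains p where "p \<in> C" "\<And>q. q \<in> C \<Longrightarrow> g q \<le> g p"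
proof -
  have "compact (g ` C)"
    using image_compactin[OF assms(1,3)] by simp
  then show ?thesis
    using compact_attains_sup[of "g ` C"] assms(2) that by auto
qed

text \<open>The transition map reparametrises one chart expression of F into the other, and the
  shrinker data of both agree by \<open>shrinker_on_unique\<close>;
  \<open>reparam_invariants\<close> does the rest.\<close>

lemma atlas_transition:
  fixes F :: "'a \<Rightarrow> real^'n::finite" and \<A> :: "('a, 'm::finite) chart set"
  assumes M: "smooth_manifold M \<A>" and c: "c \<in> \<A>" and d: "d \<in> \<A>"
    and p: "p \<in> chart_dom c" "p \<in> chart_dom d"
    and shc: "shrinker_on (chart_image c) (in_chart c F) \<nu> h"
    and shd: "shrinker_on (chart_image d) (in_chart d F) \<mu> k"
  shows "h (chart_map c p) = k (chart_map d p)"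
    and "pinching (in_chart c F) \<nu> h (chart_map c p) = pinching (in_chart d F) \<mu> k (chart_map d p)"
    and "normal_speed (in_chart c F) \<nu> h (chart_map c p) = normal_speed (in_chart d F) \<mu> k (chart_map d p)"
proof -
  define \<phi> where "\<phi> = in_chart c (chart_map d)"
  define T where "T = chart_map c ` (chart_dom c \<inter> chart_dom d)"
  have ch: "is_chart M c" "is_chart M d" and sm: "smooth_on \<phi> T"
    using M c d unfolding smooth_manifold_def \<phi>_def T_def by blast+
  note T = smooth_on_open[OF sm]
  have pq: "\<phi> (chart_map c q) = chart_map d q" if "q \<in> chart_dom c" for q
    unfolding \<phi>_def by (rule in_chart_chart_map[OF ch(1) that])
  have Tc: "T \<subseteq> chart_image c" unfolding T_def chart_image_def by auto
  have Td: "\<phi> ` T \<subseteq> chart_image d" unfolding T_def chart_image_def using pq by auto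
  have eq: "in_chart c F y = in_chart d F (\<phi> y)" if "y \<in> T" for y
    using that unfolding T_def
    by (auto simp: pq in_chart_chart_map[OF ch(1)] in_chart_chart_map[OF ch(2)])
  \<comment> \<open>Regularity of the transition map is read off from the immersion in chart c,
    whose derivative factors through it.\<close>
  have inj: "inj (frechet_derivative \<phi> (at y))" if y: "y \<in> T" for y
  proof -
    have "inj (frechet_derivative (in_chart c F) (at y))"
      using shrinker_onD(4)[OF shc] Tc y by auto
    moreover have "frechet_derivative (in_chart c F) (at y) v =
       frechet_derivative (in_chart d F) (at (\<phi> y)) (frechet_derivative \<phi> (at y) v)" for v
      by (rule frechet_derivative_compose_eq[OF shrinker_onD(1)[OF shd] sm Td y eq])
    ultimately show ?thesis unfolding inj_def by metis
  qed
  have eq2: "\<nu> y = \<mu> (\<phi> y)" "h y = k (\<phi> y)" if "y \<in> T" for y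
    using shrinker_on_unique[OF shc shrinker_on_reparam[OF shd sm Td inj] T Tc order_refl eq that] by auto
  have y: "chart_map c p \<in> T" using p unfolding T_def by auto
  show "h (chart_map c p) = k (chart_map d p)"
    using eq2(2)[OF y] pq[OF p(1)] by simp
  then show "pinching (in_chart c F) \<nu> h (chart_map c p) = pinching (in_chart d F) \<mu> k (chart_map d p)"
    using reparam_invariants(1)[OF shd shc sm Td Tc eq eq2 y] pq[OF p(1)]
    by (simp add: pinching_def)
  show "normal_speed (in_chart c F) \<nu> h (chart_map c p) = normal_speed (in_chart d F) \<mu> k (chart_map d p)"
    using reparam_invariants(2)[OF shd shc sm Td Tc eq eq2 y] pq[OF p(1)] by simp
qed

text \<open>At u = s the h^2 term vanishes. If u = 1, the factor 1 - 1/s vanishes too; if z = 0, the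
  gradient terms do. What remains is m - 1/s.\<close>

lemma barrier_rate_pos:
  assumes "s > 1 / m" "m > 0" "u = s" "u = 1 \<or> z = 0"
  shows "barrier_rate m s u h z F > 0"
proof -
  have "s > 0"
    using assms(1,2) by (intro less_trans[of 0 "1 / m" s]) auto
  moreover from this have "m - 1 / s > 0"
    using assms(1,2) by (simp add: field_simps)
  ultimately show ?thesis
    using assms(3,4) by (auto simp: barrier_rate_def)
qed

section \<open>The global argument on the compact manifold\<close>

lemma parallel_principal_normal_imp_spherical:
  fixes M :: "'a topology" and \<A> :: "('a, 'm::finite) chart set" and F :: "'a \<Rightarrow> real^'n::finite"
  assumes m: "CARD('m) \<ge> 2" and M: "smooth_manifold M \<A>" and comp: "compact_space M"
    and imm: "smooth_immersion \<A> F" and shr: "self_shrinker \<A> F"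
    and H: "mean_curvature_nowhere_zero \<A> F" and par: "parallel_principal_normal \<A> F"
  shows "spherical M F"
proof (cases "topspace M = {}")
  case True
  then show ?thesis by (auto simp: spherical_def intro: exI[of _ 1])
next
  case ne: False
  define n where "n = real CARD('m)"
  have n: "n \<ge> 2" using m by (simp add: n_def)
  define \<nu> where "\<nu> c = principal_normal (in_chart c F)" for c :: "('a, 'm) chart"
  define hc where "hc c x = norm (normal_part (in_chart c F) x (in_chart c F x))" for c :: "('a, 'm) chart" and x
  have sh: "shrinker_on (chart_image c) (in_chart c F) (\<nu> c) (hc c)" if c: "c \<in> \<A>" for c
    unfolding \<nu>_def hc_def using c imm shr H par
    by (intro shrinker_onI)
       (auto simp: smooth_immersion_def self_shrinker_def mean_curvature_nowhere_zero_def
         parallel_principal_normal_def)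
  have chart: "is_chart M c" if "c \<in> \<A>" for c using M that by (simp add: smooth_manifold_def)
  have cover: "\<exists>c. c \<in> \<A> \<and> p \<in> chart_dom c" if "p \<in> topspace M" for p
    using M that unfolding smooth_manifold_def by blast
  have dom: "p \<in> topspace M" if "c \<in> \<A>" "p \<in> chart_dom c" for c p
    using M that unfolding smooth_manifold_def by blast
  have img: "chart_map c p \<in> chart_image c" if "p \<in> chart_dom c" for c :: "('a, 'm) chart" and p
    using that by (simp add: chart_image_def)
  have img_ex: "\<exists>q. q \<in> chart_dom c \<and> x = chart_map c q" if "x \<in> chart_image c" for c :: "('a, 'm) chart" and x
    using that by (auto simp: chart_image_def)
  \<comment> \<open>Global functions are read in a chosen chart at each point; independence of the
    choice, proved by \<open>atlas_transition\<close>, makes them continuous and comparable along a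
    whole chart.\<close>
  define ch where "ch p = (SOME c. c \<in> \<A> \<and> p \<in> chart_dom c)" for p
  have ch: "ch p \<in> \<A>" "p \<in> chart_dom (ch p)" if "p \<in> topspace M" for p
    using someI_ex[OF cover[OF that]] by (auto simp: ch_def)
  define u where "u p = pinching (in_chart (ch p) F) (\<nu> (ch p)) (hc (ch p)) (chart_map (ch p) p)" for p
  define h where "h p = hc (ch p) (chart_map (ch p) p)" for p
  define z where "z p = normal_speed (in_chart (ch p) F) (\<nu> (ch p)) (hc (ch p)) (chart_map (ch p) p)" for p
  have F_eq: "in_chart c F (chart_map c p) = F p" if "c \<in> \<A>" "p \<in> chart_dom c" for c p
    by (rule in_chart_chart_map[OF chart[OF that(1)] that(2)])
  have h_eq: "h p = hc c (chart_map c p)"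
    and u_eq: "u p = pinching (in_chart c F) (\<nu> c) (hc c) (chart_map c p)"
    and z_eq: "z p = normal_speed (in_chart c F) (\<nu> c) (hc c) (chart_map c p)"
    if "c \<in> \<A>" "p \<in> chart_dom c" for c p
    using atlas_transition[OF M ch(1)[OF dom[OF that]] that(1) ch(2)[OF dom[OF that]] that(2)
        sh[OF ch(1)[OF dom[OF that]]] sh[OF that(1)]]
    unfolding h_def u_def z_def by auto
  have h_pos: "h p > 0" if "p \<in> topspace M" for p
    using shrinker_onD(5)[OF sh[OF ch(1)[OF that]] img[OF ch(2)[OF that]]] by (simp add: h_def)
  have contF: "continuous_on (chart_image c) (in_chart c F)"
    and conth: "continuous_on (chart_image c) (hc c)"
    and contu: "continuous_on (chart_image c) (pinching (in_chart c F) (\<nu> c) (hc c))"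
    and contz: "continuous_on (chart_image c) (normal_speed (in_chart c F) (\<nu> c) (hc c))"
    if "c \<in> \<A>" for c
    using shrinker_onD(1,3)[OF sh[OF that]] smooth_on_pinching[OF sh[OF that]]
      smooth_on_normal_speed[OF sh[OF that]] by (auto intro: smooth_on_continuous_on)
  have hc_pos: "hc c x > 0" if "c \<in> \<A>" "x \<in> chart_image c" for c x
    using shrinker_onD(5)[OF sh[OF that(1)] that(2)] .
  have cu: "continuous_map M euclidean u"
    by (rule continuous_map_charts[OF M contu]) (auto simp: u_eq)
  have compM: "compactin M (topspace M)" using comp by (simp add: compact_space_def)
  have A: "u p = 1 \<or> z p = 0" if p: "p \<in> topspace M" and max: "\<And>q. q \<in> topspace M \<Longrightarrow> u q \<le> u p" for p
  proof -
    note c = ch[OF p]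
    show ?thesis
      unfolding u_def[of p] z_def[of p]
    proof (rule shrinker_max_pinching[OF sh[OF c(1)] img[OF c(2)]])
      fix x assume "x \<in> chart_image (ch p)"
      then obtain q where q: "q \<in> chart_dom (ch p)" "x = chart_map (ch p) q" using img_ex by blast
      show "pinching (in_chart (ch p) F) (\<nu> (ch p)) (hc (ch p)) x \<le>
        pinching (in_chart (ch p) F) (\<nu> (ch p)) (hc (ch p)) (chart_map (ch p) p)"
        using max[OF dom[OF c(1) q(1)]] u_eq[OF c(1) q(1)] u_eq[OF c] q(2) by simp
    qed
  qed
  have ge: "u p \<ge> 1 / n" if p: "p \<in> topspace M" for p
    unfolding u_def n_def by (rule shrinker_pinching_ge[OF sh[OF ch(1)[OF p]] img[OF ch(2)[OF p]]])
  obtain p0 where p0: "p0 \<in> topspace M" "\<And>q. q \<in> topspace M \<Longrightarrow> u q \<le> u p0"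
    using compactin_attains_sup[OF compM ne cu] by blast
  define s where "s = u p0"
  have s: "s \<ge> 1 / n" "s > 0"
    using ge[OF p0(1)] n by (auto simp: s_def intro: less_le_trans[of 0 "1 / n"])
  define E where "E p = exp (F p \<bullet> F p / 2 - ln (h p) / s)" for p
  define Q where "Q p = barrier_rate n s (u p) (h p) (z p) (F p)" for p
  have B: "Q p \<le> 0" if p: "p \<in> topspace M" and e: "\<epsilon> > 0"
    and max: "\<And>q. q \<in> topspace M \<Longrightarrow> u q + \<epsilon> * E q \<le> u p + \<epsilon> * E p" for p \<epsilon>
  proof -
    note c = ch[OF p]
    have "barrier_rate n s (pinching (in_chart (ch p) F) (\<nu> (ch p)) (hc (ch p)) (chart_map (ch p) p))
      (hc (ch p) (chart_map (ch p) p))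
      (normal_speed (in_chart (ch p) F) (\<nu> (ch p)) (hc (ch p)) (chart_map (ch p) p))
      (in_chart (ch p) F (chart_map (ch p) p)) \<le> 0"
      unfolding n_def
    proof (rule shrinker_max_barrier[OF sh[OF c(1)] img[OF c(2)] s(2) e])
      fix x assume "x \<in> chart_image (ch p)"
      then obtain q where q: "q \<in> chart_dom (ch p)" "x = chart_map (ch p) q" using img_ex by blast
      show "pinching (in_chart (ch p) F) (\<nu> (ch p)) (hc (ch p)) x +
         \<epsilon> * exp (in_chart (ch p) F x \<bullet> in_chart (ch p) F x / 2 - ln (hc (ch p) x) / s)
        \<le> pinching (in_chart (ch p) F) (\<nu> (ch p)) (hc (ch p)) (chart_map (ch p) p) +
         \<epsilon> * exp (in_chart (ch p) F (chart_map (ch p) p) \<bullet> in_chart (ch p) F (chart_map (ch p) p) / 2 -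
           ln (hc (ch p) (chart_map (ch p) p)) / s)"
        using max[OF dom[OF c(1) q(1)]] unfolding E_def q(2)
        by (simp only: u_eq[OF c(1) q(1)] u_eq[OF c] h_eq[OF c(1) q(1)] h_eq[OF c]
            F_eq[OF c(1) q(1)] F_eq[OF c])
    qed
    then show ?thesis
      by (simp add: Q_def u_def h_def z_def F_eq[OF c])
  qed
  have s_eq: "s = 1 / n"
  proof (rule ccontr)
    assume "s \<noteq> 1 / n"
    then have s1: "s > 1 / n" using s by simp
    have cE: "continuous_map M euclidean E"
    proof (rule continuous_map_charts[OF M, where g' = "\<lambda>c x. exp (in_chart c F x \<bullet> in_chart c F x / 2 - ln (hc c x) / s)"])
      show "continuous_on (chart_image c) (\<lambda>x. exp (in_chart c F x \<bullet> in_chart c F x / 2 - ln (hc c x) / s))"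
        if "c \<in> \<A>" for c
        using hc_pos[OF that] s(2) by (intro continuous_intros contF conth that) (auto simp: less_le)
    qed (simp add: E_def F_eq h_eq)
    have cQ: "continuous_map M euclidean Q"
    proof (rule continuous_map_charts[OF M, where g' = "\<lambda>c x. barrier_rate n s
        (pinching (in_chart c F) (\<nu> c) (hc c) x) (hc c x)
        (normal_speed (in_chart c F) (\<nu> c) (hc c) x) (in_chart c F x)"])
      show "continuous_on (chart_image c) (\<lambda>x. barrier_rate n s
        (pinching (in_chart c F) (\<nu> c) (hc c) x) (hc c x)
        (normal_speed (in_chart c F) (\<nu> c) (hc c) x) (in_chart c F x))"
        if "c \<in> \<A>" for c
        unfolding barrier_rate_def using hc_pos[OF that] s(2)
        by (intro continuous_intros contF conth contu contz that) (auto simp: less_le)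
    qed (simp add: Q_def F_eq h_eq u_eq z_eq)
    have Q_pos: "Q p > 0" if "p \<in> topspace M" "u p = s" for p
    proof -
      have "u p = 1 \<or> z p = 0"
        by (rule A[OF that(1)]) (use p0(2) that(2) in \<open>simp add: s_def\<close>)
      then show ?thesis
        unfolding Q_def using s1 n that(2) by (intro barrier_rate_pos) auto
    qed
    \<comment> \<open>Q is L E / E. It is positive where u = s, so the compact set where it is not
      positive misses the maximum set of u.\<close>
    define C where "C = {p \<in> topspace M. Q p \<in> {..0}}"
    have "closedin M C"
      unfolding C_def by (rule closedin_continuous_map_preimage[OF cQ]) simp
    then have C: "compactin M C"
      using closedin_compact_space[OF comp] by blast
    obtain e where e: "e \<in> topspace M" "\<And>q. q \<in> topspace M \<Longrightarrow> E q \<le> E e"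
      using compactin_attains_sup[OF compM ne cE] by blast
    have E_pos: "E p > 0" for p by (simp add: E_def)
    \<comment> \<open>u attains its maximum on C, strictly below s; for empty C any positive gap
      will do.\<close>
    have "\<exists>\<delta>>0. \<forall>p\<in>C. u p \<le> s - \<delta>"
    proof (cases "C = {}")
      case False
      obtain p1 where p1: "p1 \<in> C" "\<And>q. q \<in> C \<Longrightarrow> u q \<le> u p1"
        using compactin_attains_sup[OF C False cu] by blast
      have "u p1 \<noteq> s" using Q_pos[of p1] p1(1) by (auto simp: C_def)
      then have "u p1 < s" using p0(2)[of p1] p1(1) by (simp add: C_def s_def)
      then show ?thesis using p1(2) by (intro exI[of _ "s - u p1"]) auto
    qed (auto intro: exI[of _ 1])
    then obtain \<delta> where \<delta>: "\<delta> > 0" "\<And>p. p \<in> C \<Longrightarrow> u p \<le> s - \<delta>" by blast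
    \<comment> \<open>With this size the perturbation never exceeds the gap: epsilon E <= \<delta>
      everywhere.\<close>
    define \<epsilon> where "\<epsilon> = \<delta> / E e"
    have \<epsilon>: "\<epsilon> > 0" using \<delta>(1) E_pos by (simp add: \<epsilon>_def)
    have "continuous_map M euclidean (\<lambda>p. u p + \<epsilon> * E p)"
      using cu cE by (intro continuous_intros) auto
    then obtain p where p: "p \<in> topspace M" "\<And>q. q \<in> topspace M \<Longrightarrow> u q + \<epsilon> * E q \<le> u p + \<epsilon> * E p"
      using compactin_attains_sup[OF compM ne] by blast
    \<comment> \<open>By \<open>B\<close> a maximum point of u + epsilon E lies in C. There the sum
      is at most s - \<delta> + \<delta> = s, but at p0 it exceeds s.\<close>
    have "p \<in> C" using B[OF p(1) \<epsilon> p(2)] p(1) by (simp add: C_def)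
    then have "u p \<le> s - \<delta>" by (rule \<delta>(2))
    moreover have "\<epsilon> * E p \<le> \<epsilon> * E e" using e(2)[OF p(1)] \<epsilon> by simp
    moreover have "\<epsilon> * E e = \<delta>" using E_pos[of e] by (simp add: \<epsilon>_def)
    moreover have "s + \<epsilon> * E p0 \<le> u p + \<epsilon> * E p" using p(2)[OF p0(1)] by (simp add: s_def)
    moreover have "\<epsilon> * E p0 > 0" using \<epsilon> E_pos by simp
    ultimately show False by linarith
  qed
  have u: "u p = 1 / n" if "p \<in> topspace M" for p
    using ge[OF that] p0(2)[OF that] s_eq by (simp add: s_def)
  \<comment> \<open>Every point is now a maximum of u, and u = 1/m < 1 since m is at least 2; the
    alternative u = 1 is excluded.\<close>
  have z: "z p = 0" if "p \<in> topspace M" for p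
    using A[OF that] u n that by auto
  have h: "(h p)\<^sup>2 = n" if p: "p \<in> topspace M" for p
  proof -
    note c = ch[OF p]
    have "normal_speed (in_chart (ch p) F) (\<nu> (ch p)) (hc (ch p)) x = 0" if x: "x \<in> chart_image (ch p)" for x
      using img_ex[OF x] z_eq[OF c(1)] z dom[OF c(1)] by metis
    then have "shape_sq (in_chart (ch p) F) (\<nu> (ch p)) (chart_map (ch p) p) = 1"
      by (rule shrinker_constant_mean_curvature[OF sh[OF c(1)] img[OF c(2)]])
    then have "u p = 1 / (h p)\<^sup>2"
      by (simp add: u_def h_def pinching_def power2_eq_square)
    then show ?thesis using u[OF p] n h_pos[OF p] by (simp add: field_simps)
  qed
  \<comment> \<open>|F|^2 is at least m everywhere, and its maximum equals h^2 = m at p1; no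
    connectedness argument is required.\<close>
  have lower: "F p \<bullet> F p \<ge> n" if p: "p \<in> topspace M" for p
    using shrinker_norm_position[OF sh[OF ch(1)[OF p]] img[OF ch(2)[OF p]]] h[OF p]
    by (simp add: F_eq[OF ch[OF p]] h_def)
  have "continuous_map M euclidean (\<lambda>p. F p \<bullet> F p)"
  proof (rule continuous_map_charts[OF M, where g' = "\<lambda>c x. in_chart c F x \<bullet> in_chart c F x"])
    show "continuous_on (chart_image c) (\<lambda>x. in_chart c F x \<bullet> in_chart c F x)" if "c \<in> \<A>" for c
      by (intro continuous_intros contF that)
  qed (simp add: F_eq)
  then obtain p1 where p1: "p1 \<in> topspace M" "\<And>q. q \<in> topspace M \<Longrightarrow> F q \<bullet> F q \<le> F p1 \<bullet> F p1"
    using compactin_attains_sup[OF compM ne] by blast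
  note c = ch[OF p1(1)]
  have "in_chart (ch p1) F (chart_map (ch p1) p1) \<bullet> in_chart (ch p1) F (chart_map (ch p1) p1) =
      (hc (ch p1) (chart_map (ch p1) p1))\<^sup>2"
  proof (rule shrinker_max_norm_position[OF sh[OF c(1)] img[OF c(2)]])
    fix x assume "x \<in> chart_image (ch p1)"
    then obtain q where q: "q \<in> chart_dom (ch p1)" "x = chart_map (ch p1) q" using img_ex by blast
    show "in_chart (ch p1) F x \<bullet> in_chart (ch p1) F x \<le>
      in_chart (ch p1) F (chart_map (ch p1) p1) \<bullet> in_chart (ch p1) F (chart_map (ch p1) p1)"
      using p1(2)[OF dom[OF c(1) q(1)]] by (simp add: q(2) F_eq[OF c(1) q(1)] F_eq[OF c])
  qed
  then have "F p1 \<bullet> F p1 = n"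
    using h[OF p1(1)] by (simp add: F_eq[OF c] h_def)
  then have "norm (F p) = sqrt n" if "p \<in> topspace M" for p
    using lower[OF that] p1(2)[OF that] by (simp add: norm_eq_sqrt_inner)
  then have "F ` topspace M \<subseteq> sphere 0 (sqrt n)" by auto
  then show ?thesis
    unfolding spherical_def using n by (intro exI[of _ 0] exI[of _ "sqrt n"]) auto
qed

theorem theorem1p1:
  fixes M :: "'a topology"
    and \<A> :: "('a, 'm::finite) chart set"
    and F :: "'a \<Rightarrow> real^'n::finite"
  assumes "CARD('m) \<ge> 2"
    and "smooth_manifold M \<A>"
    and "compact_space M"
    and "smooth_immersion \<A> F"
    and "self_shrinker \<A> F"
  shows "spherical M F \<longleftrightarrow>
           mean_curvature_nowhere_zero \<A> F \<and> parallel_principal_normal \<A> F"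
proof
  assume "spherical M F"
  then obtain a r where r: "F ` topspace M \<subseteq> sphere a r" by (auto simp: spherical_def)
  have "mean_curvature (in_chart c F) x \<noteq> 0 \<and>
      normal_connection (in_chart c F) i (principal_normal (in_chart c F)) x = 0"
    if c: "c \<in> \<A>" and x: "x \<in> chart_image c" for c x i
  proof -
    have X: "smooth_on (in_chart c F) (chart_image c)"
      and inj: "\<And>x. x \<in> chart_image c \<Longrightarrow> inj (frechet_derivative (in_chart c F) (at x))"
      and shr: "\<And>x. x \<in> chart_image c \<Longrightarrow>
        mean_curvature (in_chart c F) x = - normal_part (in_chart c F) x (in_chart c F x)"
      using assms(4,5) c by (auto simp: smooth_immersion_def self_shrinker_def)
    have rad: "(in_chart c F y - a) \<bullet> (in_chart c F y - a) = r\<^sup>2" if y: "y \<in> chart_image c" for y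
    proof -
      obtain q where q: "q \<in> chart_dom c" "y = chart_map c q" using y by (auto simp: chart_image_def)
      have "is_chart M c" "q \<in> topspace M"
        using assms(2) c q(1) unfolding smooth_manifold_def by blast+
      then have "in_chart c F y = F q" "norm (F q - a) = r"
        using q r by (auto simp: in_chart_chart_map dist_norm norm_minus_commute)
      then show ?thesis by (simp add: dot_square_norm)
    qed
    show ?thesis
      using spherical_self_shrinker_local[OF X inj shr rad x] by blast
  qed
  then show "mean_curvature_nowhere_zero \<A> F \<and> parallel_principal_normal \<A> F"
    by (auto simp: mean_curvature_nowhere_zero_def parallel_principal_normal_def)
next
  assume "mean_curvature_nowhere_zero \<A> F \<and> parallel_principal_normal \<A> F"
  then show "spherical M F"
    using parallel_principal_normal_imp_spherical assms by blast
qed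

end
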